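(* Let $h$ be a hermitian form of signature $(3,p)$ on $\mathbb{C}^{3+p}$, let $\Omega=\{l\in\mathbb{P}^{p+2}\mid h \text{ is positive definite on } l\}$ and let $\omega=i\Theta(\mathcal{O}_{\mathbb{P}^{p+2}}(-1)|_\Omega,h)$. Let $f:\mathbb{C}\to\Omega$ be a non-constant holomorphic map such that $f'(\mathbb{C})\subset\mathbb{P}(\Omega^1_\Omega)^+$. Let $\beta=\psi\otimes dz$ be the second fundamental form of $\mathcal{L}=f'^*\mathcal{O}_{\mathbb{P}(\Omega^1_\Omega)}(-1)\subset f^*T_\Omega$ with respect to $f^*\omega$, and let $\sigma_f:=\|\psi\|^2_{f^*\omega}\,\frac{i}{2}dz\wedge d\overline z$. Let $\gamma>0$ be the constant such that the holomorphic sectional curvature of $\omega$ equals $-\gamma$ on all of $\mathbb{P}(\Omega^1_\Omega)^+$. Then $$\gamma\,T_{f,\omega}(r)+T_{\sigma_f}(r)\leqslant_{\mathrm{exc}}O\big(\log(r)+\log(T_{f,\omega}(r))\big),$$ where the subscript $\mathrm{exc}$ means that the inequality holds for $r$ outside a subset of finite Lebesgue measure in $[1,+\infty[$.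
   Context: $\mathbb{P}^{p+2}$ is the space of lines in $\mathbb{C}^{3+p}$. The form $\omega$ (locally $-i\partial\overline\partial\log h(s,s)$ for a local non-vanishing holomorphic section $s$ of $\mathcal{O}(-1)$) is a closed non-degenerate real $(1,1)$-form of signature $(p,2)$ on $\Omega$, i.e. a pseudo-Kähler metric; a hermitian metric $(h_{jk})$ and its form are related by $\omega=\sum h_{jk}\frac{i}{2}dz_j\wedge d\overline z_k$, and we also write $\omega$ for the metric. $\mathbb{P}(\Omega^1_\Omega)$ is the bundle of lines in $T_\Omega$, and $\mathbb{P}(\Omega^1_\Omega)^+$ is the open subset of lines on which $\omega$ is positive definite. For non-constant $f$, $f':\mathbb{C}\to\mathbb{P}(\Omega^1_\Omega)$ is its lift by the direction of the derivative (extended holomorphically across zeros of $df$), and $\mathcal{L}=f'^*\mathcal{O}_{\mathbb{P}(\Omega^1_\Omega)}(-1)$ is the corresponding line subbundle of $f^*T_\Omega$; by hypothesis $f^*\omega$ is positive definite on $\mathcal{L}$. For a holomorphic bundle $E$ with a non-degenerate (possibly indefinite) hermitian metric there is a unique Chern connection $\nabla$ (compatible with the metric, with $\nabla^{0,1}=\overline\partial$), with curvature $\Theta$. Let $\nabla$ be the Chern connection of $(f^*T_\Omega,f^*\omega)$ and $\mathcal{L}^\perp$ the $f^*\omega$-orthogonal complement of $\mathcal{L}$; the second fundamental form is $\beta(V)\cdot s=\mathrm{pr}_{\mathcal{L}^\perp}(\nabla_V s)$, for $V$ a vector field on $\mathbb{C}$ and $s$ a section of $\mathcal{L}$. It is a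 $(1,0)$-form with values in $\mathrm{Hom}(\mathcal{L},\mathcal{L}^\perp)$, and $\psi$ is the section of $\mathrm{Hom}(\mathcal{L},\mathcal{L}^\perp)$ with $\beta=\psi\otimes dz$. The quantity $\|\psi\|^2_{f^*\omega}:=\|\psi(X)\|^2_{f^*\omega}/\|X\|^2_{f^*\omega}$, for $X\neq0$ in $\mathcal{L}$, is real but may be negative since $f^*\omega$ is indefinite on $\mathcal{L}^\perp$. The holomorphic sectional curvature of a pseudo-hermitian metric $g$ at a non-isotropic vector $u$ of type $(1,0)$ is $g(\Theta(T,g)(u,\overline u)u,u)/g(u,u)^2$; it depends only on the line spanned by $u$. For $\omega$, it equals a negative constant $-\gamma$ on all lines in $\mathbb{P}(\Omega^1_\Omega)^+$. For a $(1,1)$-form $\alpha$ on $\mathbb{C}$, $T_\alpha(r)=\int_1^r\frac{dt}{t}\int_{\Delta_t}\alpha$, $r\geqslant1$, with $\Delta_t$ the disk of radius $t$ centered at $0$; $T_{f,\omega}:=T_{f^*\omega}$. The implicit constant in $O(\cdot)$ may depend on $f$. *)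

theory Defs
  imports "HOL-Analysis.Analysis"
begin

section \<open>Hermitian forms and projective space\<close>

definition hermitian_form :: "(complex^'n \<Rightarrow> complex^'n \<Rightarrow> complex) \<Rightarrow> bool" where
  "hermitian_form h \<longleftrightarrow>
     (\<forall>x y z. h (x + y) z = h x z + h y z) \<and>
     (\<forall>c x y. h (c *s x) y = c * h x y) \<and>
     (\<forall>x y. h y x = cnj (h x y))"

text \<open>\<open>h\<close> has signature \<open>(a, b)\<close>, and is in particular non-degenerate: there is an orthogonal basis
  of the whole space with \<open>a\<close> positive and \<open>b\<close> negative vectors.\<close>

definition has_signature :: "(complex^'n \<Rightarrow> complex^'n \<Rightarrow> complex) \<Rightarrow> nat \<Rightarrow> nat \<Rightarrow> bool" where
  "has_signature h a b \<longleftrightarrow>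
     (\<exists>P N. finite P \<and> finite N \<and> P \<inter> N = {} \<and> card P = a \<and> card N = b \<and>
        vec.independent (P \<union> N) \<and> vec.span (P \<union> N) = UNIV \<and>
        (\<forall>x\<in>P \<union> N. \<forall>y\<in>P \<union> N. x \<noteq> y \<longrightarrow> h x y = 0) \<and>
        (\<forall>x\<in>P. Re (h x x) > 0) \<and> (\<forall>x\<in>N. Re (h x x) < 0))"

definition proj_space :: "(complex^'n) set set" where
  "proj_space = {l. vec.subspace l \<and> vec.dim l = 1}"

definition pos_domain :: "(complex^'n \<Rightarrow> complex^'n \<Rightarrow> complex) \<Rightarrow> (complex^'n) set set" where
  "pos_domain h = {l \<in> proj_space. \<forall>x\<in>l. x \<noteq> 0 \<longrightarrow> Re (h x x) > 0}"

text \<open>The standard affine charts. The affine coordinates \<open>x\<^sub>j / x\<^sub>i\<close> (for \<open>j \<noteq> i\<close>) of a line are kept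
  together with the redundant entry \<open>x\<^sub>i / x\<^sub>i = 1\<close>, so that the chart takes its values in the affine
  hyperplane of all \<open>x\<close> with \<open>x\<^sub>i = 1\<close>. Accordingly the tangent vector
  \<open>\<Sum>\<^bsub>j \<noteq> i\<^esub> v\<^sub>j \<partial>/\<partial>z\<^sub>j\<close> of type \<open>(1,0)\<close> is written as the vector \<open>v\<close> with \<open>v\<^sub>i = 0\<close>, and the tangent
  bundle over the chart is trivialised with fibre \<open>chart_fibre i\<close>.\<close>

definition chart_dom :: "'n \<Rightarrow> (complex^'n) set set" where
  "chart_dom i = {l \<in> proj_space. \<exists>x\<in>l. x $ i \<noteq> 0}"

definition chart :: "'n \<Rightarrow> (complex^'n) set \<Rightarrow> complex^'n" where
  "chart i l = (THE x. x \<in> l \<and> x $ i = 1)"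

definition chart_fibre :: "'n \<Rightarrow> (complex^'n) set" where
  "chart_fibre i = {v. v $ i = 0}"

definition pos_region :: "(complex^'n \<Rightarrow> complex^'n \<Rightarrow> complex) \<Rightarrow> 'n \<Rightarrow> (complex^'n) set" where
  "pos_region h i = chart i ` (pos_domain h \<inter> chart_dom i)"

definition chart_preimage :: "(complex \<Rightarrow> (complex^'n) set) \<Rightarrow> 'n \<Rightarrow> complex set" where
  "chart_preimage f i = {z. f z \<in> chart_dom i}"

definition holomorphic_curve :: "(complex \<Rightarrow> (complex^'n) set) \<Rightarrow> bool" where
  "holomorphic_curve f \<longleftrightarrow>
     (\<forall>z. f z \<in> proj_space) \<and>
     (\<forall>i. open (chart_preimage f i) \<and>
          (\<forall>j. (\<lambda>z. chart i (f z) $ j) holomorphic_on chart_preimage f i))"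

section \<open>Directional derivatives and the metric\<close>

definition dird :: "('b::real_normed_vector \<Rightarrow> 'c::real_normed_vector) \<Rightarrow> 'b \<Rightarrow> 'b \<Rightarrow> 'c" where
  "dird F x v = vector_derivative (\<lambda>t::real. F (x + t *\<^sub>R v)) (at 0)"

text \<open>\<open>\<Sum>\<^sub>j v\<^sub>j \<partial>F/\<partial>z\<^sub>j\<close> and \<open>\<Sum>\<^sub>j cnj v\<^sub>j \<partial>F/\<partial>(cnj z\<^sub>j)\<close>, respectively.\<close>

definition del :: "(complex^'n \<Rightarrow> complex) \<Rightarrow> complex^'n \<Rightarrow> complex^'n \<Rightarrow> complex" where
  "del F x v = (dird F x v - \<i> * dird F x (\<i> *s v)) / 2"

definition delbar :: "(complex^'n \<Rightarrow> complex) \<Rightarrow> complex^'n \<Rightarrow> complex^'n \<Rightarrow> complex" where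
  "delbar F x v = (dird F x v + \<i> * dird F x (\<i> *s v)) / 2"

text \<open>In every affine chart \<open>x \<mapsto> x\<close> is a non-vanishing holomorphic section of the tautological line
  bundle, so \<open>\<omega> = -i \<partial>\<partial>bar log h(x,x)\<close>. With the normalisation
  \<open>\<omega> = \<Sum> h\<^sub>j\<^sub>k (i/2) dz\<^sub>j \<and> d(cnj z\<^sub>k)\<close> the coefficients of the associated hermitian metric are
  \<open>h\<^sub>j\<^sub>k = -2 \<partial>\<^sub>j \<partial>bar\<^sub>k log h(x,x)\<close>; \<open>omega_metric h x u v\<close> is \<open>\<Sum> h\<^sub>j\<^sub>k u\<^sub>j (cnj v\<^sub>k)\<close> at the point with
  affine coordinates \<open>x\<close>.\<close>

definition omega_metric ::
  "(complex^'n \<Rightarrow> complex^'n \<Rightarrow> complex) \<Rightarrow> complex^'n \<Rightarrow> complex^'n \<Rightarrow> complex^'n \<Rightarrow> complex" where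
  "omega_metric h x u v =
     - 2 * del (\<lambda>y. delbar (\<lambda>w. complex_of_real (ln (Re (h w w)))) y v) x u"

section \<open>Chern connections\<close>

text \<open>A holomorphic vector bundle over \<open>M\<close>, trivialised by a holomorphic frame, with fibre the complex
  subspace \<open>F\<close> of the space of vectors; \<open>D\<close> is the space of real tangent directions of \<open>M\<close>, \<open>J\<close> its
  complex structure and \<open>g\<close> a (possibly indefinite) hermitian metric on the bundle. A connection is
  \<open>\<nabla> = d + A\<close> with an \<open>End F\<close>-valued 1-form \<open>A\<close>, acting on sections, that is, on functions with
  values in \<open>F\<close>.\<close>

definition nabla ::
  "('b::real_normed_vector \<Rightarrow> 'b \<Rightarrow> complex^'n \<Rightarrow> complex^'n) \<Rightarrow> ('b \<Rightarrow> complex^'n) \<Rightarrow> 'b \<Rightarrow> 'b \<Rightarrow> complex^'n" where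
  "nabla A s x v = dird s x v + A x v (s x)"

text \<open>The second condition is the equality of \<open>(0,1)\<close>-parts \<open>\<nabla>\<^sup>0\<^sup>,\<^sup>1 = \<partial>bar\<close>, where the
  \<open>(0,1)\<close>-part of a vector-valued 1-form \<open>a\<close> is \<open>v \<mapsto> (a v + i a (J v)) / 2\<close>. The third one is
  compatibility with the metric.\<close>

definition chern_connection ::
  "('b \<Rightarrow> 'b) \<Rightarrow> 'b::real_normed_vector set \<Rightarrow> 'b set \<Rightarrow> (complex^'n) set \<Rightarrow>
   ('b \<Rightarrow> complex^'n \<Rightarrow> complex^'n \<Rightarrow> complex) \<Rightarrow>
   ('b \<Rightarrow> 'b \<Rightarrow> complex^'n \<Rightarrow> complex^'n) \<Rightarrow> bool" where
  "chern_connection J M D F g A \<longleftrightarrow>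
     (\<forall>x\<in>M. \<forall>v\<in>D. \<forall>w\<in>F. A x v w \<in> F \<and>
        (\<forall>c. A x v (c *s w) = c *s A x v w) \<and>
        (\<forall>w'\<in>F. A x v (w + w') = A x v w + A x v w') \<and>
        (\<forall>a::real. A x (a *\<^sub>R v) w = a *\<^sub>R A x v w) \<and>
        (\<forall>v'\<in>D. A x (v + v') w = A x v w + A x v' w)) \<and>
     (\<forall>s. \<forall>x\<in>M. (\<forall>y\<in>M. s y \<in> F) \<and> s differentiable (at x within M) \<longrightarrow>
        (\<forall>v\<in>D. (1 / 2) *s (nabla A s x v + \<i> *s nabla A s x (J v))
              = (1 / 2) *s (dird s x v + \<i> *s dird s x (J v)))) \<and>
     (\<forall>s t. \<forall>x\<in>M. (\<forall>y\<in>M. s y \<in> F \<and> t y \<in> F) \<and>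
        s differentiable (at x within M) \<and> t differentiable (at x within M) \<longrightarrow>
        (\<forall>v\<in>D. dird (\<lambda>y. g y (s y) (t y)) x v
              = g x (nabla A s x v) (t x) + g x (s x) (nabla A t x v)))"

text \<open>The Chern connection form is unique on \<open>M\<close>, \<open>D\<close>, \<open>F\<close>; the choice only concerns irrelevant
  arguments.\<close>

definition chern_form ::
  "('b \<Rightarrow> 'b) \<Rightarrow> 'b::real_normed_vector set \<Rightarrow> 'b set \<Rightarrow> (complex^'n) set \<Rightarrow>
   ('b \<Rightarrow> complex^'n \<Rightarrow> complex^'n \<Rightarrow> complex) \<Rightarrow>
   ('b \<Rightarrow> 'b \<Rightarrow> complex^'n \<Rightarrow> complex^'n)" where
  "chern_form J M D F g = (SOME A. chern_connection J M D F g A)"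

text \<open>The curvature \<open>dA + A \<and> A\<close>, evaluated on two real directions (extended to constant vector
  fields) and a vector of the fibre.\<close>

definition curvature ::
  "('b::real_normed_vector \<Rightarrow> 'b \<Rightarrow> complex^'n \<Rightarrow> complex^'n) \<Rightarrow> 'b \<Rightarrow> 'b \<Rightarrow> 'b \<Rightarrow> complex^'n \<Rightarrow> complex^'n" where
  "curvature A x v w e =
     dird (\<lambda>y. A y w e) x v - dird (\<lambda>y. A y v e) x w + A x v (A x w e) - A x w (A x v e)"

text \<open>The value on the pair \<open>(u, cnj u)\<close>, where \<open>u = (v - i Jv)/2\<close> is the vector of type \<open>(1,0)\<close> with
  coordinates \<open>v\<close>. Complex bilinear extension and antisymmetry give
  \<open>\<Theta> ((v - i Jv)/2) ((v + i Jv)/2) = (i/2) \<Theta> v (Jv)\<close>.\<close>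

definition curvature11 ::
  "('b \<Rightarrow> 'b) \<Rightarrow> ('b::real_normed_vector \<Rightarrow> 'b \<Rightarrow> complex^'n \<Rightarrow> complex^'n) \<Rightarrow> 'b \<Rightarrow> 'b \<Rightarrow> complex^'n \<Rightarrow> complex^'n" where
  "curvature11 J A x v e = (\<i> / 2) *s curvature A x v (J v) e"

section \<open>Holomorphic sectional curvature of \<open>\<omega>\<close>\<close>

definition omega_chern_form ::
  "(complex^'n \<Rightarrow> complex^'n \<Rightarrow> complex) \<Rightarrow> 'n \<Rightarrow> complex^'n \<Rightarrow> complex^'n \<Rightarrow> complex^'n \<Rightarrow> complex^'n" where
  "omega_chern_form h i =
     chern_form (\<lambda>v. \<i> *s v) (pos_region h i) (chart_fibre i) (chart_fibre i) (omega_metric h)"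

definition hol_sect_curv ::
  "(complex^'n \<Rightarrow> complex^'n \<Rightarrow> complex) \<Rightarrow> 'n \<Rightarrow> complex^'n \<Rightarrow> complex^'n \<Rightarrow> complex" where
  "hol_sect_curv h i x u =
     omega_metric h x (curvature11 (\<lambda>v. \<i> *s v) (omega_chern_form h i) x u u) u
       / (omega_metric h x u u)\<^sup>2"

text \<open>The holomorphic sectional curvature equals \<open>c\<close> on all lines on which \<open>\<omega>\<close> is positive
  definite.\<close>

definition hol_sect_curv_pos_eq :: "(complex^'n \<Rightarrow> complex^'n \<Rightarrow> complex) \<Rightarrow> real \<Rightarrow> bool" where
  "hol_sect_curv_pos_eq h c \<longleftrightarrow>
     (\<forall>i. \<forall>x\<in>pos_region h i. \<forall>u\<in>chart_fibre i.
        Re (omega_metric h x u u) > 0 \<longrightarrow> hol_sect_curv h i x u = complex_of_real c)"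

section \<open>The lift of a curve and its second fundamental form\<close>

text \<open>For a curve \<open>f\<close>, the bundle \<open>f\<^sup>*T\<close> is trivialised over \<open>chart_preimage f i\<close> with fibre
  \<open>chart_fibre i\<close>.\<close>

definition curve_deriv :: "(complex \<Rightarrow> (complex^'n) set) \<Rightarrow> 'n \<Rightarrow> complex \<Rightarrow> complex^'n" where
  "curve_deriv f i z = (\<chi> j. deriv (\<lambda>\<zeta>. chart i (f \<zeta>) $ j) z)"

text \<open>A non-vanishing holomorphic \<open>s\<close> on a neighbourhood of \<open>z\<close> that represents there the holomorphic
  extension of the direction of the derivative.\<close>

definition lift_generator ::
  "(complex \<Rightarrow> (complex^'n) set) \<Rightarrow> 'n \<Rightarrow> complex \<Rightarrow> (complex \<Rightarrow> complex^'n) \<Rightarrow> bool" where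
  "lift_generator f i z s \<longleftrightarrow>
     (\<exists>W. open W \<and> z \<in> W \<and> W \<subseteq> chart_preimage f i \<and>
        (\<forall>j. (\<lambda>\<zeta>. s \<zeta> $ j) holomorphic_on W) \<and>
        (\<forall>\<zeta>\<in>W. s \<zeta> \<noteq> 0 \<and> s \<zeta> \<in> chart_fibre i \<and>
           (curve_deriv f i \<zeta> \<noteq> 0 \<longrightarrow> vec.span {s \<zeta>} = vec.span {curve_deriv f i \<zeta>})))"

text \<open>The fibre at \<open>z\<close> of the tautological line bundle \<open>L\<close>, that is, the line \<open>f'(z)\<close>.\<close>

definition lift_line :: "(complex \<Rightarrow> (complex^'n) set) \<Rightarrow> 'n \<Rightarrow> complex \<Rightarrow> (complex^'n) set" where
  "lift_line f i z = {w. \<exists>s. lift_generator f i z s \<and> w \<in> vec.span {s z}}"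

definition pullback_metric ::
  "(complex^'n \<Rightarrow> complex^'n \<Rightarrow> complex) \<Rightarrow> (complex \<Rightarrow> (complex^'n) set) \<Rightarrow> 'n \<Rightarrow> complex \<Rightarrow>
   complex^'n \<Rightarrow> complex^'n \<Rightarrow> complex" where
  "pullback_metric h f i z = omega_metric h (chart i (f z))"

definition lift_in_positive_lines ::
  "(complex^'n \<Rightarrow> complex^'n \<Rightarrow> complex) \<Rightarrow> (complex \<Rightarrow> (complex^'n) set) \<Rightarrow> bool" where
  "lift_in_positive_lines h f \<longleftrightarrow>
     (\<forall>i. \<forall>z\<in>chart_preimage f i. \<forall>w\<in>lift_line f i z. w \<noteq> 0 \<longrightarrow> Re (pullback_metric h f i z w w) > 0)"

definition pullback_chern_form ::
  "(complex^'n \<Rightarrow> complex^'n \<Rightarrow> complex) \<Rightarrow> (complex \<Rightarrow> (complex^'n) set) \<Rightarrow> 'n \<Rightarrow>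
   complex \<Rightarrow> complex \<Rightarrow> complex^'n \<Rightarrow> complex^'n" where
  "pullback_chern_form h f i =
     chern_form (\<lambda>v. \<i> * v) (chart_preimage f i) UNIV (chart_fibre i) (pullback_metric h f i)"

text \<open>The \<open>g\<close>-orthogonal projection of the fibre \<open>F\<close> onto the orthogonal complement of \<open>L\<close>.\<close>

definition pr_perp ::
  "(complex^'n) set \<Rightarrow> (complex^'n \<Rightarrow> complex^'n \<Rightarrow> complex) \<Rightarrow> (complex^'n) set \<Rightarrow> complex^'n \<Rightarrow> complex^'n" where
  "pr_perp F g L w = (THE y. y \<in> F \<and> w - y \<in> L \<and> (\<forall>X\<in>L. g y X = 0))"

text \<open>\<open>\<beta>(v) \<cdot> X\<close> at \<open>z\<close>, for a real direction \<open>v\<close>: the value of \<open>pr_perp (\<nabla>\<^sub>v s)\<close> for any section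
  \<open>s\<close> of \<open>L\<close> with \<open>s z = X\<close>.\<close>

definition second_fund ::
  "(complex^'n \<Rightarrow> complex^'n \<Rightarrow> complex) \<Rightarrow> (complex \<Rightarrow> (complex^'n) set) \<Rightarrow> 'n \<Rightarrow>
   complex \<Rightarrow> complex \<Rightarrow> complex^'n \<Rightarrow> complex^'n" where
  "second_fund h f i z v X =
     (THE Y. \<exists>s. (\<forall>\<zeta>\<in>chart_preimage f i. s \<zeta> \<in> lift_line f i \<zeta>) \<and> s differentiable (at z) \<and> s z = X \<and>
        Y = pr_perp (chart_fibre i) (pullback_metric h f i z) (lift_line f i z)
              (nabla (pullback_chern_form h f i) s z v))"

text \<open>\<open>\<psi>\<close> with \<open>\<beta> = \<psi> \<otimes> dz\<close>: the real direction \<open>1\<close> is \<open>\<partial>/\<partial>x\<close>, and \<open>dz(\<partial>/\<partial>x) = 1\<close>.\<close>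

definition psi ::
  "(complex^'n \<Rightarrow> complex^'n \<Rightarrow> complex) \<Rightarrow> (complex \<Rightarrow> (complex^'n) set) \<Rightarrow> 'n \<Rightarrow>
   complex \<Rightarrow> complex^'n \<Rightarrow> complex^'n" where
  "psi h f i z X = second_fund h f i z 1 X"

text \<open>The next two values do not depend on the chart \<open>i\<close> nor on \<open>X\<close>. They are the coefficients of
  \<open>\<sigma>\<^sub>f\<close> and of \<open>f\<^sup>*\<omega>\<close> with respect to \<open>(i/2) dz \<and> d(cnj z)\<close>.\<close>

definition psi_norm2 ::
  "(complex^'n \<Rightarrow> complex^'n \<Rightarrow> complex) \<Rightarrow> (complex \<Rightarrow> (complex^'n) set) \<Rightarrow> complex \<Rightarrow> real" where
  "psi_norm2 h f z =
     (THE q. \<forall>i. z \<in> chart_preimage f i \<longrightarrow> (\<forall>X\<in>lift_line f i z. X \<noteq> 0 \<longrightarrow>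
        q = Re (pullback_metric h f i z (psi h f i z X) (psi h f i z X))
              / Re (pullback_metric h f i z X X)))"

definition pullback_omega ::
  "(complex^'n \<Rightarrow> complex^'n \<Rightarrow> complex) \<Rightarrow> (complex \<Rightarrow> (complex^'n) set) \<Rightarrow> complex \<Rightarrow> real" where
  "pullback_omega h f z =
     (THE q. \<forall>i. z \<in> chart_preimage f i \<longrightarrow>
        q = Re (pullback_metric h f i z (curve_deriv f i z) (curve_deriv f i z)))"

section \<open>Characteristic functions\<close>

text \<open>A \<open>(1,1)\<close>-form on the plane is represented by its coefficient \<open>a\<close> with respect to
  \<open>(i/2) dz \<and> d(cnj z)\<close>, which is the Lebesgue area form.\<close>

definition characteristic :: "(complex \<Rightarrow> real) \<Rightarrow> real \<Rightarrow> real" where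
  "characteristic a r = (LINT t:{1..r}|lborel. (1 / t) * (LINT z:ball 0 t|lborel. a z))"

end

theory Submission
  imports Defs "HOL-Complex_Analysis.Conformal_Mappings"
begin

text \<open>
  At a point with affine coordinates \<open>x\<close> the metric \<open>\<omega>\<close> is \<open>-2/h(x,x)\<close> times the form induced by
  \<open>h\<close> on the quotient by the line \<open>x\<close>. The Chern connection is then explicit, and the holomorphic
  sectional curvature is \<open>-1\<close>, so \<open>\<gamma> = 1\<close>. If \<open>F\<close> lifts \<open>f\<close> to a chart, \<open>W = \<nabla> F'\<close> and
  \<open>a = g(F',F')\<close> is the coefficient of \<open>f\<^sup>*\<omega>\<close>, then \<open>\<partial>a = g(W,F')\<close> and
  \<open>\<partial>\<partial>bar a = a\<^sup>2 + g(W,W)\<close>, whence \<open>\<partial>\<partial>bar log a = a + \<parallel>\<psi>\<parallel>\<^sup>2\<close> off the zeros of \<open>a\<close>. Jensen's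
  formula is applied to the smooth function \<open>log (a + \<epsilon>)\<close>, which satisfies
  \<open>\<partial>\<partial>bar log (a + \<epsilon>) \<ge> (a + \<parallel>\<psi>\<parallel>\<^sup>2) a / (a + \<epsilon>)\<close> off the zeros of \<open>a\<close>. As \<open>\<epsilon>\<close> tends to \<open>0\<close> this bounds
  the sum of the characteristic functions by the mean of \<open>log a\<close> over a circle, because \<open>\<parallel>\<psi>\<parallel>\<^sup>2\<close> is
  locally bounded: the tangent lines are positive also at the zeros of \<open>a\<close>. Concavity of the
  logarithm and two applications of Borel's growth lemma finish the proof.
\<close>

section \<open>Integration in polar coordinates\<close>

text \<open>Two obstacles shape the argument. First, \<omega> is indefinite on the orthogonal
  complement of the tangent lines, so \<kappa> = a + \<parallel>\<psi>\<parallel>^2 has no sign and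
  the limit \<epsilon> to 0 cannot rest on monotonicity. Replacing \<kappa> by \<kappa> a / (a +
  \<epsilon>) costs \<kappa> \<epsilon> / (a + \<epsilon>); this error is at most a bound for
  \<kappa> on the disk times the integral of \<epsilon> / (a + \<epsilon>), which tends to 0 because
  the zeros of a are countable. Second, the expression of \<parallel>\<psi>\<parallel>^2 through a
  breaks down where F' = 0. Near such a point z0 one writes F' = (z - z0)^m s with s(z0) nonzero.
  The quotient that gives \<parallel>\<psi>\<parallel>^2 is the same for the pair (s, \<nabla>s) as
  for (F', \<nabla>F'), and it is continuous at z0 because g(s,s) > 0 there. The logarithmic
  right-hand side arises because the derivative of T is the disk integral of a divided by r, and the
  derivative of that disk integral is r times the circle integral of a: two growth steps bound the
  circle mean by r T^4.\<close>

lemma lborel_complex_eq_distr: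
  "(lborel :: complex measure) = distr (lborel \<Otimes>\<^sub>M lborel) borel (\<lambda>(x, y). Complex x y)"
proof (rule lborel_eqI)
  let ?F = "\<lambda>(x::real, y::real). Complex x y"
  have m: "?F \<in> borel_measurable (lborel \<Otimes>\<^sub>M lborel)"
    unfolding lborel_prod case_prod_beta
    by (auto intro!: borel_measurable_continuous_onI continuous_intros simp: Complex_eq)
  fix l u :: complex
  assume le: "\<And>b. b \<in> Basis \<Longrightarrow> l \<bullet> b \<le> u \<bullet> b"
  then have le': "Re l \<le> Re u" "Im l \<le> Im u"
    by (force simp: Basis_complex_def)+
  have vim: "?F -` box l u \<inter> space (lborel \<Otimes>\<^sub>M lborel) = box (Re l) (Re u) \<times> box (Im l) (Im u)"
    by (auto simp: box_def Basis_complex_def space_pair_measure)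
  have "emeasure (distr (lborel \<Otimes>\<^sub>M lborel) borel ?F) (box l u)
      = emeasure (lborel \<Otimes>\<^sub>M lborel) (box (Re l) (Re u) \<times> box (Im l) (Im u))"
    by (subst emeasure_distr[OF m]) (simp_all only: vim, simp)
  also have "\<dots> = ennreal (Re u - Re l) * ennreal (Im u - Im l)"
    using le' by (subst lborel.emeasure_pair_measure_Times) (auto simp: box_real)
  also have "\<dots> = (\<Prod>b\<in>Basis. (u - l) \<bullet> b)"
    using le' by (simp add: Basis_complex_def ennreal_mult)
  finally show "emeasure (distr (lborel \<Otimes>\<^sub>M lborel) borel ?F) (box l u) = (\<Prod>b\<in>Basis. (u - l) \<bullet> b)" .
qed auto

lemma Complex_measurable_pair [measurable]:
  "(\<lambda>(x, y). Complex x y) \<in> borel_measurable (lborel \<Otimes>\<^sub>M lborel)"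
  unfolding lborel_prod case_prod_beta
  by (auto intro!: borel_measurable_continuous_onI continuous_intros simp: Complex_eq)

lemma nn_integral_lborel_complex:
  fixes g :: "complex \<Rightarrow> ennreal"
  assumes [measurable]: "g \<in> borel_measurable borel"
  shows "(\<integral>\<^sup>+ z. g z \<partial>lborel) = (\<integral>\<^sup>+ x. (\<integral>\<^sup>+ y. g (Complex x y) \<partial>lborel) \<partial>lborel)"
    and "(\<integral>\<^sup>+ z. g z \<partial>lborel) = (\<integral>\<^sup>+ y. (\<integral>\<^sup>+ x. g (Complex x y) \<partial>lborel) \<partial>lborel)"
proof -
  have 1: "(\<integral>\<^sup>+ z. g z \<partial>lborel) = (\<integral>\<^sup>+ p. g (case p of (x, y) \<Rightarrow> Complex x y) \<partial>(lborel \<Otimes>\<^sub>M lborel))"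
    by (subst lborel_complex_eq_distr) (rule nn_integral_distr; measurable)
  have m: "(\<lambda>(x, y). g (Complex x y)) \<in> borel_measurable (lborel \<Otimes>\<^sub>M lborel)"
    using measurable_compose[OF Complex_measurable_pair assms] by (simp add: case_prod_beta)
  show "(\<integral>\<^sup>+ z. g z \<partial>lborel) = (\<integral>\<^sup>+ x. (\<integral>\<^sup>+ y. g (Complex x y) \<partial>lborel) \<partial>lborel)"
    using lborel.nn_integral_fst[OF m] 1 by (simp add: case_prod_unfold)
  show "(\<integral>\<^sup>+ z. g z \<partial>lborel) = (\<integral>\<^sup>+ y. (\<integral>\<^sup>+ x. g (Complex x y) \<partial>lborel) \<partial>lborel)"
    using lborel_pair.nn_integral_snd[OF m] 1 by (simp add: case_prod_unfold)
qed

text \<open>On each horizontal (respectively vertical) line the shear is a translation, so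
  integrating first along these lines reduces the claim to translation invariance on the real
  line.\<close>

lemma nn_integral_shear:
  fixes g :: "complex \<Rightarrow> ennreal"
  assumes g[measurable]: "g \<in> borel_measurable borel"
  shows "(\<integral>\<^sup>+ z. g (z + of_real (t * Im z)) \<partial>lborel) = (\<integral>\<^sup>+ z. g z \<partial>lborel)"
    and "(\<integral>\<^sup>+ z. g (z + \<i> * of_real (t * Re z)) \<partial>lborel) = (\<integral>\<^sup>+ z. g z \<partial>lborel)"
proof -
  have mc: "(\<lambda>x. g (Complex x y)) \<in> borel_measurable borel" "(\<lambda>y. g (Complex x y)) \<in> borel_measurable borel" for x y
    by (auto intro!: measurable_compose[OF _ g] borel_measurable_continuous_onI continuous_intros simp: Complex_eq)
  have m1: "(\<lambda>z. g (z + of_real (t * Im z))) \<in> borel_measurable borel"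
    by (rule measurable_compose[OF _ g]) (auto intro!: borel_measurable_continuous_onI continuous_intros)
  have m2: "(\<lambda>z. g (z + \<i> * of_real (t * Re z))) \<in> borel_measurable borel"
    by (rule measurable_compose[OF _ g]) (auto intro!: borel_measurable_continuous_onI continuous_intros)
  have e1: "Complex x y + of_real (t * Im (Complex x y)) = Complex (t * y + 1 * x) y" for x y
    by (simp add: complex_eq_iff)
  have e2: "Complex x y + \<i> * of_real (t * Re (Complex x y)) = Complex x (t * x + 1 * y)" for x y
    by (simp add: complex_eq_iff)
  show "(\<integral>\<^sup>+ z. g (z + of_real (t * Im z)) \<partial>lborel) = (\<integral>\<^sup>+ z. g z \<partial>lborel)"
    unfolding nn_integral_lborel_complex(2)[OF m1] nn_integral_lborel_complex(2)[OF g] e1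
    using nn_integral_real_affine[OF mc(1), of 1] by simp
  show "(\<integral>\<^sup>+ z. g (z + \<i> * of_real (t * Re z)) \<partial>lborel) = (\<integral>\<^sup>+ z. g z \<partial>lborel)"
    unfolding nn_integral_lborel_complex(1)[OF m2] nn_integral_lborel_complex(1)[OF g] e2
    using nn_integral_real_affine[OF mc(2), of 1] by simp
qed

text \<open>A rotation by an angle other than \<open>\<pi>\<close> is a composition of three shears.\<close>

lemma distr_lborel_rotation:
  assumes "cos (\<theta> / 2) \<noteq> 0"
  shows "distr lborel borel (\<lambda>z::complex. cis \<theta> * z) = lborel"
proof (rule measure_eqI)
  fix A assume "A \<in> sets (distr lborel borel (\<lambda>z::complex. cis \<theta> * z))"
  then have A[measurable]: "A \<in> sets borel" by simp
  \<comment> \<open>The slopes of the three shears are \<open>t\<close>,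
    \<open>sin \<theta>\<close>, \<open>t\<close>. Comparing matrix entries forces
    \<open>1 + t * sin \<theta> = cos \<theta>\<close>, and this is where the half angle comes
    from.\<close>
  define t where "t = - tan (\<theta> / 2)"
  define g where "g = (indicator A :: complex \<Rightarrow> ennreal)"
  define X where "X z = z + of_real (t * Im z)" for z :: complex
  define Y where "Y z = z + \<i> * of_real (sin \<theta> * Re z)" for z :: complex
  have m[measurable]: "g \<in> borel_measurable borel" by (simp add: g_def)
  have mX[measurable]: "X \<in> borel_measurable borel" and mY[measurable]: "Y \<in> borel_measurable borel"
    unfolding X_def[abs_def] Y_def[abs_def] by (auto intro!: borel_measurable_continuous_onI continuous_intros)
  have s: "sin \<theta> = 2 * sin (\<theta>/2) * cos (\<theta>/2)" and c: "cos \<theta> = 1 - 2 * (sin (\<theta>/2))\<^sup>2"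
    using sin_double[of "\<theta>/2"] cos_double_sin[of "\<theta>/2"] by simp_all
  have ts: "t * sin \<theta> = - 2 * (sin (\<theta>/2))\<^sup>2"
    using assms by (simp add: t_def tan_def s power2_eq_square)
  have k1: "1 + t * sin \<theta> = cos \<theta>" using ts c by simp
  have k2: "t * (1 + cos \<theta>) = - sin \<theta>"
  proof -
    have "1 + cos \<theta> = 2 * (cos (\<theta>/2) * cos (\<theta>/2))"
      using c sin_cos_squared_add[of "\<theta>/2"] by (simp add: power2_eq_square)
    then show ?thesis using assms by (simp add: t_def tan_def s)
  qed
  have rot: "X (Y (X z)) = cis \<theta> * z" for z
  proof -
    have "Re (X (Y (X z))) = (1 + t * sin \<theta>) * Re z + (t * (1 + (1 + t * sin \<theta>))) * Im z"
      by (simp add: X_def Y_def algebra_simps)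
    moreover have "Im (X (Y (X z))) = sin \<theta> * Re z + (1 + t * sin \<theta>) * Im z"
      by (simp add: X_def Y_def algebra_simps)
    ultimately show ?thesis
      by (simp add: complex_eq_iff k1 k2)
  qed
  have "emeasure (distr lborel borel (\<lambda>z. cis \<theta> * z)) A = (\<integral>\<^sup>+ z. g z \<partial>distr lborel borel (\<lambda>z. cis \<theta> * z))"
    by (simp add: g_def)
  also have "\<dots> = (\<integral>\<^sup>+ z. g (cis \<theta> * z) \<partial>lborel)"
    by (rule nn_integral_distr) auto
  also have "\<dots> = (\<integral>\<^sup>+ z. g (X (Y (X z))) \<partial>lborel)"
    by (simp add: rot)
  also have "\<dots> = (\<integral>\<^sup>+ z. g (X (Y z)) \<partial>lborel)"
    using nn_integral_shear(1)[of "\<lambda>z. g (X (Y z))" t] unfolding X_def[symmetric] by simp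
  also have "\<dots> = (\<integral>\<^sup>+ z. g (X z) \<partial>lborel)"
    using nn_integral_shear(2)[of "\<lambda>z. g (X z)" "sin \<theta>"] unfolding Y_def[symmetric] by simp
  also have "\<dots> = (\<integral>\<^sup>+ z. g z \<partial>lborel)"
    using nn_integral_shear(1)[of "\<lambda>z. g z" t] unfolding X_def[symmetric] by simp
  also have "\<dots> = emeasure lborel A" by (simp add: g_def)
  finally show "emeasure (distr lborel borel (\<lambda>z. cis \<theta> * z)) A = emeasure lborel A" .
qed simp

section \<open>Circle integrals and the derivative of disk integrals\<close>

text \<open>Not normalised: the mean over the circle is \<open>circ g t / (2 * pi)\<close>. With
  angles between -pi and pi the half angle has positive cosine except at the end points, which is
  what \<open>distr_lborel_rotation\<close> asks for.\<close>

definition circ :: "(complex \<Rightarrow> real) \<Rightarrow> real \<Rightarrow> real" where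
  "circ g t = integral {-pi..pi} (\<lambda>\<theta>. g (of_real t * cis \<theta>))"

lemma integral_periodic_shift:
  fixes f :: "real \<Rightarrow> real"
  assumes f: "continuous_on UNIV f" and per: "\<And>x. f (x + 2 * pi) = f x" and \<alpha>: "0 \<le> \<alpha>" "\<alpha> \<le> 2 * pi"
  shows "integral {-pi..pi} (\<lambda>\<theta>. f (\<theta> + \<alpha>)) = integral {-pi..pi} f"
proof -
  have i: "f integrable_on {a..b}" for a b
    using f by (intro integrable_continuous_real) (auto intro: continuous_on_subset)
  have "integral {-pi..pi} (\<lambda>\<theta>. f (\<theta> + \<alpha>)) = integral {-pi + \<alpha>..pi + \<alpha>} f"
    using integral_shift_Icc_real[of "-pi" pi f \<alpha>] by (simp add: add.commute o_def)
  also have "\<dots> = integral {-pi + \<alpha>..pi} f + integral {pi..pi + \<alpha>} f"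
    using \<alpha> by (intro Henstock_Kurzweil_Integration.integral_combine[symmetric] i) auto
  also have "integral {pi..pi + \<alpha>} f = integral {-pi..-pi + \<alpha>} f"
  proof -
    have "(\<lambda>x. f (x + 2 * pi)) = f" using per by auto
    then show ?thesis
      using integral_shift_Icc_real[of "-pi" "-pi + \<alpha>" f "2 * pi"] by (simp add: add.commute o_def)
  qed
  also have "integral {-pi + \<alpha>..pi} f + integral {-pi..-pi + \<alpha>} f = integral {-pi..pi} f"
    using \<alpha> Henstock_Kurzweil_Integration.integral_combine[OF _ _ i, of "-pi" "-pi + \<alpha>" pi] by auto
  finally show ?thesis .
qed

lemma integral_rotated_eq_circ:
  assumes g: "continuous_on UNIV g"
  shows "integral {-pi..pi} (\<lambda>\<theta>. g (cis \<theta> * z)) = circ g (norm z)"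
proof -
  obtain \<alpha> where \<alpha>: "0 \<le> \<alpha>" "\<alpha> < 2 * pi" "z = of_real (norm z) * cis \<alpha>"
    by (rule that[of "Arg2pi z"]) (use Arg2pi[of z] in \<open>auto simp add: cis_conv_exp is_Arg_def\<close>)
  have e: "cis \<theta> * z = of_real (norm z) * cis (\<theta> + \<alpha>)" for \<theta>
    by (subst (1) \<alpha>(3)) (simp add: cis_mult[symmetric])
  have "continuous_on UNIV (\<lambda>\<theta>. g (of_real (norm z) * cis \<theta>))"
    by (rule continuous_on_compose2[OF g]) (auto intro!: continuous_intros simp: cis_conv_exp)
  from integral_periodic_shift[OF this _ \<alpha>(1)] \<alpha>(2) show ?thesis
    unfolding e circ_def by (simp add: cis_mult[symmetric])
qed

lemma continuous_on_circ:
  assumes g: "continuous_on UNIV g"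
  shows "continuous_on UNIV (circ g)"
proof -
  have "continuous_on (UNIV \<times> cbox (-pi) pi) (\<lambda>(t, \<theta>). g (of_real t * cis \<theta>))"
    unfolding case_prod_beta
    by (rule continuous_on_compose2[OF g]) (auto intro!: continuous_intros simp: cis_conv_exp)
  from integral_continuous_on_param[OF this] show ?thesis
    unfolding circ_def[abs_def] by simp
qed

lemma integral_ball_rotation:
  fixes g :: "complex \<Rightarrow> real"
  assumes g: "continuous_on UNIV g" and \<theta>: "cos (\<theta> / 2) \<noteq> 0"
  shows "(LINT z|lborel. indicator (cball 0 t) z *\<^sub>R g (cis \<theta> * z)) = (LINT z|lborel. indicator (cball 0 t) z *\<^sub>R g z)"
proof -
  have gm: "g \<in> borel_measurable borel" using g by (rule borel_measurable_continuous_onI)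
  have "(LINT z|lborel. indicator (cball 0 t) z *\<^sub>R g z)
      = (LINT z|distr lborel borel (\<lambda>z. cis \<theta> * z). indicator (cball 0 t) z *\<^sub>R g z)"
    by (simp add: distr_lborel_rotation[OF \<theta>])
  also have "\<dots> = (LINT z|lborel. indicator (cball 0 t) (cis \<theta> * z) *\<^sub>R g (cis \<theta> * z))"
    using gm by (intro integral_distr borel_measurable_scaleR borel_measurable_indicator) auto
  also have "(\<lambda>z::complex. indicator (cball 0 t) (cis \<theta> * z) :: real) = indicator (cball 0 t)"
    by (auto simp: indicator_def norm_mult)
  finally show ?thesis by simp
qed

text \<open>Averaging over rotations: the integral over the disk does not change when
  \<open>g\<close> is rotated. Integrating over the angle and exchanging the integrals leaves an
  integrand that depends on \<open>norm z\<close> only, so that polar coordinates are needed just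
  for radial functions.\<close>

lemma integral_cball_eq_circ:
  fixes g :: "complex \<Rightarrow> real"
  assumes g: "continuous_on UNIV g"
  shows "2 * pi * (LINT z|lborel. indicator (cball 0 t) z *\<^sub>R g z)
       = (LINT z|lborel. indicator (cball (0::complex) t) z *\<^sub>R circ g (norm z))"
proof -
  let ?J = "LINT z|lborel. indicator (cball 0 t) z *\<^sub>R g z"
  let ?f = "\<lambda>\<theta> z. indicator {-pi..pi} \<theta> *\<^sub>R (indicator (cball 0 t) z *\<^sub>R g (cis \<theta> * z))"
  have "integrable lborel (\<lambda>p. indicator ({-pi..pi} \<times> cball 0 t) p *\<^sub>R g (cis (fst p) * snd p))"
    by (rule borel_integrable_compact)
      (auto intro!: compact_Times continuous_on_compose2[OF g] continuous_intros simp: cis_conv_exp)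
  also have "(\<lambda>p. indicator ({-pi..pi} \<times> cball 0 t) p *\<^sub>R g (cis (fst p) * snd p)) = case_prod ?f"
    by (auto simp: fun_eq_iff indicator_def)
  finally have int: "integrable (lborel \<Otimes>\<^sub>M lborel) (case_prod ?f)"
    unfolding lborel_prod .
  have inner: "(LINT \<theta>|lborel. ?f \<theta> z) = indicator (cball 0 t) z *\<^sub>R circ g (norm z)" for z
  proof -
    have c: "continuous_on {-pi..pi} (\<lambda>\<theta>. g (cis \<theta> * z))"
      by (rule continuous_on_compose2[OF g]) (auto intro!: continuous_intros simp: cis_conv_exp)
    have "(LINT \<theta>|lborel. ?f \<theta> z) = indicator (cball 0 t) z *\<^sub>R (LINT \<theta>:{-pi..pi}|lborel. g (cis \<theta> * z))"
      unfolding set_lebesgue_integral_def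
      by (subst integral_scaleR_right[symmetric]) (simp add: ac_simps)
    also have "(LINT \<theta>:{-pi..pi}|lborel. g (cis \<theta> * z)) = integral {-pi..pi} (\<lambda>\<theta>. g (cis \<theta> * z))"
      by (rule set_borel_integral_eq_integral(2)[OF borel_integrable_atLeastAtMost'[OF c]])
    finally show ?thesis by (simp add: integral_rotated_eq_circ[OF g])
  qed
  \<comment> \<open>At the angles pi and -pi the factorisation into shears breaks down; they form a
    null set.\<close>
  have outer: "(LINT z|lborel. ?f \<theta> z) = indicator {-pi<..<pi} \<theta> *\<^sub>R ?J" if "\<theta> \<notin> {-pi, pi}" for \<theta>
  proof (cases "\<theta> \<in> {-pi<..<pi}")
    case True
    then have "cos (\<theta> / 2) > 0" by (intro cos_gt_zero_pi) auto
    with True show ?thesis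
      using integral_ball_rotation[OF g, of \<theta> t] by simp
  next
    case False
    with that have "\<theta> \<notin> {-pi..pi}" by auto
    with False show ?thesis by simp
  qed
  have "(LINT z|lborel. indicator (cball (0::complex) t) z *\<^sub>R circ g (norm z)) = (LINT z|lborel. LINT \<theta>|lborel. ?f \<theta> z)"
    by (simp only: inner)
  also have "\<dots> = (LINT \<theta>|lborel. LINT z|lborel. ?f \<theta> z)"
    using lborel_pair.Fubini_integral[OF int] .
  also have "\<dots> = (LINT \<theta>|lborel. indicator {-pi<..<pi} \<theta> *\<^sub>R ?J)"
    by (rule integral_discrete_difference[where X="{-pi, pi}"]) (use outer in auto)
  also have "\<dots> = 2 * pi * ?J" by simp
  finally show ?thesis by simp
qed

text \<open>The constant \<open>m t\<close> contributes \<open>pi * s\<^sup>2 * m t\<close>, which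
  has the stated derivative. The remainder \<open>m - m t\<close> is small near radius
  \<open>t\<close>, so its integral over a thin annulus is small compared with the width of the
  annulus and has derivative 0.\<close>

lemma has_real_derivative_integral_radial:
  fixes m :: "real \<Rightarrow> real"
  assumes m: "continuous_on UNIV m" and t: "t > 0"
  shows "((\<lambda>t. LINT z|lborel. indicator (cball (0::complex) t) z *\<^sub>R m (norm z)) has_real_derivative 2 * pi * t * m t) (at t)"
proof -
  define k where "k = (\<lambda>x. m x - m t)"
  define \<Psi> where "\<Psi> = (\<lambda>s. LINT z|lborel. indicator (cball (0::complex) s) z *\<^sub>R k (norm z))"
  have k: "continuous_on UNIV k" unfolding k_def by (intro continuous_intros m)
  have ik: "integrable lborel (\<lambda>z. indicator (cball (0::complex) s) z *\<^sub>R k (norm z))" for s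
    by (rule borel_integrable_compact) (auto intro!: continuous_on_compose2[OF k] continuous_intros)
  have ic: "integrable lborel (\<lambda>z. indicator (cball (0::complex) s) z *\<^sub>R c)" for s and c :: real
    by (rule borel_integrable_compact) auto
  have vol: "(LINT z|lborel. indicator (cball (0::complex) s) z *\<^sub>R c) = pi * s\<^sup>2 * c" if "s \<ge> 0" for s and c :: real
    using that by (simp add: content_cball unit_ball_vol_2)
  have split: "(LINT z|lborel. indicator (cball (0::complex) s) z *\<^sub>R m (norm z)) = \<Psi> s + pi * s\<^sup>2 * m t" if "s \<ge> 0" for s
  proof -
    have "\<Psi> s + (LINT z|lborel. indicator (cball (0::complex) s) z *\<^sub>R m t)
        = (LINT z|lborel. indicator (cball (0::complex) s) z *\<^sub>R k (norm z) + indicator (cball (0::complex) s) z *\<^sub>R m t)"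
      unfolding \<Psi>_def by (rule Bochner_Integration.integral_add[symmetric, OF ik ic])
    also have "\<dots> = (LINT z|lborel. indicator (cball (0::complex) s) z *\<^sub>R m (norm z))"
      by (rule Bochner_Integration.integral_cong) (auto simp: k_def algebra_simps)
    finally show ?thesis unfolding vol[OF that] by simp
  qed
  have diff: "\<bar>\<Psi> v - \<Psi> u\<bar> \<le> e * (pi * v\<^sup>2 - pi * u\<^sup>2)"
    if uv: "0 \<le> u" "u \<le> v" and e: "\<And>x. u \<le> x \<Longrightarrow> x \<le> v \<Longrightarrow> \<bar>k x\<bar> \<le> e" for u v e
  proof -
    have "\<bar>\<Psi> v - \<Psi> u\<bar> = \<bar>LINT z|lborel. indicator (cball (0::complex) v) z *\<^sub>R k (norm z) - indicator (cball (0::complex) u) z *\<^sub>R k (norm z)\<bar>"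
      unfolding \<Psi>_def by (subst Bochner_Integration.integral_diff[OF ik ik]) simp
    also have "\<dots> \<le> (LINT z|lborel. indicator (cball (0::complex) v) z *\<^sub>R e - indicator (cball (0::complex) u) z *\<^sub>R e)"
      using uv e
      by (intro integral_abs_bound_integral Bochner_Integration.integrable_diff ik ic)
         (auto simp: indicator_def)
    also have "\<dots> = e * (pi * v\<^sup>2 - pi * u\<^sup>2)"
      unfolding Bochner_Integration.integral_diff[OF ic ic] vol[OF uv(1)] vol[OF order_trans[OF uv]] by (simp add: algebra_simps)
    finally show ?thesis .
  qed
  have "(\<Psi> has_real_derivative 0) (at t)"
    unfolding has_field_derivative_def has_derivative_at_alt
  proof (intro conjI allI impI)
    fix e :: real assume e: "e > 0"
    \<comment> \<open>The annulus between the radii \<open>y\<close> and \<open>t\<close> has area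
      \<open>pi * (y + t) * \<bar>y - t\<bar>\<close>, and \<open>y + t \<le> 3 * t\<close> because
      \<open>y \<le> 2 * t\<close>.\<close>
    define e' where "e' = e / (pi * (3 * t))"
    have e': "e' > 0" using e t by (simp add: e'_def)
    have "isCont k t" using k by (simp add: continuous_on_eq_continuous_at)
    then obtain d where d: "d > 0" "\<And>x. \<bar>x - t\<bar> < d \<Longrightarrow> \<bar>k x\<bar> < e'"
      using e' by (auto simp: continuous_at_eps_delta dist_real_def k_def)
    show "\<exists>d>0. \<forall>y. norm (y - t) < d \<longrightarrow> norm (\<Psi> y - \<Psi> t - 0 * (y - t)) \<le> e * norm (y - t)"
    proof (intro exI[of _ "min d t"] conjI allI impI)
      fix y assume y: "norm (y - t) < min d t"
      have y0: "y > 0" "y \<le> 2 * t" using y by (auto simp: abs_less_iff)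
      have ek: "\<bar>k x\<bar> \<le> e'" if "min y t \<le> x" "x \<le> max y t" for x
        using d(2)[of x] that y by (auto simp: abs_less_iff min_def max_def split: if_splits)
      have "\<bar>\<Psi> (max y t) - \<Psi> (min y t)\<bar> \<le> e' * (pi * (max y t)\<^sup>2 - pi * (min y t)\<^sup>2)"
        using y0 t by (intro diff ek) auto
      also have "pi * (max y t)\<^sup>2 - pi * (min y t)\<^sup>2 = pi * ((y + t) * \<bar>y - t\<bar>)"
        by (auto simp: max_def min_def power2_eq_square algebra_simps)
      also have "e' * \<dots> \<le> e' * (pi * ((3 * t) * \<bar>y - t\<bar>))"
        using e' y0 by (intro mult_left_mono mult_right_mono) auto
      also have "\<dots> = e * \<bar>y - t\<bar>" using t by (simp add: e'_def)
      finally show "norm (\<Psi> y - \<Psi> t - 0 * (y - t)) \<le> e * norm (y - t)"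
        by (auto simp: max_def min_def abs_minus_commute split: if_splits)
    qed (use d t in auto)
  qed (rule bounded_linear_mult_right)
  then have "((\<lambda>s. \<Psi> s + pi * s\<^sup>2 * m t) has_real_derivative 2 * pi * t * m t) (at t)"
    by (auto intro!: derivative_eq_intros simp: algebra_simps)
  then show ?thesis
    by (rule has_field_derivative_transform_within[where d=t]) (use t split in \<open>auto simp: dist_real_def abs_less_iff\<close>)
qed

definition area :: "(complex \<Rightarrow> real) \<Rightarrow> real \<Rightarrow> real" where
  "area g t = (LINT z:ball 0 t|lborel. g z)"

lemma area_eq_cball:
  fixes g :: "complex \<Rightarrow> real"
  assumes g: "g \<in> borel_measurable borel"
  shows "area g t = (LINT z|lborel. indicator (cball 0 t) z *\<^sub>R g z)"
  unfolding area_def set_lebesgue_integral_def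
proof (rule integral_cong_AE)
  have "sphere 0 t \<in> null_sets (lebesgue :: complex measure)"
    by (simp add: negligible_sphere flip: negligible_iff_null_sets)
  then have "sphere 0 t \<in> null_sets (lborel :: complex measure)"
    by (metis borel_closed closed_sphere null_sets_completion_iff sets_lborel)
  then have "AE z in lborel. z \<notin> sphere (0::complex) t" by (rule AE_not_in)
  then show "AE z in lborel. indicator (ball 0 t) z *\<^sub>R g z = indicator (cball 0 t) z *\<^sub>R g z"
    by eventually_elim (auto simp: indicator_def)
qed (use g in \<open>auto intro!: borel_measurable_times borel_measurable_indicator\<close>)

lemma has_real_derivative_area:
  assumes g: "continuous_on UNIV g" and t: "t > 0"
  shows "(area g has_real_derivative t * circ g t) (at t)"
proof -
  have gm: "g \<in> borel_measurable borel" using g by (rule borel_measurable_continuous_onI)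
  have "area g = (\<lambda>t. (LINT z|lborel. indicator (cball (0::complex) t) z *\<^sub>R circ g (norm z)) / (2 * pi))"
    unfolding area_eq_cball[OF gm, abs_def] fun_eq_iff
    using integral_cball_eq_circ[OF g] by (simp add: field_simps)
  then show ?thesis
    using DERIV_cdivide[OF has_real_derivative_integral_radial[OF continuous_on_circ[OF g] t], of "2 * pi"]
    by simp
qed

section \<open>Jensen's formula\<close>

lemma continuous_on_polar [continuous_intros]:
  fixes g :: "complex \<Rightarrow> 'b::topological_space"
  assumes "continuous_on UNIV g"
  shows "continuous_on S (\<lambda>p. g (of_real (fst p) * cis (snd p)))"
    and "continuous_on T (\<lambda>\<theta>. g (of_real t * cis \<theta>))"
  by (rule continuous_on_compose2[OF assms]; auto intro!: continuous_intros simp: cis_conv_exp)+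

lemma continuous_on_cis_snd [continuous_intros]:
  "continuous_on S (\<lambda>p. cis (snd p))" "continuous_on T cis"
  by (auto intro!: continuous_intros simp: cis_conv_exp[abs_def])

text \<open>\<open>P\<close> is the Wirtinger derivative \<partial>U/\<partial>z: for a real
  function, dU(v) = 2 Re (P v). In the lemmas below \<open>Q\<close> and \<open>L\<close> are
  likewise \<partial>\<partial>U and the real function \<partial>\<partial>bar U.\<close>

lemma has_real_derivative_circ:
  assumes U: "\<And>z. (U has_derivative (\<lambda>v. 2 * Re (P z * v))) (at z)" and P: "continuous_on UNIV P"
  shows "(circ U has_real_derivative integral {-pi..pi} (\<lambda>\<theta>. 2 * Re (P (of_real t * cis \<theta>) * cis \<theta>))) (at t)"
proof -
  have cU: "continuous_on UNIV U"
    by (meson U continuous_at_imp_continuous_on has_derivative_continuous)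
  have "((\<lambda>t. U (of_real t * cis \<theta>)) has_real_derivative 2 * Re (P (of_real t * cis \<theta>) * cis \<theta>)) (at t within UNIV)" for t \<theta>
  proof -
    have "((\<lambda>t. of_real t * cis \<theta>) has_derivative (\<lambda>h. of_real h * cis \<theta>)) (at t)"
      by (auto intro!: derivative_eq_intros)
    from has_derivative_compose[OF this U] show ?thesis
      unfolding has_field_derivative_def by (rule has_derivative_eq_rhs) (auto simp: fun_eq_iff algebra_simps)
  qed
  moreover have "(\<lambda>\<theta>. U (of_real t * cis \<theta>)) integrable_on cbox (-pi) pi" for t
    by (intro integrable_continuous continuous_intros cU)
  moreover have "continuous_on (UNIV \<times> cbox (-pi) pi) (\<lambda>(t, \<theta>). 2 * Re (P (of_real t * cis \<theta>) * cis \<theta>))"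
    unfolding case_prod_beta by (intro continuous_intros P)
  ultimately show ?thesis
    using leibniz_rule_field_derivative[of UNIV "-pi" pi "\<lambda>t \<theta>. U (of_real t * cis \<theta>)"
        "\<lambda>t \<theta>. 2 * Re (P (of_real t * cis \<theta>) * cis \<theta>)" t]
    unfolding circ_def[abs_def] by simp
qed

text \<open>With P = \<partial>U/\<partial>z this is the outward flux of the gradient of U through
  the circle, that is, \<open>t\<close> times the derivative of \<open>circ U\<close> at
  \<open>t\<close>.\<close>

definition flux :: "(complex \<Rightarrow> complex) \<Rightarrow> real \<Rightarrow> real" where
  "flux P t = integral {-pi..pi} (\<lambda>\<theta>. 2 * Re (P (of_real t * cis \<theta>) * (of_real t * cis \<theta>)))"

lemma has_vector_derivative_cis: "(cis has_vector_derivative \<i> * cis \<theta>) (at \<theta> within S)"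
  unfolding cis_conv_exp[abs_def]
  by (rule has_vector_derivative_real_field) (auto intro!: derivative_eq_intros)

text \<open>Since \<open>d/d\<theta> (P z) = i (Q z\<^sup>2 + P z) - i L |z|\<^sup>2\<close> on the circle, and the integral of this derivative
  over the circle vanishes, the second derivatives other than \<open>L\<close> drop out.\<close>

lemma has_real_derivative_flux:
  assumes P: "\<And>z. (P has_derivative (\<lambda>v. Q z * v + of_real (L z) * cnj v)) (at z)"
    and Q: "continuous_on UNIV Q" and L: "continuous_on UNIV L" and t: "t > 0"
  shows "(flux P has_real_derivative 4 * t * circ L t) (at t)"
proof -
  have cP: "continuous_on UNIV P"
    by (meson P continuous_at_imp_continuous_on has_derivative_continuous)
  define N' where "N' = (\<lambda>t \<theta>. let z = of_real t * cis \<theta> in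
    2 * Re (P z * cis \<theta> + (Q z * cis \<theta> + of_real (L z) * cnj (cis \<theta>)) * z))"
  have "((\<lambda>t. 2 * Re (P (of_real t * cis \<theta>) * (of_real t * cis \<theta>))) has_real_derivative N' t \<theta>) (at t within UNIV)" for t \<theta>
  proof -
    have 1: "((\<lambda>t. of_real t * cis \<theta>) has_derivative (\<lambda>h. of_real h * cis \<theta>)) (at t)"
      by (auto intro!: derivative_eq_intros)
    note 2 = has_derivative_compose[OF 1 P]
    have "((\<lambda>t. 2 * Re (P (of_real t * cis \<theta>) * (of_real t * cis \<theta>))) has_derivative (\<lambda>h. 2 * Re
       (P (of_real t * cis \<theta>) * (of_real h * cis \<theta>) +
        (Q (of_real t * cis \<theta>) * (of_real h * cis \<theta>) + of_real (L (of_real t * cis \<theta>)) * cnj (of_real h * cis \<theta>)) * (of_real t * cis \<theta>)))) (at t)"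
      by (intro has_derivative_mult_right has_derivative_Re has_derivative_mult 1 2)
    then show ?thesis
      unfolding has_field_derivative_def N'_def Let_def
      by (rule has_derivative_eq_rhs) (auto simp: fun_eq_iff algebra_simps)
  qed
  moreover have "(\<lambda>\<theta>. 2 * Re (P (of_real t * cis \<theta>) * (of_real t * cis \<theta>))) integrable_on cbox (-pi) pi" for t
    by (intro integrable_continuous continuous_intros cP)
  moreover have "continuous_on (UNIV \<times> cbox (-pi) pi) (\<lambda>(t, \<theta>). N' t \<theta>)"
    unfolding case_prod_beta N'_def Let_def by (intro continuous_intros cP Q L)
  ultimately have D: "(flux P has_real_derivative integral {-pi..pi} (N' t)) (at t)"
    using leibniz_rule_field_derivative[of UNIV "-pi" pi "\<lambda>t \<theta>. 2 * Re (P (of_real t * cis \<theta>) * (of_real t * cis \<theta>))"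
        "N'" t]
    unfolding flux_def[abs_def] by simp
  define E where "E = (\<lambda>\<theta>. let z = of_real t * cis \<theta> in \<i> * (Q z * z\<^sup>2 + P z * z) - \<i> * of_real (L z * t\<^sup>2))"
  have E: "((\<lambda>\<theta>. P (of_real t * cis \<theta>) * (of_real t * cis \<theta>)) has_vector_derivative E \<theta>) (at \<theta> within {-pi..pi})" for \<theta>
  proof -
    have 1: "((\<lambda>\<theta>. of_real t * cis \<theta>) has_derivative (\<lambda>h. of_real h * (\<i> * (of_real t * cis \<theta>)))) (at \<theta> within {-pi..pi})"
      using has_vector_derivative_mult_right[OF has_vector_derivative_cis, of "of_real t" \<theta> "{-pi..pi}"]
      unfolding has_vector_derivative_def
      by (rule has_derivative_eq_rhs) (auto simp: fun_eq_iff algebra_simps scaleR_conv_of_real)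
    note 2 = has_derivative_compose[OF 1 P]
    have n: "cis \<theta> * cnj (cis \<theta>) = 1" by (simp add: complex_norm_square[symmetric])
    have n': "cis \<theta> * (cnj (cis \<theta>) * x) = x" for x
      using n by (simp add: mult.assoc[symmetric])
    have "((\<lambda>\<theta>. P (of_real t * cis \<theta>) * (of_real t * cis \<theta>)) has_derivative
       (\<lambda>h. P (of_real t * cis \<theta>) * (of_real h * (\<i> * (of_real t * cis \<theta>))) +
        (Q (of_real t * cis \<theta>) * (of_real h * (\<i> * (of_real t * cis \<theta>))) + of_real (L (of_real t * cis \<theta>)) * cnj (of_real h * (\<i> * (of_real t * cis \<theta>)))) * (of_real t * cis \<theta>))) (at \<theta> within {-pi..pi})"
      by (intro has_derivative_mult 1 2)
    then show ?thesis
      unfolding has_vector_derivative_def E_def Let_def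
      by (rule has_derivative_eq_rhs) (simp add: fun_eq_iff algebra_simps scaleR_conv_of_real power2_eq_square n' del: cis_cnj)
  qed
  have "(E has_integral 0) {-pi..pi}"
    using fundamental_theorem_of_calculus[of "-pi" pi, OF _ E] by (simp add: cis_pi flip: cis_cnj)
  from has_integral_linear[OF this bounded_linear_Im]
  have E0: "((\<lambda>\<theta>. Im (E \<theta>)) has_integral 0) {-pi..pi}"
    by (simp add: o_def)
  have "((\<lambda>\<theta>. L (of_real t * cis \<theta>)) has_integral circ L t) {-pi..pi}"
    unfolding circ_def by (intro integrable_integral integrable_continuous_real continuous_intros L)
  then have "((\<lambda>\<theta>. 4 * t * L (of_real t * cis \<theta>)) has_integral 4 * t * circ L t) {-pi..pi}"
    by (rule has_integral_mult_right)
  \<comment> \<open>Pointwise, \<open>2 / t * Im (E \<theta>)\<close> is the radial derivative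
    \<open>N' t \<theta>\<close> minus \<open>4 * t * L\<close>. Hence the vanishing integral of
    \<open>E\<close> leaves only the term with \<open>L\<close>.\<close>
  from has_integral_add[OF this has_integral_mult_right[OF E0, of "2 / t"]]
  have "((\<lambda>\<theta>. 4 * t * L (of_real t * cis \<theta>) + 2 / t * Im (E \<theta>)) has_integral 4 * t * circ L t) {-pi..pi}"
    by simp
  moreover have "4 * t * L (of_real t * cis \<theta>) + 2 / t * Im (E \<theta>) = N' t \<theta>" for \<theta>
  proof -
    have "cos \<theta> * cos \<theta> + sin \<theta> * sin \<theta> = 1"
      using sin_cos_squared_add2[of \<theta>] by (simp add: power2_eq_square)
    then have n: "cos \<theta> * (cos \<theta> * x) + sin \<theta> * (sin \<theta> * x) = x" for x
      by algebra
    show ?thesis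
      using t by (simp add: E_def N'_def Let_def field_simps power2_eq_square)
        (simp add: n flip: distrib_left)
  qed
  ultimately have "integral {-pi..pi} (N' t) = 4 * t * circ L t"
    by (simp add: integral_unique)
  with D show ?thesis by simp
qed

section \<open>Disk integrals of locally bounded functions\<close>

lemma area_0 [simp]: "area g 0 = 0"
  by (simp add: area_def set_lebesgue_integral_def)

text \<open>Wide enough for the squared norm of \<psi>, which is controlled near the zeros of the
  velocity but may be redefined arbitrarily at the zeros themselves, and so need not be
  continuous.\<close>

definition loc_bounded :: "(complex \<Rightarrow> real) \<Rightarrow> bool" where
  "loc_bounded g \<longleftrightarrow> g \<in> borel_measurable borel \<and> (\<forall>R. \<exists>B. \<forall>z. norm z \<le> R \<longrightarrow> \<bar>g z\<bar> \<le> B)"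

lemma loc_bounded_continuous:
  assumes "continuous_on UNIV g"
  shows "loc_bounded g"
  unfolding loc_bounded_def
proof (intro conjI allI)
  show "g \<in> borel_measurable borel" using assms by (rule borel_measurable_continuous_onI)
  fix R :: real
  have "compact (g ` cball 0 R)"
    by (intro compact_continuous_image continuous_on_subset[OF assms]) auto
  then show "\<exists>B. \<forall>z. norm z \<le> R \<longrightarrow> \<bar>g z\<bar> \<le> B"
    using compact_imp_bounded[of "g ` cball 0 R"] unfolding bounded_iff by (metis imageI mem_cball_0 real_norm_def)
qed

lemma loc_bounded_add:
  assumes "loc_bounded f" "loc_bounded g"
  shows "loc_bounded (\<lambda>z. f z + g z)"
  unfolding loc_bounded_def
proof (intro conjI allI)
  fix R
  obtain B C where "\<And>z. norm z \<le> R \<Longrightarrow> \<bar>f z\<bar> \<le> B" "\<And>z. norm z \<le> R \<Longrightarrow> \<bar>g z\<bar> \<le> C"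
    using assms unfolding loc_bounded_def by metis
  then show "\<exists>B. \<forall>z. norm z \<le> R \<longrightarrow> \<bar>f z + g z\<bar> \<le> B"
    by (intro exI[of _ "B + C"]) (meson abs_triangle_ineq add_mono order_trans)
qed (use assms in \<open>auto simp: loc_bounded_def\<close>)

lemma loc_bounded_integrable:
  assumes "loc_bounded g"
  shows "integrable lborel (\<lambda>z. indicator (ball 0 t) z *\<^sub>R g z)"
proof -
  obtain B where B: "\<And>z. norm z \<le> t \<Longrightarrow> \<bar>g z\<bar> \<le> B" and m: "g \<in> borel_measurable borel"
    using assms unfolding loc_bounded_def by metis
  show ?thesis
  proof (rule Bochner_Integration.integrable_bound)
    show "integrable lborel (\<lambda>z. indicator (ball (0::complex) t) z * B)"
      by (intro integrable_mult_left integrable_real_indicator) (auto simp: emeasure_lborel_ball_finite[unfolded infinity_ennreal_def])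
    show "(\<lambda>z. indicator (ball 0 t) z *\<^sub>R g z) \<in> borel_measurable lborel"
      using m by (auto intro!: borel_measurable_times borel_measurable_indicator)
    show "AE z in lborel. norm (indicator (ball 0 t) z *\<^sub>R g z) \<le> norm (indicator (ball 0 t) z * B)"
      using B by (intro AE_I2) (auto simp: indicator_def dist_norm intro: order_trans[OF _ abs_ge_self])
  qed
qed

lemma area_add:
  assumes "loc_bounded f" "loc_bounded g"
  shows "area (\<lambda>z. f z + g z) t = area f t + area g t"
  unfolding area_def set_lebesgue_integral_def scaleR_add_right
  by (rule Bochner_Integration.integral_add[OF assms[THEN loc_bounded_integrable]])

lemma area_cmult: "area (\<lambda>z. c * g z) t = c * area g t"
  unfolding area_def set_lebesgue_integral_def by (simp add: mult.left_commute)

lemma area_cong_countable: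
  assumes "countable X" "\<And>z. z \<notin> X \<Longrightarrow> f z = g z"
  shows "area f t = area g t"
  unfolding area_def set_lebesgue_integral_def
  by (rule integral_discrete_difference[OF assms(1)]) (use assms(2) in auto)

lemma area_mono:
  assumes "loc_bounded f" "loc_bounded g" "countable X" "\<And>z. z \<notin> X \<Longrightarrow> norm z \<le> t \<Longrightarrow> f z \<le> g z"
  shows "area f t \<le> area g t"
proof -
  have "AE z in lborel. z \<notin> X"
    using assms(3) by (intro AE_not_in countable_imp_null_set_lborel)
  then have "AE z in lborel. indicator (ball 0 t) z *\<^sub>R f z \<le> indicator (ball 0 t) z *\<^sub>R g z"
    by eventually_elim (use assms(4) in \<open>auto simp: indicator_def\<close>)
  then show ?thesis
    unfolding area_def set_lebesgue_integral_def
    by (rule integral_mono_AE[OF assms(1,2)[THEN loc_bounded_integrable]])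
qed

lemma area_const: "t \<ge> 0 \<Longrightarrow> area (\<lambda>_. c) t = c * (pi * t\<^sup>2)"
  unfolding area_def set_lebesgue_integral_def by (simp add: content_ball unit_ball_vol_2)

lemma area_mono_radius:
  assumes f: "loc_bounded f" "\<And>z. f z \<ge> 0" and t: "u \<le> v"
  shows "area f u \<le> area f v"
  unfolding area_def set_lebesgue_integral_def
  using t f(2) by (intro integral_mono loc_bounded_integrable[OF f(1)]) (auto simp: indicator_def)

text \<open>The integral over an annulus is at most the local bound times the area of the annulus.
  Radius 0 is included because the constant of integration in \<open>flux_eq_area\<close> is
  determined there.\<close>

lemma continuous_on_area:
  assumes g: "loc_bounded g"
  shows "continuous_on {0..} (area g)"
proof -
  have m: "g \<in> borel_measurable borel" using g by (simp add: loc_bounded_def)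
  have lip: "\<bar>area g v - area g u\<bar> \<le> B * (pi * v\<^sup>2 - pi * u\<^sup>2)"
    if uv: "0 \<le> u" "u \<le> v" "v \<le> R" and B: "\<And>z. norm z \<le> R \<Longrightarrow> \<bar>g z\<bar> \<le> B" for u v R B
  proof -
    note i = loc_bounded_integrable[OF g]
    note iB = loc_bounded_integrable[OF loc_bounded_continuous[OF continuous_on_const[of _ B]]]
    have vol: "(LINT z|lborel. indicator (ball (0::complex) s) z *\<^sub>R B) = B * (pi * s\<^sup>2)" if "s \<ge> 0" for s
      using area_const[OF that] by (simp add: area_def set_lebesgue_integral_def)
    have "\<bar>area g v - area g u\<bar> = \<bar>LINT z|lborel. indicator (ball 0 v) z *\<^sub>R g z - indicator (ball 0 u) z *\<^sub>R g z\<bar>"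
      unfolding area_def set_lebesgue_integral_def by (subst Bochner_Integration.integral_diff[OF i i]) simp
    also have "\<dots> \<le> (LINT z|lborel. indicator (ball (0::complex) v) z *\<^sub>R B - indicator (ball (0::complex) u) z *\<^sub>R B)"
      using uv B by (intro integral_abs_bound_integral Bochner_Integration.integrable_diff i iB) (auto simp: indicator_def)
    also have "\<dots> = B * (pi * v\<^sup>2 - pi * u\<^sup>2)"
      unfolding Bochner_Integration.integral_diff[OF iB iB] vol[OF uv(1)] vol[OF order_trans[OF uv(1,2)]]
      by (simp add: algebra_simps)
    finally show ?thesis .
  qed
  show ?thesis
    unfolding continuous_on_def
  proof
    fix t :: real assume t: "t \<in> {0..}"
    obtain B where B: "\<And>z. norm z \<le> t + 1 \<Longrightarrow> \<bar>g z\<bar> \<le> B" using g unfolding loc_bounded_def by metis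
    have "B \<ge> 0" using B[of 0] t by auto
    have "((\<lambda>s. B * pi * \<bar>s\<^sup>2 - t\<^sup>2\<bar>) \<longlongrightarrow> B * pi * \<bar>t\<^sup>2 - t\<^sup>2\<bar>) (at t within {0..})"
      by (intro tendsto_intros)
    then have z: "((\<lambda>s. B * pi * \<bar>s\<^sup>2 - t\<^sup>2\<bar>) \<longlongrightarrow> 0) (at t within {0..})" by simp
    have "((\<lambda>s. area g s - area g t) \<longlongrightarrow> 0) (at t within {0..})"
    proof (rule Lim_null_comparison[OF _ z])
      have "norm (area g s - area g t) \<le> B * pi * \<bar>s\<^sup>2 - t\<^sup>2\<bar>" if s: "s \<ge> 0" "s \<le> t + 1" for s
      proof (cases "s \<le> t")
        case True
        then have "s\<^sup>2 \<le> t\<^sup>2" using s by (intro power_mono) auto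
        then show ?thesis using lip[of s t "t + 1", OF s(1) True _ B] by (simp add: abs_minus_commute algebra_simps)
      next
        case False
        then have "t\<^sup>2 \<le> s\<^sup>2" using s t by (intro power_mono) auto
        then show ?thesis using lip[of t s "t + 1", OF _ _ _ B] s t False by (simp add: algebra_simps)
      qed
      then show "\<forall>\<^sub>F s in at t within {0..}. norm (area g s - area g t) \<le> B * pi * \<bar>s\<^sup>2 - t\<^sup>2\<bar>"
        unfolding eventually_at by (intro exI[of _ 1]) (auto simp: dist_real_def)
    qed
    then show "(area g \<longlongrightarrow> area g t) (at t within {0..})" by (rule LIM_zero_cancel)
  qed
qed

text \<open>Green's theorem on disks, obtained in the radial variable: both sides have the same
  derivative for positive radii, are continuous up to radius 0 and vanish there.\<close>

lemma flux_eq_area: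
  assumes P: "\<And>z. (P has_derivative (\<lambda>v. Q z * v + of_real (L z) * cnj v)) (at z)"
    and Q: "continuous_on UNIV Q" and L: "continuous_on UNIV L" and t: "t > 0"
  shows "flux P t = 4 * area L t"
proof -
  have cP: "continuous_on UNIV P"
    by (meson P continuous_at_imp_continuous_on has_derivative_continuous)
  have "continuous_on (UNIV \<times> cbox (-pi) pi) (\<lambda>(t, \<theta>). 2 * Re (P (of_real t * cis \<theta>) * (of_real t * cis \<theta>)))"
    unfolding case_prod_beta by (intro continuous_intros cP)
  from integral_continuous_on_param[OF this] have "continuous_on UNIV (flux P)"
    unfolding flux_def[abs_def] by simp
  then have "continuous_on {0..t} (\<lambda>t. flux P t - 4 * area L t)"
    using continuous_on_area[OF loc_bounded_continuous[OF L]] by (intro continuous_intros) (auto intro: continuous_on_subset)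
  moreover have "((\<lambda>t. flux P t - 4 * area L t) has_real_derivative 0) (at x)" if "0 < x" for x
    using has_real_derivative_flux[OF P Q L that] has_real_derivative_area[OF L that]
    by (auto intro!: derivative_eq_intros)
  ultimately have "flux P t - 4 * area L t = flux P 0 - 4 * area L 0"
    using t by (intro DERIV_isconst_end) auto
  then show ?thesis by (simp add: flux_def)
qed

text \<open>The derivative of \<open>circ U\<close> at \<open>t\<close> is
  \<open>flux P t / t\<close>, so integrating the flux formula in \<open>t\<close> is enough. The 4
  appears because \<open>L\<close> = \<partial>\<partial>bar U is a quarter of the
  Laplacian.\<close>

theorem jensen_formula:
  assumes U: "\<And>z. (U has_derivative (\<lambda>v. 2 * Re (P z * v))) (at z)"
    and P: "\<And>z. (P has_derivative (\<lambda>v. Q z * v + of_real (L z) * cnj v)) (at z)"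
    and Q: "continuous_on UNIV Q" and L: "continuous_on UNIV L" and "0 < s" "s \<le> r"
  shows "((\<lambda>t. 1 / t * area L t) has_integral (circ U r - circ U s) / 4) {s..r}"
proof -
  have cP: "continuous_on UNIV P"
    by (meson P continuous_at_imp_continuous_on has_derivative_continuous)
  have "(circ U has_real_derivative 4 * (1 / t * area L t)) (at t)" if "t > 0" for t
  proof -
    have "t * integral {-pi..pi} (\<lambda>\<theta>. 2 * Re (P (of_real t * cis \<theta>) * cis \<theta>)) = flux P t"
      unfolding flux_def by (subst integral_mult_right[symmetric]) (simp add: algebra_simps)
    then have "integral {-pi..pi} (\<lambda>\<theta>. 2 * Re (P (of_real t * cis \<theta>) * cis \<theta>)) = flux P t / t"
      using that by (simp only: nonzero_eq_divide_eq) (simp only: mult.commute)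
    then show ?thesis
      using has_real_derivative_circ[OF U cP, of t] flux_eq_area[OF P Q L that] that
      by simp
  qed
  then have "((\<lambda>t. 4 * (1 / t * area L t)) has_integral circ U r - circ U s) {s..r}"
    using assms by (intro fundamental_theorem_of_calculus)
      (auto simp: has_real_derivative_iff_has_vector_derivative[symmetric] intro: has_field_derivative_at_within)
  from has_integral_mult_right[OF this, of "1/4"] show ?thesis by simp
qed

section \<open>Growth of characteristic functions\<close>

text \<open>On the exceptional set \<open>\<phi>' / \<phi>\<^sup>2\<close> exceeds 1, while it is
  the derivative of \<open>- 1 / \<phi>\<close>, whose total increase is at most
  \<open>1 / \<phi> r0\<close>. This number therefore bounds the measure of the set.\<close>

lemma borel_growth_lemma:
  fixes \<phi> \<phi>' :: "real \<Rightarrow> real"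
  assumes d: "\<And>t. t \<ge> r0 \<Longrightarrow> (\<phi> has_real_derivative \<phi>' t) (at t)"
    and c: "continuous_on {r0..} \<phi>'" and nn: "\<And>t. t \<ge> r0 \<Longrightarrow> \<phi>' t \<ge> 0" and pos: "\<phi> r0 > 0"
  shows "{t. t \<ge> r0 \<and> \<phi>' t > (\<phi> t)\<^sup>2} \<in> lmeasurable"
proof -
  define E where "E = {t. t \<ge> r0 \<and> \<phi>' t > (\<phi> t)\<^sup>2}"
  \<comment> \<open>Freezing the argument at \<open>r0\<close> extends the quotient continuously to
    the whole line and thereby makes it Borel measurable.\<close>
  define f where "f = (\<lambda>t. \<phi>' (max r0 t) / (\<phi> (max r0 t))\<^sup>2)"
  have ge: "\<phi> t \<ge> \<phi> r0" if "t \<ge> r0" for t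
    by (rule DERIV_nonneg_imp_nondecreasing[OF that]) (use d nn in auto)
  have pos': "\<phi> t > 0" if "t \<ge> r0" for t using ge[OF that] pos by simp
  have c\<phi>: "continuous_on {r0..} \<phi>"
    using d by (meson DERIV_isCont atLeast_iff continuous_at_imp_continuous_on)
  have cm: "continuous_on UNIV (\<lambda>t. \<phi>' (max r0 t))" "continuous_on UNIV (\<lambda>t. \<phi> (max r0 t))"
    by (rule continuous_on_compose2[OF c] continuous_on_compose2[OF c\<phi>]; auto intro!: continuous_intros)+
  have "continuous_on UNIV f"
    unfolding f_def by (intro continuous_on_divide cm continuous_intros) (use pos' in \<open>auto simp: less_imp_neq[THEN not_sym]\<close>)
  then have fm: "f \<in> borel_measurable borel" by (rule borel_measurable_continuous_onI)
  have E_eq: "E = {r0..} \<inter> {t. 1 < f t}"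
    using pos' by (fastforce simp: E_def f_def max_def less_divide_eq)
  have "{t. 1 < f t} \<in> sets borel" using fm by measurable
  then have Es: "E \<in> sets borel" unfolding E_eq by auto
  have bd: "emeasure lborel (E \<inter> {r0..r0 + real n}) \<le> ennreal (1 / \<phi> r0)" for n
  proof -
    have "emeasure lborel (E \<inter> {r0..r0 + real n}) = (\<integral>\<^sup>+ t. indicator (E \<inter> {r0..r0 + real n}) t \<partial>lborel)"
      using Es by simp
    also have "\<dots> \<le> (\<integral>\<^sup>+ t. ennreal (f t) * indicator {r0..r0 + real n} t \<partial>lborel)"
      by (rule nn_integral_mono) (auto simp: E_eq indicator_def)
    also have "\<dots> = (- 1 / \<phi> (r0 + real n)) - (- 1 / \<phi> r0)"
    proof (rule nn_integral_FTC_Icc[OF fm])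
      fix t assume "t \<in> {r0..r0 + real n}"
      then have t: "r0 \<le> t" "t \<le> r0 + real n" by auto
      then have p: "\<phi> t \<noteq> 0" using pos'[of t] by simp
      show "((\<lambda>t. - 1 / \<phi> t) has_real_derivative f t) (at t)"
        using p t by (auto intro!: derivative_eq_intros d simp: f_def power2_eq_square max_def)
      show "0 \<le> f t" using nn[of t] t by (simp add: f_def max_def)
    qed simp
    also have "\<dots> \<le> ennreal (1 / \<phi> r0)"
      using pos'[of "r0 + real n"] by (intro ennreal_leI) simp
    finally show ?thesis .
  qed
  have "E = (\<Union>n. E \<inter> {r0..r0 + real n})"
  proof -
    have "\<exists>n. t \<le> r0 + real n" for t
      using real_arch_simple[of "t - r0"] by (auto simp: algebra_simps)
    then show ?thesis by (auto simp: E_def)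
  qed
  moreover have "(SUP n. emeasure lborel (E \<inter> {r0..r0 + real n})) = emeasure lborel (\<Union>n. E \<inter> {r0..r0 + real n})"
    using Es by (intro SUP_emeasure_incseq) (auto simp: incseq_def)
  ultimately have "emeasure lborel E \<le> ennreal (1 / \<phi> r0)"
    using bd by (metis SUP_least)
  then have "emeasure lebesgue E < \<infinity>"
    using Es by (simp add: order_le_less_trans)
  then show ?thesis using Es unfolding E_def[symmetric] by (intro fmeasurableI) auto
qed

lemma continuous_on_char_integrand:
  assumes "loc_bounded g" "0 < s"
  shows "continuous_on {s..r} (\<lambda>t. 1 / t * area g t)"
  by (intro continuous_intros continuous_on_subset[OF continuous_on_area[OF assms(1)]]) (use assms(2) in auto)

text \<open>The characteristic function with a free lower limit: Jensen's formula has to start on a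
  circle without zeros of the velocity, and the unit circle may contain some.\<close>

definition log_area :: "(complex \<Rightarrow> real) \<Rightarrow> real \<Rightarrow> real \<Rightarrow> real" where
  "log_area g s r = integral {s..r} (\<lambda>t. 1 / t * area g t)"

lemma log_area_integrable:
  assumes "loc_bounded g" "0 < s"
  shows "(\<lambda>t. 1 / t * area g t) integrable_on {s..r}"
  by (intro integrable_continuous_real continuous_on_char_integrand assms)

lemma log_area_add:
  assumes "loc_bounded f" "loc_bounded g" "0 < s"
  shows "log_area (\<lambda>z. f z + g z) s r = log_area f s r + log_area g s r"
  unfolding log_area_def area_add[OF assms(1,2)] distrib_left
  by (rule Henstock_Kurzweil_Integration.integral_add[OF assms(1,2)[THEN log_area_integrable, OF assms(3)]])

lemma log_area_combine:
  assumes "loc_bounded g" "0 < s" "s \<le> u" "u \<le> r"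
  shows "log_area g s u + log_area g u r = log_area g s r"
  unfolding log_area_def
  by (rule Henstock_Kurzweil_Integration.integral_combine[OF assms(3,4) log_area_integrable[OF assms(1,2)]])

lemma has_real_derivative_log_area:
  assumes "loc_bounded g" "0 < s" "s < t"
  shows "(log_area g s has_real_derivative area g t / t) (at t)"
proof -
  have "(log_area g s has_real_derivative 1 / t * area g t) (at t within {s..t + 1})"
    unfolding log_area_def[abs_def]
    by (rule integral_has_real_derivative[OF continuous_on_char_integrand[OF assms(1,2)]]) (use assms in auto)
  then show ?thesis
    using assms at_within_interior[of t "{s..t + 1}"] by (simp add: interior_atLeastAtMost_real)
qed

text \<open>Here \<open>\<kappa>\<close> is \<partial>\<partial>bar log a off the zeros of
  \<open>a\<close>. In the difference of the two circle integrals of log (a + \<epsilon>),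
  \<open>c\<close> bounds the inner one from below and \<open>K\<close> the outer one from
  above.\<close>

theorem log_area_le_circle_mean:
  fixes a \<kappa> a_zzbar :: "complex \<Rightarrow> real" and a_z a_zz :: "complex \<Rightarrow> complex"
  assumes a_nonneg: "\<And>z. a z \<ge> 0"
    and da: "\<And>z. (a has_derivative (\<lambda>v. 2 * Re (a_z z * v))) (at z)"
    and dA1: "\<And>z. (a_z has_derivative (\<lambda>v. a_zz z * v + of_real (a_zzbar z) * cnj v)) (at z)"
    and cA2: "continuous_on UNIV a_zz" and cA11: "continuous_on UNIV a_zzbar"
    and Z: "countable {z. a z = 0}"
    and \<kappa>: "\<And>z. a z \<noteq> 0 \<Longrightarrow> \<kappa> z = a_zzbar z / a z - (norm (a_z z))\<^sup>2 / (a z)\<^sup>2"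
    and lb: "loc_bounded \<kappa>"
    and s: "0 < s" "s \<le> r" and c: "c > 0" "\<And>z. norm z = s \<Longrightarrow> c \<le> a z"
    and K: "K > 0" "circ a r / (2 * pi) \<le> K"
  shows "log_area \<kappa> s r \<le> pi / 2 * (ln K - ln c)"
proof -
  have ca: "continuous_on UNIV a" by (meson da continuous_at_imp_continuous_on has_derivative_continuous)
  have cA1: "continuous_on UNIV a_z" by (meson dA1 continuous_at_imp_continuous_on has_derivative_continuous)
  obtain B0 where B0: "\<And>z. norm z \<le> r \<Longrightarrow> \<bar>\<kappa> z\<bar> \<le> B0" using lb unfolding loc_bounded_def by metis
  define B where "B = max B0 0"
  have B: "B \<ge> 0" "\<And>z. norm z \<le> r \<Longrightarrow> \<bar>\<kappa> z\<bar> \<le> B" using B0 by (force simp: B_def)+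
  define e where "e n = 1 / real (Suc n)" for n
  have e: "e n > 0" for n by (simp add: e_def)
  have elim: "e \<longlonglongrightarrow> 0" unfolding e_def by (rule LIMSEQ_Suc[OF lim_1_over_n])
  \<comment> \<open>The weight that is lost when \<open>a / (a + e n)\<close> replaces 1. Its disk
    integral \<open>\<delta> n\<close> tends to 0 by dominated convergence, since pointwise
    convergence fails only at the zeros of \<open>a\<close>.\<close>
  define w where "w n z = e n / (a z + e n)" for n z
  have ae: "a z + e n > 0" for z n using a_nonneg[of z] e[of n] by simp
  have ane: "a z + e n \<noteq> 0" for z n using ae[of z n] by simp
  have cw: "continuous_on UNIV (w n)" for n
    unfolding w_def by (intro continuous_intros ca) (use ane in auto)
  have w01: "0 \<le> w n z" "w n z \<le> 1" for n z
    using a_nonneg[of z] e[of n] by (auto simp: w_def divide_simps)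
  define \<delta> where "\<delta> n = area (w n) r" for n
  have \<delta>: "\<delta> \<longlonglongrightarrow> 0"
  proof -
    have "(\<lambda>n. LINT z|lborel. indicator (ball 0 r) z *\<^sub>R w n z) \<longlonglongrightarrow> (LINT z::complex|lborel. (0::real))"
    proof (rule integral_dominated_convergence[where w="\<lambda>z::complex. indicator (ball 0 r) z *\<^sub>R (1::real)"])
      show "integrable lborel (\<lambda>z::complex. indicator (ball 0 r) z *\<^sub>R (1::real))"
        by (rule loc_bounded_integrable[OF loc_bounded_continuous]) auto
      show "(\<lambda>z. indicator (ball 0 r) z *\<^sub>R w n z) \<in> borel_measurable lborel" for n
        using loc_bounded_integrable[OF loc_bounded_continuous[OF cw]] by (rule borel_measurable_integrable)
      have "AE z in lborel. z \<notin> {z. a z = 0}"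
        by (intro AE_not_in countable_imp_null_set_lborel Z)
      then show "AE z in lborel. (\<lambda>n. indicator (ball 0 r) z *\<^sub>R w n z) \<longlonglongrightarrow> 0"
      proof eventually_elim
        case (elim z)
        then have "(\<lambda>n. indicator (ball 0 r) z *\<^sub>R w n z) \<longlonglongrightarrow> indicator (ball 0 r) z *\<^sub>R (0 / (a z + 0))"
          unfolding w_def by (intro tendsto_intros \<open>e \<longlonglongrightarrow> 0\<close>) auto
        then show ?case by simp
      qed
      show "AE z in lborel. norm (indicator (ball 0 r) z *\<^sub>R w n z) \<le> indicator (ball 0 r) z *\<^sub>R 1" for n
        using w01 by (auto simp: indicator_def)
    qed auto
    then show ?thesis unfolding \<delta>_def[abs_def] by (simp add: area_def set_lebesgue_integral_def)
  qed
  define b where "b n = pi / 2 * (ln (K + e n) - ln c) + B * \<delta> n * (ln r - ln s)" for n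
  have main: "log_area \<kappa> s r \<le> b n" for n
  proof -
    define U where "U z = ln (a z + e n)" for z
    define P where "P z = a_z z / of_real (a z + e n)" for z
    define Q where "Q z = a_zz z / of_real (a z + e n) - (a_z z)\<^sup>2 / of_real ((a z + e n)\<^sup>2)" for z
    define L where "L z = a_zzbar z / (a z + e n) - (norm (a_z z))\<^sup>2 / (a z + e n)\<^sup>2" for z
    have dU: "(U has_derivative (\<lambda>v. 2 * Re (P z * v))) (at z)" for z
    proof -
      have "(U has_derivative (\<lambda>v. 2 * Re (a_z z * v) * inverse (a z + e n))) (at z)"
        unfolding U_def using ae[of z n] by (auto intro!: derivative_eq_intros da)
      then show ?thesis
        by (rule has_derivative_eq_rhs) (use ane[of z n] in \<open>simp add: fun_eq_iff P_def field_simps Re_divide_of_real flip: of_real_add\<close>)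
    qed
    have dP: "(P has_derivative (\<lambda>v. Q z * v + of_real (L z) * cnj v)) (at z)" for z
    proof -
      define k where "k = complex_of_real (a z + e n)"
      have k: "k \<noteq> 0" using ane[of z n] by (simp add: k_def flip: of_real_add)
      have "((\<lambda>z. complex_of_real (a z + e n)) has_derivative (\<lambda>v. of_real (2 * Re (a_z z * v)))) (at z)"
        by (intro has_derivative_of_real) (auto intro!: derivative_eq_intros da)
      from has_derivative_divide[OF dA1 this] k
      have "(P has_derivative (\<lambda>v. - a_z z * (inverse k * of_real (2 * Re (a_z z * v)) * inverse k) +
          (a_zz z * v + of_real (a_zzbar z) * cnj v) / k)) (at z)"
        unfolding P_def[abs_def] k_def by auto
      moreover have "- a_z z * (inverse k * of_real (2 * Re (a_z z * v)) * inverse k) + (a_zz z * v + of_real (a_zzbar z) * cnj v) / k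
        = Q z * v + of_real (L z) * cnj v" for v
      proof -
        have 1: "of_real (2 * Re (a_z z * v)) = a_z z * v + cnj (a_z z) * cnj v"
          by (simp add: complex_eq_iff)
        have 2: "Q z = a_zz z / k - (a_z z)\<^sup>2 / k\<^sup>2" by (simp add: Q_def k_def)
        have 3: "of_real (L z) = of_real (a_zzbar z) / k - (a_z z * cnj (a_z z)) / k\<^sup>2"
          by (simp add: L_def k_def complex_norm_square[symmetric])
        show ?thesis unfolding 1 2 3 using k by (simp add: field_simps power2_eq_square)
      qed
      ultimately show ?thesis by simp
    qed
    have ck: "continuous_on UNIV (\<lambda>z. a z + e n)" by (intro continuous_intros ca)
    have cQ: "continuous_on UNIV Q" unfolding Q_def[abs_def]
      by (intro continuous_intros ck cA2 cA1) (use ane in \<open>auto simp flip: of_real_add\<close>)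
    have cL: "continuous_on UNIV L" unfolding L_def[abs_def]
      by (intro continuous_intros ck cA11 cA1) (use ane in auto)
    have jen: "log_area L s r = (circ U r - circ U s) / 4"
      unfolding log_area_def using jensen_formula[OF dU dP cQ cL s] by (rule integral_unique)
    \<comment> \<open>With k = a + e n, \<open>L\<close> equals \<kappa> a / k plus |a_z|^2 (1 / (a
      k) - 1 / k^2). The second term is nonnegative since k \<ge> a, so the only loss is in the
      weight of \<kappa>, which may be negative.\<close>
    have L_ge: "\<kappa> z \<le> L z + B * w n z" if z: "a z \<noteq> 0" "norm z \<le> r" for z
    proof -
      have apos: "a z > 0" using z(1) a_nonneg[of z] by simp
      define k where "k = a z + e n"
      have k: "k > 0" using ae by (simp add: k_def)
      have A: "a_zzbar z = a z * \<kappa> z + (norm (a_z z))\<^sup>2 / a z"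
        using apos unfolding \<kappa>[OF z(1)] by (simp add: field_simps power2_eq_square)
      have "L z = \<kappa> z * (a z / k) + (norm (a_z z))\<^sup>2 * (1 / (a z * k) - 1 / k\<^sup>2)"
        unfolding L_def A k_def[symmetric] using k apos by (simp add: field_simps power2_eq_square)
      moreover have "1 / (a z * k) - 1 / k\<^sup>2 \<ge> 0"
      proof -
        have "a z * k \<le> k\<^sup>2"
          unfolding power2_eq_square using k e[of n] by (intro mult_right_mono) (auto simp: k_def)
        then show ?thesis using apos k by (simp add: frac_le)
      qed
      ultimately have "L z \<ge> \<kappa> z * (a z / k)" by simp
      moreover have "a z / k = 1 - w n z"
        using k by (simp add: w_def k_def field_simps)
      moreover have "\<kappa> z * w n z \<le> B * w n z"
        using B(2)[OF z(2)] w01 by (intro mult_right_mono) auto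
      ultimately show ?thesis by (simp add: algebra_simps)
    qed
    have lbL: "loc_bounded L" and lbw: "loc_bounded (\<lambda>z. B * w n z)" and lbw': "loc_bounded (w n)"
      by (intro loc_bounded_continuous cL cw continuous_intros)+
    have "log_area \<kappa> s r \<le> integral {s..r} (\<lambda>t. 1 / t * area L t + B * \<delta> n * (1 / t))"
      unfolding log_area_def
    proof (rule integral_le[OF log_area_integrable[OF lb s(1)]])
      show "(\<lambda>t. 1 / t * area L t + B * \<delta> n * (1 / t)) integrable_on {s..r}"
        using s by (intro integrable_continuous_real continuous_on_add continuous_on_char_integrand[OF lbL] continuous_intros) auto
      fix t assume t: "t \<in> {s..r}"
      have "area \<kappa> t \<le> area (\<lambda>z. L z + B * w n z) t"
        by (rule area_mono[OF lb loc_bounded_add[OF lbL lbw] Z]) (use L_ge t in auto)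
      also have "\<dots> = area L t + B * area (w n) t"
        by (simp add: area_add[OF lbL lbw] area_cmult)
      also have "\<dots> \<le> area L t + B * \<delta> n"
        unfolding \<delta>_def using t B(1) w01 by (intro add_left_mono mult_left_mono area_mono_radius lbw') auto
      finally have "1 / t * area \<kappa> t \<le> 1 / t * (area L t + B * \<delta> n)"
        using t s by (intro mult_left_mono) auto
      then show "1 / t * area \<kappa> t \<le> 1 / t * area L t + B * \<delta> n * (1 / t)"
        by (simp add: distrib_left mult.commute)
    qed
    also have "\<dots> = log_area L s r + B * \<delta> n * (ln r - ln s)"
    proof -
      have "((\<lambda>t. 1 / t) has_integral ln r - ln s) {s..r}"
        using s by (intro fundamental_theorem_of_calculus)
          (auto simp: has_real_derivative_iff_has_vector_derivative[symmetric] intro!: derivative_eq_intros)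
      from has_integral_add[OF integrable_integral[OF log_area_integrable[OF lbL s(1)]] has_integral_mult_right[OF this, of "B * \<delta> n"]]
      show ?thesis unfolding log_area_def by (rule integral_unique)
    qed
    also have "log_area L s r \<le> pi / 2 * (ln (K + e n) - ln c)"
    proof -
      have cU: "continuous_on UNIV U" unfolding U_def[abs_def] by (intro continuous_intros ca) (use ane in auto)
      have i: "(\<lambda>\<theta>. g (of_real t * cis \<theta>)) integrable_on {-pi..pi}" if "continuous_on UNIV g" for g :: "complex \<Rightarrow> real" and t
        by (intro integrable_continuous_real continuous_intros that)
      define k where "k = K + e n"
      have k: "k > 0" using K e[of n] by (simp add: k_def)
      \<comment> \<open>Concavity in the form that the logarithm lies below its tangent line at
        \<open>k\<close>. As \<open>circ a r \<le> 2 * pi * K\<close> and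
        \<open>k = K + e n\<close>, the linear terms add up to exactly 2 pi and cancel.\<close>
      have "circ U r \<le> integral {-pi..pi} (\<lambda>\<theta>. (ln k - 1 + e n / k) + 1 / k * a (of_real r * cis \<theta>))"
        unfolding circ_def
      proof (rule integral_le[OF i[OF cU]])
        show "(\<lambda>\<theta>. (ln k - 1 + e n / k) + 1 / k * a (of_real r * cis \<theta>)) integrable_on {-pi..pi}"
          by (intro integrable_continuous_real continuous_intros ca)
        fix \<theta>
        let ?x = "a (of_real r * cis \<theta>) + e n"
        have "ln (?x / k) \<le> ?x / k - 1" using ae k by (intro ln_le_minus_one) auto
        then have "ln ?x \<le> ln k + ?x / k - 1" using ae[of "of_real r * cis \<theta>" n] k by (simp add: ln_div split: if_splits)
        then show "U (of_real r * cis \<theta>) \<le> (ln k - 1 + e n / k) + 1 / k * a (of_real r * cis \<theta>)"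
          by (simp add: U_def add_divide_distrib)
      qed
      also have "\<dots> = 2 * pi * (ln k - 1 + e n / k) + 1 / k * circ a r"
        using has_integral_add[OF has_integral_const_real[of "ln k - 1 + e n / k" "-pi" pi] has_integral_mult_right[OF integrable_integral[OF i[OF ca]], of "1 / k" r]]
        unfolding circ_def by (subst integral_unique) auto
      also have "\<dots> \<le> 2 * pi * (ln k - 1 + e n / k) + 1 / k * (2 * pi * K)"
        using K k by (intro add_left_mono mult_left_mono) (auto simp: field_simps)
      also have "\<dots> = 2 * pi * ln k"
        using k by (simp add: field_simps) (simp add: k_def algebra_simps)
      finally have 1: "circ U r \<le> 2 * pi * ln k" .
      have "integral {-pi..pi} (\<lambda>\<theta>. ln c) \<le> circ U s"
        unfolding circ_def
      proof (rule integral_le[OF _ i[OF cU]])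
        fix \<theta>
        have "c \<le> a (of_real s * cis \<theta>)" using s by (intro c(2)) (simp add: norm_mult)
        then show "ln c \<le> U (of_real s * cis \<theta>)"
          unfolding U_def using c(1) e[of n] by simp
      qed auto
      with 1 show ?thesis unfolding jen k_def by (simp add: field_simps)
    qed
    finally show ?thesis by (simp add: b_def)
  qed
  have "b \<longlonglongrightarrow> pi / 2 * (ln (K + 0) - ln c) + B * 0 * (ln r - ln s)"
    unfolding b_def using K by (intro tendsto_intros elim \<delta>) auto
  then show ?thesis
    using main by (intro LIMSEQ_le_const[of b]) auto
qed

lemma characteristic_eq_log_area:
  assumes "loc_bounded g"
  shows "characteristic g r = log_area g 1 r"
  unfolding characteristic_def log_area_def area_def[symmetric]
  by (intro set_borel_integral_eq_integral(2) borel_integrable_atLeastAtMost' continuous_on_char_integrand assms) simp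

text \<open>The part of the proof that is pure function theory on the plane. The formula for
  \<open>q\<close> says that \<partial>\<partial>bar log a = a + q off the zeros of
  \<open>a\<close>, so the sum of the two characteristic functions is the one estimated by
  \<open>log_area_le_circle_mean\<close>.\<close>

theorem characteristic_bound_outside_exceptional_set:
  fixes a q a_zzbar :: "complex \<Rightarrow> real" and a_z a_zz :: "complex \<Rightarrow> complex"
  assumes a_nonneg: "\<And>z. a z \<ge> 0"
    and da: "\<And>z. (a has_derivative (\<lambda>v. 2 * Re (a_z z * v))) (at z)"
    and dA1: "\<And>z. (a_z has_derivative (\<lambda>v. a_zz z * v + of_real (a_zzbar z) * cnj v)) (at z)"
    and cA2: "continuous_on UNIV a_zz" and cA11: "continuous_on UNIV a_zzbar"
    and Z: "countable {z. a z = 0}"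
    and q: "\<And>z. a z \<noteq> 0 \<Longrightarrow> q z = a_zzbar z / a z - (norm (a_z z))\<^sup>2 / (a z)\<^sup>2 - a z"
    and bdd: "\<And>R. \<exists>B. \<forall>z. norm z \<le> R \<longrightarrow> a z \<noteq> 0 \<longrightarrow> \<bar>q z\<bar> \<le> B"
  shows "\<exists>C>0. \<exists>E. E \<subseteq> {1..} \<and> E \<in> lmeasurable \<and>
           (\<forall>r. r \<ge> 1 \<and> r \<notin> E \<longrightarrow>
              characteristic a r + characteristic q r \<le> C * (ln r + ln (characteristic a r)))"
proof -
  have ca: "continuous_on UNIV a" by (meson da continuous_at_imp_continuous_on has_derivative_continuous)
  have cA1: "continuous_on UNIV a_z" by (meson dA1 continuous_at_imp_continuous_on has_derivative_continuous)
  \<comment> \<open>Nothing is known about \<open>q\<close> at the zeros of \<open>a\<close>. This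
    representative is visibly measurable and has the same disk integrals, because the zeros are
    countable.\<close>
  define q' where "q' z = (if a z = 0 then 0 else a_zzbar z / a z - (norm (a_z z))\<^sup>2 / (a z)\<^sup>2 - a z)" for z
  note meas = ca[THEN borel_measurable_continuous_onI] cA1[THEN borel_measurable_continuous_onI] cA11[THEN borel_measurable_continuous_onI]
  have lba: "loc_bounded a" using ca by (rule loc_bounded_continuous)
  have lbq: "loc_bounded q'"
    unfolding loc_bounded_def
  proof (intro conjI allI)
    show "q' \<in> borel_measurable borel"
      unfolding q'_def using meas by measurable
    fix R
    obtain B where "\<forall>z. norm z \<le> R \<longrightarrow> a z \<noteq> 0 \<longrightarrow> \<bar>q z\<bar> \<le> B" using bdd by metis
    then show "\<exists>B. \<forall>z. norm z \<le> R \<longrightarrow> \<bar>q' z\<bar> \<le> B"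
      using q by (intro exI[of _ "\<bar>B\<bar>"]) (auto simp: q'_def intro: order_trans[OF _ abs_ge_self])
  qed
  define \<kappa> where "\<kappa> z = a z + q' z" for z
  have lbk: "loc_bounded \<kappa>" unfolding \<kappa>_def[abs_def] by (rule loc_bounded_add[OF lba lbq])
  have k_eq: "\<kappa> z = a_zzbar z / a z - (norm (a_z z))\<^sup>2 / (a z)\<^sup>2" if "a z \<noteq> 0" for z
    using that by (simp add: \<kappa>_def q'_def)
  have char_q: "characteristic q r = characteristic q' r" for r
  proof -
    have "area q t = area q' t" for t
      by (rule area_cong_countable[OF Z]) (use q in \<open>auto simp: q'_def\<close>)
    then show ?thesis unfolding characteristic_def area_def[symmetric] by simp
  qed
  have sum_eq: "characteristic a r + characteristic q r = log_area \<kappa> 1 r" for r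
    unfolding char_q characteristic_eq_log_area[OF lba] characteristic_eq_log_area[OF lbq] \<kappa>_def[abs_def]
    by (rule log_area_add[OF lba lbq, symmetric]) simp
  text \<open>The start circle has to avoid the zeros of \<open>a\<close>, whose moduli form a countable set.\<close>
  have "uncountable ({0<..<1} - norm ` {z. a z = 0})"
    using Z by (intro uncountable_minus_countable uncountable_open_interval[THEN iffD2] countable_image) auto
  then obtain s where s: "0 < s" "s < 1" and sZ: "s \<notin> norm ` {z. a z = 0}"
    by (metis DiffE countable_empty ex_in_conv greaterThanLessThan_iff)
  obtain c where c: "c > 0" "\<And>z. norm z = s \<Longrightarrow> c \<le> a z"
  proof -
    have "\<exists>x\<in>sphere 0 s. \<forall>y\<in>sphere 0 s. a x \<le> a y"
    proof (rule continuous_attains_inf)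
      show "sphere (0::complex) s \<noteq> {}" using s by simp
    qed (auto intro: continuous_on_subset[OF ca])
    then obtain x where x: "norm x = s" "\<And>y. norm y = s \<Longrightarrow> a x \<le> a y" by (auto simp: dist_norm)
    have "a x \<noteq> 0" using x(1) sZ by auto
    with a_nonneg[of x] that[of "a x"] x(2) show ?thesis by simp
  qed
  \<comment> \<open>Collects what does not depend on \<open>r\<close>: the lower bound on the
    starting circle and the contribution of the radii between \<open>s\<close> and 1.\<close>
  define C0 where "C0 = - (pi / 2 * ln c) - log_area \<kappa> s 1"
  have main: "log_area \<kappa> 1 r \<le> pi / 2 * ln K + C0" if "r \<ge> 1" "K > 0" "circ a r / (2 * pi) \<le> K" for r K
  proof -
    have "log_area \<kappa> s r \<le> pi / 2 * (ln K - ln c)"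
      by (rule log_area_le_circle_mean[OF a_nonneg da dA1 cA2 cA11 Z k_eq lbk s(1) _ c that(2,3)])
        (use that s in auto)
    moreover have "log_area \<kappa> s 1 + log_area \<kappa> 1 r = log_area \<kappa> s r"
      using that s by (intro log_area_combine[OF lbk]) auto
    ultimately show ?thesis by (simp add: C0_def algebra_simps)
  qed
  define T where "T = log_area a 1"
  have area_nn: "area a t \<ge> 0" for t
    unfolding area_def set_lebesgue_integral_def using a_nonneg by (intro integral_nonneg_AE) auto
  have area1: "area a 1 > 0"
  proof (rule ccontr)
    assume "\<not> area a 1 > 0"
    then have "area a 1 = 0" using area_nn[of 1] by simp
    then have "AE z in lborel. indicator (ball 0 1) z *\<^sub>R a z = 0"
      unfolding area_def set_lebesgue_integral_def
      using integral_nonneg_eq_0_iff_AE[OF loc_bounded_integrable[OF lba]] a_nonneg by auto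
    moreover have "AE z in lborel. z \<notin> {z. a z = 0}"
      by (intro AE_not_in countable_imp_null_set_lborel Z)
    ultimately have "AE z in lborel. z \<notin> ball (0::complex) 1"
      by eventually_elim (auto simp: indicator_def)
    then have "emeasure lborel (ball (0::complex) 1) = 0"
      by (rule AE_iff_measurable[THEN iffD1, rotated 2]) auto
    moreover have "emeasure lborel (ball (0::complex) 1) = ennreal pi"
      by (subst emeasure_ball) (simp_all add: unit_ball_vol_2)
    ultimately show False by simp
  qed
  have dT: "(T has_real_derivative area a t / t) (at t)" if "t > 1" for t
    unfolding T_def by (rule has_real_derivative_log_area[OF lba]) (use that in auto)
  have T_ge: "T r \<ge> area a 1 * ln r" if "r \<ge> 1" for r
  proof -
    have "((\<lambda>t. area a 1 * (1 / t)) has_integral area a 1 * (ln r - ln 1)) {1..r}"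
      using that by (intro has_integral_mult_right fundamental_theorem_of_calculus)
        (auto simp: has_real_derivative_iff_has_vector_derivative[symmetric] intro!: derivative_eq_intros)
    moreover have "((\<lambda>t. 1 / t * area a t) has_integral T r) {1..r}"
      unfolding T_def log_area_def by (intro integrable_integral log_area_integrable lba) simp
    moreover have "area a 1 * (1 / t) \<le> 1 / t * area a t" if "t \<in> {1..r}" for t
      using that area_mono_radius[OF lba a_nonneg, of 1 t] by (simp add: divide_right_mono)
    ultimately have "area a 1 * (ln r - ln 1) \<le> T r" by (rule has_integral_le)
    then show ?thesis by simp
  qed
  \<comment> \<open>Since \<open>T\<close> grows at least like \<open>area a 1 * ln r\<close>, this
    gives \<open>T r0 \<ge> 1\<close> as well as \<open>ln r0 \<ge> 1\<close>. The first makes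
    \<open>ln (T r)\<close> nonnegative and starts the growth lemma with a positive value; the
    second lets \<open>ln r\<close> absorb additive constants. Smaller radii are put into the
    exceptional set.\<close>
  define r0 where "r0 = exp (max 1 (1 / area a 1))"
  have r0: "r0 > 1" "ln r0 \<ge> 1" by (auto simp: r0_def)
  have Tr0: "T r0 \<ge> 1"
  proof -
    have "1 = area a 1 * (1 / area a 1)" using area1 by simp
    also have "\<dots> \<le> area a 1 * ln r0" using area1 by (intro mult_left_mono) (auto simp: r0_def)
    also have "\<dots> \<le> T r0" using r0 by (intro T_ge) simp
    finally show ?thesis .
  qed
  have carea: "continuous_on {r0..} (area a)"
    using r0 by (intro continuous_on_subset[OF continuous_on_area[OF lba]]) auto
  \<comment> \<open>The exceptional sets of the growth lemma for \<open>T\<close>, with derivative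
    \<open>area a t / t\<close>, and for \<open>area a\<close>, with derivative
    \<open>t * circ a t\<close>.\<close>
  define E1 where "E1 = {t. t \<ge> r0 \<and> area a t / t > (T t)\<^sup>2}"
  define E2 where "E2 = {t. t \<ge> r0 \<and> t * circ a t > (area a t)\<^sup>2}"
  have E1: "E1 \<in> lmeasurable"
    unfolding E1_def
    using r0 Tr0 area_nn by (intro borel_growth_lemma dT continuous_on_divide carea continuous_intros) auto
  have E2: "E2 \<in> lmeasurable"
    unfolding E2_def
  proof (intro borel_growth_lemma)
    show "area a r0 > 0" using area1 area_mono_radius[OF lba a_nonneg, of 1 r0] r0 by simp
    show "continuous_on {r0..} (\<lambda>t. t * circ a t)"
      by (intro continuous_intros continuous_on_subset[OF continuous_on_circ[OF ca]]) auto
    fix t assume "r0 \<le> t"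
    then show "(area a has_real_derivative t * circ a t) (at t)" "0 \<le> t * circ a t"
      using r0 has_real_derivative_area[OF ca, of t] a_nonneg
      by (auto simp: circ_def intro!: mult_nonneg_nonneg integral_nonneg integrable_continuous_real continuous_intros ca)
  qed
  define E where "E = E1 \<union> E2 \<union> {1..r0}"
  \<comment> \<open>From \<open>pi / 2 * ln K = pi / 2 * (ln r + 4 * ln (T r))\<close> comes the
    \<open>2 * pi\<close>; \<open>\<bar>C0\<bar>\<close> is absorbed because
    \<open>ln r \<ge> 1\<close>.\<close>
  define C where "C = 2 * pi + \<bar>C0\<bar>"
  show ?thesis
  proof (intro exI[of _ C] exI[of _ E] conjI allI impI)
    show "C > 0" using pi_gt_zero by (simp add: C_def add_pos_nonneg)
    show "E \<subseteq> {1..}" using r0 by (auto simp: E_def E1_def E2_def)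
    show "E \<in> lmeasurable" unfolding E_def by (intro fmeasurable.Un E1 E2 lmeasurable_interval)
    fix r assume r: "1 \<le> r \<and> r \<notin> E"
    then have rr: "r > r0" and n1: "area a r / r \<le> (T r)\<^sup>2" and n2: "r * circ a r \<le> (area a r)\<^sup>2"
      by (auto simp: E_def E1_def E2_def)
    have r1: "r > 1" using rr r0 by simp
    have T1: "T r \<ge> 1"
    proof -
      have "T r0 \<le> T r"
      proof (rule DERIV_nonneg_imp_nondecreasing[where f=T])
        fix t assume "r0 \<le> t"
        then have "t > 1" using r0 by simp
        then show "\<exists>y. (T has_real_derivative y) (at t) \<and> 0 \<le> y"
          using dT[of t] area_nn[of t] by (intro exI[of _ "area a t / t"]) simp
      qed (use rr in simp)
      with Tr0 show ?thesis by simp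
    qed
    \<comment> \<open>Off \<open>E\<close> one has
      \<open>r * circ a r \<le> (area a r)\<^sup>2\<close> and
      \<open>area a r \<le> r * (T r)\<^sup>2\<close>; eliminating the area gives
      \<open>circ a r \<le> r * T r ^ 4\<close>.\<close>
    define K where "K = r * T r ^ 4"
    have K: "K > 0" using r1 T1 by (simp add: K_def)
    have "area a r \<le> r * (T r)\<^sup>2" using n1 r1 by (simp add: divide_simps mult.commute)
    then have "(area a r)\<^sup>2 \<le> (r * (T r)\<^sup>2)\<^sup>2" using area_nn by (intro power_mono) auto
    with n2 have "r * circ a r \<le> r * (r * T r ^ 4)"
      by (simp add: power2_eq_square power4_eq_xxxx algebra_simps)
    then have "circ a r \<le> K" using r1 by (simp add: K_def)
    also have "K \<le> K * (2 * pi)" using K pi_gt3 by simp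
    finally have "circ a r / (2 * pi) \<le> K" using pi_gt_zero by (simp add: divide_simps)
    from main[OF _ K this] r1 have "log_area \<kappa> 1 r \<le> pi / 2 * ln K + C0" by simp
    also have "ln K = ln r + 4 * ln (T r)"
      using r1 T1 by (simp add: K_def ln_mult ln_realpow)
    also have "pi / 2 * (ln r + 4 * ln (T r)) + C0 \<le> C * (ln r + ln (T r))"
    proof -
      have l1: "ln r \<ge> 1" using r0 rr by (meson ln_le_cancel_iff less_imp_le less_trans order_trans zero_less_one)
      have l2: "ln (T r) \<ge> 0" using T1 by simp
      have "pi * ln r \<ge> 0" using l1 by (intro mult_nonneg_nonneg) auto
      then have "pi / 2 * (ln r + 4 * ln (T r)) \<le> 2 * pi * (ln r + ln (T r))" unfolding distrib_left by linarith
      moreover have "C0 \<le> \<bar>C0\<bar> * (ln r + ln (T r))"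
      proof -
        have "\<bar>C0\<bar> * 1 \<le> \<bar>C0\<bar> * (ln r + ln (T r))" using l1 l2 by (intro mult_left_mono) auto
        then show ?thesis by simp
      qed
      ultimately show ?thesis unfolding C_def distrib_right[of "2 * pi"] by (rule add_mono)
    qed
    finally show "characteristic a r + characteristic q r \<le> C * (ln r + ln (characteristic a r))"
      unfolding sum_eq unfolding characteristic_eq_log_area[OF lba] T_def .
  qed
qed

section \<open>The metric and its Chern connection\<close>

lemma scaleR_eq_vector_scalar: "a *\<^sub>R (x :: complex^'n) = of_real a *s x"
  unfolding vec_eq_iff vector_scaleR_component vector_smult_component by (simp add: scaleR_conv_of_real)

lemma dird_eqI: "((\<lambda>t::real. F (x + t *\<^sub>R v)) has_vector_derivative d) (at 0) \<Longrightarrow> dird F x v = d"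
  unfolding dird_def by (rule vector_derivative_at)

lemma has_vector_derivative_line:
  assumes "(F has_derivative D) (at x)"
  shows "((\<lambda>t::real. F (x + t *\<^sub>R v)) has_vector_derivative D v) (at 0)"
proof -
  have "((\<lambda>t::real. x + t *\<^sub>R v) has_derivative (\<lambda>t. t *\<^sub>R v)) (at 0)"
    by (auto intro!: derivative_eq_intros)
  from has_derivative_compose[OF this, of F D] assms
  have "((\<lambda>t::real. F (x + t *\<^sub>R v)) has_derivative (\<lambda>t. D (t *\<^sub>R v))) (at 0)" by simp
  then show ?thesis
    using linear_scale[OF has_derivative_linear[OF assms]] by (simp add: has_vector_derivative_def)
qed

lemma dird_has_derivative:
  assumes "(F has_derivative D) (at x)"
  shows "dird F x v = D v"
  by (rule dird_eqI[OF has_vector_derivative_line[OF assms]])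

locale hermitian =
  fixes h :: "complex^'n \<Rightarrow> complex^'n \<Rightarrow> complex"
  assumes herm: "hermitian_form h"
begin

lemma h_add_left: "h (x + y) z = h x z + h y z"
  and h_scale_left: "h (c *s x) y = c * h x y"
  and h_cnj: "cnj (h x y) = h y x"
  using herm unfolding hermitian_form_def by (blast, blast, metis)

lemma h_add_right: "h x (y + z) = h x y + h x z"
  and h_scale_right: "h x (c *s y) = cnj c * h x y"
  using h_add_left[of y z x] h_scale_left[of c y x] by (metis h_cnj complex_cnj_add, metis h_cnj complex_cnj_mult)

lemma h_zero: "h 0 y = 0" "h y 0 = 0"
  using h_scale_left[of 0 0 y] h_scale_right[of y 0 0] by simp_all

lemma h_minus: "h (- x) y = - h x y" "h y (- x) = - h y x"
  using h_scale_left[of "-1" x y] h_scale_right[of y "-1" x] by simp_all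

lemma h_diff: "h (x - z) y = h x y - h z y" "h y (x - z) = h y x - h y z"
  using h_add_left[of x "- z" y] h_add_right[of y x "- z"] by (simp_all add: h_minus)

lemmas h_simps = h_add_left h_scale_left h_cnj h_add_right h_scale_right h_zero h_minus h_diff

lemma h_self: "h x x = of_real (Re (h x x))"
  using h_cnj[of x x] by (metis Reals_cnj_iff complex_is_Real_iff of_real_Re)

sublocale bb: bounded_bilinear h
  unfolding bilinear_conv_bounded_bilinear[symmetric] bilinear_def
  by (auto intro!: linearI simp: h_simps scaleR_eq_vector_scalar scaleR_conv_of_real)

text \<open>The explicit form of \<open>\<omega>\<close> and of its Chern connection: a vector of the fibre represents a
  homomorphism of the line \<open>x\<close> into the quotient of the ambient space by it, with its quotient
  metric.\<close>

definition qmetric :: "complex^'n \<Rightarrow> complex^'n \<Rightarrow> complex^'n \<Rightarrow> complex" where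
  "qmetric x u v = - 2 * (h u v / h x x - h u x * h x v / (h x x)\<^sup>2)"

definition qconn :: "complex^'n \<Rightarrow> complex^'n \<Rightarrow> complex^'n \<Rightarrow> complex^'n" where
  "qconn x v w = (- 1 / h x x) *s (h w x *s v + h v x *s w)"

lemma qmetric_simps:
  "qmetric x (u + u') v = qmetric x u v + qmetric x u' v" "qmetric x u (v + v') = qmetric x u v + qmetric x u v'"
  "qmetric x (u - u') v = qmetric x u v - qmetric x u' v" "qmetric x u (v - v') = qmetric x u v - qmetric x u v'"
  "qmetric x (c *s u) v = c * qmetric x u v" "qmetric x u (c *s v) = cnj c * qmetric x u v"
  "qmetric x 0 v = 0" "qmetric x u 0 = 0"
  by (simp_all add: qmetric_def h_simps add_divide_distrib diff_divide_distrib algebra_simps)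

lemma qmetric_cnj: "cnj (qmetric x u v) = qmetric x v u"
  by (simp add: qmetric_def h_cnj mult.commute)

lemma qmetric_self: "qmetric x u u = of_real (Re (qmetric x u u))"
  using qmetric_cnj[of x u u] by (metis Reals_cnj_iff complex_is_Real_iff of_real_Re)

lemma qconn_simps:
  "qconn x (v + v') w = qconn x v w + qconn x v' w" "qconn x v (w + w') = qconn x v w + qconn x v w'"
  "qconn x (c *s v) w = c *s qconn x v w" "qconn x v (c *s w) = c *s qconn x v w"
  "qconn x 0 w = 0" "qconn x v 0 = 0"
  by (simp_all add: qconn_def vec_eq_iff h_simps algebra_simps)

lemma qconn_fibre: "v \<in> chart_fibre i \<Longrightarrow> w \<in> chart_fibre i \<Longrightarrow> qconn x v w \<in> chart_fibre i"
  by (simp add: qconn_def chart_fibre_def)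

text \<open>Metric compatibility of \<open>qconn\<close> along arbitrary differentiable families of
  base points and vectors. It serves twice: to recognise the Chern connection, and to differentiate
  \<open>a\<close> and \<open>a_z\<close> along a lift of the curve.\<close>

lemma has_derivative_qmetric:
  assumes X: "(X has_derivative X') (at t within S)" and Y: "(Y has_derivative Y') (at t within S)"
    and V: "(V has_derivative V') (at t within S)" and nz: "h (X t) (X t) \<noteq> 0"
  shows "((\<lambda>s. qmetric (X s) (Y s) (V s)) has_derivative
    (\<lambda>k. qmetric (X t) (Y' k + qconn (X t) (X' k) (Y t)) (V t) + qmetric (X t) (Y t) (V' k + qconn (X t) (X' k) (V t)))) (at t within S)"
proof -
  note D = bb.FDERIV[OF Y V] bb.FDERIV[OF X X] bb.FDERIV[OF Y X] bb.FDERIV[OF X V]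
  have n2: "(h (X t) (X t))\<^sup>2 \<noteq> 0" using nz by simp
  show ?thesis
    unfolding qmetric_def
    apply (rule has_derivative_eq_rhs)
     apply (rule has_derivative_mult_right has_derivative_diff has_derivative_divide[OF D(1) D(2) nz]
        has_derivative_divide[OF has_derivative_mult[OF D(3) D(4)] has_derivative_power[OF D(2)] n2])+
    apply (simp add: fun_eq_iff qconn_def h_simps h_cnj)
    apply (use nz in \<open>simp add: field_simps power2_eq_square\<close>)
    done
qed

lemma open_pos: "open {x. Re (h x x) > 0}"
proof -
  have "continuous_on UNIV (\<lambda>x. Re (h x x))" by (intro continuous_intros bb.continuous_on)
  then show ?thesis by (rule open_Collect_less[OF continuous_on_const])
qed

text \<open>The (0,1)-derivative of log h(y,y) sees only the conjugate-linear slot and equals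
  \<open>h y v / h y y\<close>. This holds on an open set, so the (1,0)-derivative can be taken of
  that quotient.\<close>

lemma omega_metric_eq:
  assumes "Re (h x x) > 0"
  shows "omega_metric h x u v = qmetric x u v"
proof -
  have db: "delbar (\<lambda>w. complex_of_real (ln (Re (h w w)))) y v = h y v / h y y" if y: "Re (h y y) > 0" for y
  proof -
    have "((\<lambda>w. complex_of_real (ln (Re (h w w)))) has_derivative
      (\<lambda>k. of_real (2 * Re (h k y) / Re (h y y)))) (at y)"
    proof -
      have "((\<lambda>w. Re (h w w)) has_derivative (\<lambda>k. Re (h y k + h k y))) (at y)"
        by (intro has_derivative_Re bb.FDERIV has_derivative_ident)
      moreover have "Re (h y k + h k y) = 2 * Re (h k y)" for k
        using arg_cong[OF h_cnj[of k y], of Re] by simp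
      ultimately have "((\<lambda>w. Re (h w w)) has_derivative (\<lambda>k. 2 * Re (h k y))) (at y)" by simp
      then have "((\<lambda>w. ln (Re (h w w))) has_derivative (\<lambda>k. 2 * Re (h k y) * inverse (Re (h y y)))) (at y)"
        by (rule DERIV_compose_FDERIV[where f=ln and g="\<lambda>w. Re (h w w)" and x=y, OF DERIV_ln[OF y]])
      then show ?thesis by (intro has_derivative_of_real) (simp add: divide_inverse)
    qed
    note d = dird_has_derivative[OF this]
    obtain r where r: "h y y = of_real r" "r > 0" using h_self[of y] y by blast
    show ?thesis
      using r(2) unfolding delbar_def d h_scale_left h_cnj[of v y, symmetric] r(1)
      by (simp add: complex_eq_iff Re_divide_of_real Im_divide_of_real field_simps)
  qed
  have nz: "h x x \<noteq> 0" using assms by auto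
  define D where "D k = (h k v * h x x - h x v * (h x k + h k x)) / (h x x)\<^sup>2" for k
  have "((\<lambda>y. h y v / h y y) has_derivative D) (at x)"
    by (rule has_derivative_eq_rhs[OF has_derivative_divide[OF bb.FDERIV[OF has_derivative_ident has_derivative_const] bb.FDERIV[OF has_derivative_ident has_derivative_ident] nz]])
       (use nz in \<open>simp add: fun_eq_iff h_simps D_def field_simps power2_eq_square\<close>)
  then have "((\<lambda>y. delbar (\<lambda>w. complex_of_real (ln (Re (h w w)))) y v) has_derivative D) (at x)"
    by (rule has_derivative_transform_within_open[OF _ open_pos]) (use assms db in auto)
  note d = dird_has_derivative[OF this]
  show ?thesis
    unfolding omega_metric_def del_def d qmetric_def
    using nz by (simp add: D_def h_simps field_simps power2_eq_square)
qed

section \<open>Existence and uniqueness of the Chern connection\<close>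

lemma eventually_line_open:
  assumes "\<forall>\<^sub>F t in nhds (0::real). x + t *\<^sub>R v \<in> M"
  obtains S where "open S" "0 \<in> S" "\<And>t. t \<in> S \<Longrightarrow> x + t *\<^sub>R v \<in> M"
  using assms unfolding eventually_nhds by blast

text \<open>\<open>pos_region h i\<close> lies in a hyperplane and is not open in the ambient space,
  so a section is differentiable only within it. Along a direction that stays in the set for small
  \<open>t\<close>, the derivative in \<open>t\<close> is nevertheless a full one.\<close>

lemma has_derivative_line_within:
  assumes s: "(s has_derivative s') (at x within M)" and ev: "\<forall>\<^sub>F t in nhds (0::real). x + t *\<^sub>R v \<in> M"
  shows "((\<lambda>t. s (x + t *\<^sub>R v)) has_derivative (\<lambda>t. t *\<^sub>R s' v)) (at 0)"
proof -
  obtain S where S: "open S" "0 \<in> S" "\<And>t. t \<in> S \<Longrightarrow> x + t *\<^sub>R v \<in> M"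
    using eventually_line_open[OF ev] by blast
  have "((\<lambda>t::real. x + t *\<^sub>R v) has_derivative (\<lambda>t. t *\<^sub>R v)) (at 0 within S)"
    by (auto intro!: derivative_eq_intros)
  moreover have "(s has_derivative s') (at (x + 0 *\<^sub>R v) within (\<lambda>t. x + t *\<^sub>R v) ` S)"
  proof (rule has_derivative_subset)
    show "(s has_derivative s') (at (x + 0 *\<^sub>R v) within M)" using s by simp
  qed (use S(3) in auto)
  ultimately have "((\<lambda>t. s (x + t *\<^sub>R v)) has_derivative (\<lambda>t. s' (t *\<^sub>R v))) (at 0 within S)"
    by (rule diff_chain_within[of "\<lambda>t. x + t *\<^sub>R v" "\<lambda>t. t *\<^sub>R v" 0 S s s', unfolded o_def])
  then show ?thesis
    unfolding at_within_open[OF S(2,1)] linear_scale[OF has_derivative_linear[OF s]] .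
qed

lemma dird_within:
  assumes s: "(s has_derivative s') (at x within M)" and ev: "\<forall>\<^sub>F t in nhds (0::real). x + t *\<^sub>R v \<in> M"
  shows "dird s x v = s' v"
  using has_derivative_line_within[OF assms] by (intro dird_eqI) (simp add: has_vector_derivative_def)

text \<open>Covers both bundles at once: with the identity for \<open>\<Phi>\<close> it gives the
  connection of \<omega> in a chart, with a holomorphic lift of the curve the connection of the
  pulled-back metric. \<open>d x v\<close> is the derivative of \<open>\<Phi>\<close> in the
  direction \<open>v\<close>.\<close>

lemma chern_connection_pullback:
  assumes pos: "\<And>x. x \<in> M \<Longrightarrow> Re (h (\<Phi> x) (\<Phi> x)) > 0"
    and d\<Phi>: "\<And>x v. x \<in> M \<Longrightarrow> v \<in> D \<Longrightarrow> ((\<lambda>t::real. \<Phi> (x + t *\<^sub>R v)) has_derivative (\<lambda>t. t *\<^sub>R d x v)) (at 0)"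
    and ev: "\<And>x v. x \<in> M \<Longrightarrow> v \<in> D \<Longrightarrow> \<forall>\<^sub>F t in nhds (0::real). x + t *\<^sub>R v \<in> M"
    and J: "\<And>v. v \<in> D \<Longrightarrow> J v \<in> D" "\<And>x v. x \<in> M \<Longrightarrow> v \<in> D \<Longrightarrow> d x (J v) = \<i> *s d x v"
    and lin: "\<And>x v v'. x \<in> M \<Longrightarrow> v \<in> D \<Longrightarrow> v' \<in> D \<Longrightarrow> d x (v + v') = d x v + d x v'"
      "\<And>x v a. x \<in> M \<Longrightarrow> v \<in> D \<Longrightarrow> d x (a *\<^sub>R v) = a *\<^sub>R d x v"
    and fib: "\<And>x v. x \<in> M \<Longrightarrow> v \<in> D \<Longrightarrow> d x v \<in> chart_fibre i"
  shows "chern_connection J M D (chart_fibre i) (\<lambda>x. omega_metric h (\<Phi> x)) (\<lambda>x v w. qconn (\<Phi> x) (d x v) w)"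
  unfolding chern_connection_def
proof (intro conjI ballI allI impI)
  fix x v w
  assume x: "x \<in> M" and v: "v \<in> D" and w: "w \<in> chart_fibre i"
  show "qconn (\<Phi> x) (d x v) w \<in> chart_fibre i" using fib[OF x v] w by (rule qconn_fibre)
  show "qconn (\<Phi> x) (d x v) (c *s w) = c *s qconn (\<Phi> x) (d x v) w" for c by (simp add: qconn_simps)
  show "qconn (\<Phi> x) (d x v) (w + w') = qconn (\<Phi> x) (d x v) w + qconn (\<Phi> x) (d x v) w'" for w' by (simp add: qconn_simps)
  show "qconn (\<Phi> x) (d x (a *\<^sub>R v)) w = a *\<^sub>R qconn (\<Phi> x) (d x v) w" for a
    using lin(2)[OF x v] by (simp add: qconn_simps scaleR_eq_vector_scalar)
  show "qconn (\<Phi> x) (d x (v + v')) w = qconn (\<Phi> x) (d x v) w + qconn (\<Phi> x) (d x v') w" if "v' \<in> D" for v'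
    using lin(1)[OF x v that] by (simp add: qconn_simps)
next
  fix s :: "'a \<Rightarrow> complex^'n" and x v
  assume x: "x \<in> M" and v: "v \<in> D"
  \<comment> \<open>\<open>qconn\<close> is complex linear in the direction, so its contributions
    from \<open>v\<close> and \<open>J v\<close> cancel in the (0,1)-part.\<close>
  show "(1 / 2) *s (nabla (\<lambda>x v w. qconn (\<Phi> x) (d x v) w) s x v + \<i> *s nabla (\<lambda>x v w. qconn (\<Phi> x) (d x v) w) s x (J v)) =
        (1 / 2) *s (dird s x v + \<i> *s dird s x (J v))"
    unfolding nabla_def J(2)[OF x v] qconn_simps by (simp add: vec_eq_iff algebra_simps)
next
  fix s t :: "'a \<Rightarrow> complex^'n" and x v
  assume x: "x \<in> M" and v: "v \<in> D"
    and st: "(\<forall>y\<in>M. s y \<in> chart_fibre i \<and> t y \<in> chart_fibre i) \<and> s differentiable at x within M \<and> t differentiable at x within M"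
  obtain s' t' where s': "(s has_derivative s') (at x within M)" and t': "(t has_derivative t') (at x within M)"
    using st unfolding differentiable_def by blast
  note e = ev[OF x v]
  obtain S where S: "open S" "0 \<in> S" "\<And>t. t \<in> S \<Longrightarrow> x + t *\<^sub>R v \<in> M"
    using eventually_line_open[OF e] by blast
  have nz: "h (\<Phi> x) (\<Phi> x) \<noteq> 0" using pos[OF x] by auto
  have "((\<lambda>r. qmetric (\<Phi> (x + r *\<^sub>R v)) (s (x + r *\<^sub>R v)) (t (x + r *\<^sub>R v))) has_derivative
    (\<lambda>k. qmetric (\<Phi> (x + 0 *\<^sub>R v)) (k *\<^sub>R s' v + qconn (\<Phi> (x + 0 *\<^sub>R v)) (k *\<^sub>R d x v) (s (x + 0 *\<^sub>R v))) (t (x + 0 *\<^sub>R v)) + qmetric (\<Phi> (x + 0 *\<^sub>R v)) (s (x + 0 *\<^sub>R v)) (k *\<^sub>R t' v + qconn (\<Phi> (x + 0 *\<^sub>R v)) (k *\<^sub>R d x v) (t (x + 0 *\<^sub>R v))))) (at 0)"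
    by (rule has_derivative_qmetric[OF d\<Phi>[OF x v] has_derivative_line_within[OF s' e] has_derivative_line_within[OF t' e]])
      (use nz in simp)
  then have "((\<lambda>r. qmetric (\<Phi> (x + r *\<^sub>R v)) (s (x + r *\<^sub>R v)) (t (x + r *\<^sub>R v))) has_vector_derivative
     qmetric (\<Phi> x) (s' v + qconn (\<Phi> x) (d x v) (s x)) (t x) + qmetric (\<Phi> x) (s x) (t' v + qconn (\<Phi> x) (d x v) (t x))) (at 0)"
    unfolding has_vector_derivative_def
    by (rule has_derivative_eq_rhs)
      (simp add: fun_eq_iff scaleR_eq_vector_scalar qconn_simps qmetric_simps scaleR_conv_of_real algebra_simps)
  then have "((\<lambda>r. omega_metric h (\<Phi> (x + r *\<^sub>R v)) (s (x + r *\<^sub>R v)) (t (x + r *\<^sub>R v))) has_vector_derivative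
     qmetric (\<Phi> x) (s' v + qconn (\<Phi> x) (d x v) (s x)) (t x) + qmetric (\<Phi> x) (s x) (t' v + qconn (\<Phi> x) (d x v) (t x))) (at 0)"
    by (rule has_vector_derivative_transform_within_open[OF _ S(1,2)]) (use S(3) pos omega_metric_eq in auto)
  then have "dird (\<lambda>y. omega_metric h (\<Phi> y) (s y) (t y)) x v =
     qmetric (\<Phi> x) (s' v + qconn (\<Phi> x) (d x v) (s x)) (t x) + qmetric (\<Phi> x) (s x) (t' v + qconn (\<Phi> x) (d x v) (t x))"
    by (rule dird_eqI)
  then show "dird (\<lambda>y. omega_metric h (\<Phi> y) (s y) (t y)) x v =
     omega_metric h (\<Phi> x) (nabla (\<lambda>x v w. qconn (\<Phi> x) (d x v) w) s x v) (t x) +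
     omega_metric h (\<Phi> x) (s x) (nabla (\<lambda>x v w. qconn (\<Phi> x) (d x v) w) t x v)"
    by (simp add: nabla_def omega_metric_eq[OF pos[OF x]] dird_within[OF s' e] dird_within[OF t' e])
qed

lemma chern_connection_compatible:
  assumes "chern_connection J M D F g A" "x \<in> M" "v \<in> D"
    and "\<forall>y\<in>M. s y \<in> F \<and> t y \<in> F" "s differentiable (at x within M)" "t differentiable (at x within M)"
  shows "dird (\<lambda>y. g y (s y) (t y)) x v = g x (nabla A s x v) (t x) + g x (s x) (nabla A t x v)"
  using assms unfolding chern_connection_def by (elim conjE) blast

lemma dird_const: "dird (\<lambda>_. c) x v = 0"
  by (rule dird_eqI) simp

text \<open>For the difference D of two Chern connections, compatibility on constant sections gives
  g(D_v w, w') + g(w, D_v w') = 0. For J v in place of v, where D is multiplied by i, it gives the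
  same relation with a minus sign. Hence g(D_v w, w') = 0. This is what identifies the arbitrary
  choice in \<open>chern_form\<close>.\<close>

lemma chern_connection_unique:
  assumes A: "chern_connection J M D F g A" and B: "chern_connection J M D F g B"
    and x: "x \<in> M" and v: "v \<in> D" "J v \<in> D" and w: "w \<in> F"
    and g: "g x = qmetric X" and F: "F = chart_fibre i"
    and nondeg: "\<And>y. y \<in> F \<Longrightarrow> (\<And>w'. w' \<in> F \<Longrightarrow> qmetric X y w' = 0) \<Longrightarrow> y = 0"
  shows "A x v w = B x v w"
proof -
  have JA: "C x (J v) u = \<i> *s C x v u" if C: "chern_connection J M D F g C" and u: "u \<in> F" for C u
  proof -
    have "(1 / 2) *s (nabla C (\<lambda>_. u) x v + \<i> *s nabla C (\<lambda>_. u) x (J v)) = (1 / 2) *s (dird (\<lambda>_. u) x v + \<i> *s dird (\<lambda>_. u) x (J v))"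
      using C x v u unfolding chern_connection_def by auto
    then show ?thesis
      unfolding nabla_def dird_const by (simp add: vec_eq_iff complex_eq_iff add_eq_0_iff field_simps)
  qed
  have comp: "dird (\<lambda>y. g y w w') x k = qmetric X (C x k w) w' + qmetric X w (C x k w')"
    if C: "chern_connection J M D F g C" and u: "w' \<in> F" and k: "k \<in> D" for C w' k
  proof -
    have "dird (\<lambda>y. g y ((\<lambda>_. w) y) ((\<lambda>_. w') y)) x k = g x (nabla C (\<lambda>_. w) x k) w' + g x w (nabla C (\<lambda>_. w') x k)"
      by (rule chern_connection_compatible[OF C x k]) (use u w in simp_all)
    then show ?thesis unfolding nabla_def dird_const g by simp
  qed
  have "A x v w - B x v w = 0"
  proof (rule nondeg)
    show "A x v w - B x v w \<in> F"
    proof -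
      have "A x v w \<in> F" "B x v w \<in> F" using A B x v w unfolding chern_connection_def by auto
      then show ?thesis unfolding F chart_fibre_def by simp
    qed
    fix w' assume w': "w' \<in> F"
    have 1: "qmetric X (A x v w - B x v w) w' + qmetric X w (A x v w' - B x v w') = 0"
      using comp[OF A w' v(1)] comp[OF B w' v(1)] by (simp add: qmetric_simps algebra_simps)
    have "qmetric X (A x (J v) w - B x (J v) w) w' + qmetric X w (A x (J v) w' - B x (J v) w') = 0"
      using comp[OF A w' v(2)] comp[OF B w' v(2)] by (simp add: qmetric_simps algebra_simps)
    then have "\<i> * qmetric X (A x v w - B x v w) w' - \<i> * qmetric X w (A x v w' - B x v w') = 0"
      unfolding JA[OF A w] JA[OF B w] JA[OF A w'] JA[OF B w'] by (simp add: qmetric_simps algebra_simps)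
    then have "qmetric X (A x v w - B x v w) w' - qmetric X w (A x v w' - B x v w') = 0"
      by (simp flip: right_diff_distrib)
    with 1 show "qmetric X (A x v w - B x v w) w' = 0" by (simp add: add_eq_0_iff)
  qed
  then show ?thesis by simp
qed

end

lemma has_signature_nondegenerate:
  assumes "hermitian_form h" and sig: "has_signature h a b" and y: "\<And>w. h y w = 0"
  shows "y = 0"
proof -
  interpret hermitian h by unfold_locales fact
  obtain P N where fin: "finite P" "finite N" and sp: "vec.span (P \<union> N) = UNIV"
    and orth: "\<And>x y. x\<in>P \<union> N \<Longrightarrow> y\<in>P \<union> N \<Longrightarrow> x \<noteq> y \<Longrightarrow> h x y = 0"
    and pn: "\<And>x. x\<in>P \<Longrightarrow> Re (h x x) > 0" "\<And>x. x\<in>N \<Longrightarrow> Re (h x x) < 0"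
    using sig unfolding has_signature_def by metis
  have "y \<in> vec.span (P \<union> N)" using sp by simp
  then obtain u where u: "y = (\<Sum>v\<in>P \<union> N. u v *s v)"
    using fin by (auto simp: vec.span_finite)
  have hs: "h (\<Sum>v\<in>S. u v *s v) w = (\<Sum>v\<in>S. u v * h v w)" if "finite S" for S w
    using that by (induction S) (simp_all add: h_simps)
  have "u w = 0" if w: "w \<in> P \<union> N" for w
  proof -
    have "h y w = (\<Sum>v\<in>P \<union> N. u v * h v w)" unfolding u using fin by (intro hs) simp
    also have "\<dots> = (\<Sum>v\<in>P \<union> N. if v = w then u w * h w w else 0)"
      using orth w by (intro sum.cong) auto
    also have "\<dots> = u w * h w w" using w fin by simp
    finally show ?thesis using y pn w by force
  qed
  then show ?thesis unfolding u by (intro sum.neutral) auto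
qed

locale nondegenerate_hermitian = hermitian h for h :: "complex^'n \<Rightarrow> complex^'n \<Rightarrow> complex" +
  assumes nondeg: "(\<And>w. h y w = 0) \<Longrightarrow> y = 0"
begin

text \<open>\<open>y'\<close> is the part of \<open>y\<close> that is \<open>h\<close>-orthogonal to
  \<open>X\<close>. The fibre together with \<open>X\<close> spans the whole space, so
  \<open>y'\<close> is orthogonal to everything and vanishes. Then \<open>y\<close> is a multiple of
  \<open>X\<close>, and the \<open>i\<close>-th coordinates, 0 and 1, make the multiple 0.\<close>

lemma qmetric_nondegenerate:
  assumes X: "(X :: complex^'n) $ i = 1" "h X X \<noteq> 0" and y: "y \<in> chart_fibre i" and z: "\<And>w. w \<in> chart_fibre i \<Longrightarrow> qmetric X y w = 0"
  shows "y = 0"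
proof -
  define y' where "y' = y - (h y X / h X X) *s X"
  have "h y' w = 0" for w
  proof -
    have "h y' X = 0" using X by (simp add: y'_def h_simps)
    moreover have "h y' (w - w $ i *s X) = 0"
    proof -
      have "w - w $ i *s X \<in> chart_fibre i" using X by (simp add: chart_fibre_def)
      from z[OF this] have "h y (w - w $ i *s X) * h X X = h y X * h X (w - w $ i *s X)"
        using X by (simp add: qmetric_def field_simps power2_eq_square)
      then show ?thesis using X(2) unfolding y'_def h_diff(1) h_scale_left by (simp add: field_simps)
    qed
    ultimately show ?thesis by (simp add: h_simps)
  qed
  then have "y' = 0" by (rule nondeg)
  then have e: "y = (h y X / h X X) *s X" by (simp add: y'_def)
  then have "y $ i = h y X / h X X" using X by (metis mult.right_neutral vector_smult_component)
  then have "h y X / h X X = 0" using y by (simp add: chart_fibre_def)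
  then show ?thesis by (subst e) simp
qed

end

interpretation vsm: bounded_bilinear "\<lambda>(c::complex) (x :: complex^'n). c *s x"
  unfolding bilinear_conv_bounded_bilinear[symmetric] bilinear_def
  by (auto intro!: linearI simp: vec_eq_iff complex_eq_iff algebra_simps)

lemma chern_connection_chern_form:
  "chern_connection J M D F g A \<Longrightarrow> chern_connection J M D F g (chern_form J M D F g)"
  unfolding chern_form_def by (rule someI[where P="chern_connection J M D F g"])

lemma eventually_line_in_open:
  fixes x v :: "'a::real_normed_vector"
  assumes "open S" "x \<in> S"
  shows "\<forall>\<^sub>F t in nhds (0::real). x + t *\<^sub>R v \<in> S"
proof -
  have "open ((\<lambda>t::real. x + t *\<^sub>R v) -` S)"
    by (intro open_vimage assms) (auto intro!: continuous_intros)
  then show ?thesis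
    unfolding eventually_nhds using assms(2) by (intro exI[of _ "(\<lambda>t::real. x + t *\<^sub>R v) -` S"]) auto
qed

section \<open>Lines and affine charts\<close>

lemma proj_space_eq_span:
  assumes l: "l \<in> proj_space" and x: "x \<in> l" "x \<noteq> 0"
  shows "l = vec.span {x :: complex^'n}"
proof (rule vec.subspace_dim_equal[symmetric])
  show "vec.span {x} \<subseteq> l" using l x by (intro vec.span_minimal) (auto simp: proj_space_def)
  show "vec.dim l \<le> vec.dim (vec.span {x})" using l x by (simp add: proj_space_def vec.dim_singleton)
qed (use l in \<open>auto simp: proj_space_def\<close>)

lemma span_proj_space: "x \<noteq> 0 \<Longrightarrow> vec.span {x :: complex^'n} \<in> proj_space"
  by (simp add: proj_space_def vec.dim_singleton)

lemma chart_eqI: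
  assumes l: "l \<in> proj_space" and x: "x \<in> l" "(x :: complex^'n) $ i = 1"
  shows "chart i l = x"
  unfolding chart_def
proof (rule the_equality)
  have nz: "x \<noteq> 0" using x by auto
  fix y assume y: "y \<in> l \<and> y $ i = 1"
  then obtain c where "y = c *s x"
    using proj_space_eq_span[OF l x(1) nz] by (auto simp: vec.span_singleton)
  with x y show "y = x" by simp
qed (use x in simp)

lemma chart_props:
  assumes "l \<in> chart_dom i"
  shows "chart i l \<in> l" "(chart i l :: complex^'n) $ i = 1" "chart i l \<noteq> 0" "l = vec.span {chart i l}"
proof -
  obtain x where l: "l \<in> proj_space" and x: "x \<in> l" "x $ i \<noteq> 0" using assms by (auto simp: chart_dom_def)
  let ?y = "(1 / x $ i) *s x"
  have y: "?y \<in> l" "?y $ i = 1"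
    using l x by (auto simp: proj_space_def vec.subspace_scale)
  then show 1: "chart i l \<in> l" and 2: "chart i l $ i = 1" using chart_eqI[OF l y] by simp_all
  then show 3: "chart i l \<noteq> 0" by auto
  show "l = vec.span {chart i l}" by (rule proj_space_eq_span[OF l 1 3])
qed

context hermitian begin

lemma pos_domain_span:
  assumes "Re (h x x) > 0"
  shows "vec.span {x} \<in> pos_domain h"
proof -
  have "x \<noteq> 0" using assms by (auto simp: h_simps)
  moreover have "Re (h (c *s x) (c *s x)) > 0" if "c *s x \<noteq> 0" for c
  proof -
    have "h (c *s x) (c *s x) = of_real ((norm c)\<^sup>2) * h x x"
      unfolding complex_norm_square by (simp add: h_simps)
    then have "Re (h (c *s x) (c *s x)) = (norm c)\<^sup>2 * Re (h x x)" by simp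
    then show ?thesis using assms that by auto
  qed
  ultimately show ?thesis
    using span_proj_space[of x] by (auto simp: pos_domain_def vec.span_singleton)
qed

lemma pos_region_eq: "pos_region h i = {x. x $ i = 1 \<and> Re (h x x) > 0}"
proof (intro set_eqI iffI)
  fix x assume "x \<in> pos_region h i"
  then obtain l where l: "l \<in> pos_domain h" "l \<in> chart_dom i" "x = chart i l" by (auto simp: pos_region_def)
  then show "x \<in> {x. x $ i = 1 \<and> Re (h x x) > 0}"
    using chart_props[of l i] by (auto simp: pos_domain_def)
next
  fix x assume "x \<in> {x. x $ i = 1 \<and> Re (h x x) > 0}"
  then have x: "(x :: complex^'n) $ i = 1" "Re (h x x) > 0" by auto
  then have nz: "x \<noteq> 0" by auto
  have xs: "x \<in> vec.span {x}" by (simp add: vec.span_base)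
  have "vec.span {x} \<in> chart_dom i"
    using span_proj_space[OF nz] x xs by (auto simp: chart_dom_def intro!: bexI[of _ x])
  moreover have "chart i (vec.span {x}) = x"
    by (rule chart_eqI[OF span_proj_space[OF nz] xs x(1)])
  ultimately show "x \<in> pos_region h i"
    unfolding pos_region_def using pos_domain_span[OF x(2)] by (metis IntI imageI)
qed

end

section \<open>Holomorphic sectional curvature\<close>

context nondegenerate_hermitian begin

lemma omega_chern_form_eq:
  assumes x: "x \<in> pos_region h i" and v: "v \<in> chart_fibre i" and w: "w \<in> chart_fibre i"
  shows "omega_chern_form h i x v w = qconn x v w"
proof -
  have "chern_connection (\<lambda>v. \<i> *s v) (pos_region h i) (chart_fibre i) (chart_fibre i) (\<lambda>x. omega_metric h x) (\<lambda>x v w. qconn x v w)"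
  proof (rule chern_connection_pullback)
    fix x v assume x: "x \<in> pos_region h i" and v: "v \<in> chart_fibre i"
    have "\<forall>\<^sub>F t in nhds (0::real). x + t *\<^sub>R v \<in> {x. Re (h x x) > 0}"
      by (rule eventually_line_in_open[OF open_pos]) (use x in \<open>simp add: pos_region_eq\<close>)
    then show "\<forall>\<^sub>F t in nhds (0::real). x + t *\<^sub>R v \<in> pos_region h i"
      by eventually_elim (use x v in \<open>simp add: pos_region_eq chart_fibre_def\<close>)
    show "((\<lambda>t. x + t *\<^sub>R v) has_derivative (\<lambda>t. t *\<^sub>R v)) (at 0)"
      by (auto intro!: derivative_eq_intros)
  qed (auto simp: pos_region_eq chart_fibre_def)
  then have A: "chern_connection (\<lambda>v. \<i> *s v) (pos_region h i) (chart_fibre i) (chart_fibre i) (omega_metric h) qconn"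
    by simp
  then have B: "chern_connection (\<lambda>v. \<i> *s v) (pos_region h i) (chart_fibre i) (chart_fibre i) (omega_metric h) (omega_chern_form h i)"
    unfolding omega_chern_form_def by (rule chern_connection_chern_form)
  have px: "x $ i = 1" "Re (h x x) > 0" using x by (auto simp: pos_region_eq)
  show ?thesis
  proof (rule chern_connection_unique[OF B A x v _ w])
    show "omega_metric h x = qmetric x" using omega_metric_eq[OF px(2)] by (intro ext)
    show "y = 0" if "y \<in> chart_fibre i" "\<And>w'. w' \<in> chart_fibre i \<Longrightarrow> qmetric x y w' = 0" for y
      using qmetric_nondegenerate[OF px(1) _ that] px(2) by force
  qed (use v in \<open>auto simp: chart_fibre_def\<close>)
qed

text \<open>In the directions \<open>u\<close> and \<open>\<i> *s u\<close> the connection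
  multiplies \<open>u\<close> by a scalar, so the commutator vanishes and only the derivative of the
  coefficient \<open>- 2 * h u x / h x x\<close> counts. Its (0,1)-part is the metric itself, whence
  the curvature sends \<open>u\<close> to \<open>- qmetric x u u\<close> times \<open>u\<close>. The
  value -1 depends on the factor 2 in \<open>omega_metric\<close>.\<close>

lemma hol_sect_curv_eq:
  assumes x: "x \<in> pos_region h i" and u: "u \<in> chart_fibre i" and p: "Re (qmetric x u u) > 0"
  shows "hol_sect_curv h i x u = -1"
proof -
  define A where "A = omega_chern_form h i"
  have px: "x $ i = 1" "Re (h x x) > 0" using x by (auto simp: pos_region_eq)
  have nz: "h x x \<noteq> 0" using px by auto
  have iu: "\<i> *s u \<in> chart_fibre i" using u by (simp add: chart_fibre_def)
  define D where "D k = - 2 * ((h u k * h x x - h u x * (h x k + h k x)) / (h x x)\<^sup>2)" for k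
  have d: "dird (\<lambda>y. A y w u) x v = c *s (D v *s u)"
    if v: "v \<in> chart_fibre i" and w: "w = c *s u" for v w c
  proof (rule dird_eqI)
    have 1: "((\<lambda>t::real. x + t *\<^sub>R v) has_derivative (\<lambda>t. t *\<^sub>R v)) (at 0)"
      by (auto intro!: derivative_eq_intros)
    have nz0: "h (x + 0 *\<^sub>R v) (x + 0 *\<^sub>R v) \<noteq> 0" using nz by simp
    have "((\<lambda>t::real. - 2 * (h u (x + t *\<^sub>R v) / h (x + t *\<^sub>R v) (x + t *\<^sub>R v))) has_derivative (\<lambda>t. of_real t * D v)) (at 0)"
      by (rule has_derivative_eq_rhs[OF has_derivative_mult_right[OF has_derivative_divide[OF bb.FDERIV[OF has_derivative_const 1] bb.FDERIV[OF 1 1] nz0]]])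
         (use nz in \<open>simp add: fun_eq_iff h_simps D_def field_simps power2_eq_square scaleR_eq_vector_scalar\<close>)
    then have 2: "((\<lambda>t::real. (- 2 * (h u (x + t *\<^sub>R v) / h (x + t *\<^sub>R v) (x + t *\<^sub>R v))) *s (c *s u)) has_derivative (\<lambda>t. (of_real t * D v) *s (c *s u))) (at 0)"
      by (rule bounded_linear.has_derivative[OF vsm.bounded_linear_left])
    have 3: "qconn y (c *s u) u = (- 2 * (h u y / h y y)) *s (c *s u)" for y
      by (simp add: qconn_def vec_eq_iff h_simps field_simps)
    have "\<forall>\<^sub>F t in nhds (0::real). x + t *\<^sub>R v \<in> {x. Re (h x x) > 0}"
      by (rule eventually_line_in_open[OF open_pos]) (use px in simp)
    then obtain S where S: "open S" "0 \<in> S" "\<And>t. t \<in> S \<Longrightarrow> Re (h (x + t *\<^sub>R v) (x + t *\<^sub>R v)) > 0"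
      unfolding eventually_nhds by auto
    have "((\<lambda>t::real. A (x + t *\<^sub>R v) w u) has_derivative (\<lambda>t. (of_real t * D v) *s (c *s u))) (at 0)"
    proof (rule has_derivative_transform_within_open[OF 2 S(1,2)])
      fix t assume t: "t \<in> S"
      have "x + t *\<^sub>R v \<in> pos_region h i"
        using S(3)[OF t] px v by (simp add: pos_region_eq chart_fibre_def)
      then have "A (x + t *\<^sub>R v) w u = qconn (x + t *\<^sub>R v) (c *s u) u"
        unfolding A_def w by (intro omega_chern_form_eq) (use u in \<open>auto simp: chart_fibre_def\<close>)
      then show "(- 2 * (h u (x + t *\<^sub>R v) / h (x + t *\<^sub>R v) (x + t *\<^sub>R v))) *s (c *s u) = A (x + t *\<^sub>R v) w u"
        by (simp only: 3)
    qed
    then show "((\<lambda>t::real. A (x + t *\<^sub>R v) w u) has_vector_derivative c *s (D v *s u)) (at 0)"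
      unfolding has_vector_derivative_def
      by (rule has_derivative_eq_rhs) (simp add: fun_eq_iff scaleR_eq_vector_scalar vec_eq_iff)
  qed
  have A: "A x v w = qconn x v w" if "v \<in> chart_fibre i" "w \<in> chart_fibre i" for v w
    unfolding A_def using omega_chern_form_eq[OF x that] .
  have comm: "A x u (A x (\<i> *s u) u) - A x (\<i> *s u) (A x u u) = 0"
    unfolding A[OF iu u] A[OF u u] A[OF u qconn_fibre[OF iu u]] A[OF iu qconn_fibre[OF u u]]
    by (simp add: qconn_simps)
  have "curvature A x u (\<i> *s u) u = \<i> *s (D u *s u) - 1 *s (D (\<i> *s u) *s u)"
    unfolding curvature_def using comm d[OF u, of "\<i> *s u" \<i>] d[OF iu, of u 1] by simp
  then have "curvature11 (\<lambda>v. \<i> *s v) A x u u = ((\<i> / 2) * (\<i> * D u - D (\<i> *s u))) *s u"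
    unfolding curvature11_def by (simp only:) (simp add: vec_eq_iff algebra_simps)
  \<comment> \<open>The complex linear part of \<open>D\<close> cancels here; minus the
    conjugate-linear part remains.\<close>
  also have "(\<i> / 2) * (\<i> * D u - D (\<i> *s u)) = - qmetric x u u"
    using nz by (simp add: D_def qmetric_def h_simps field_simps power2_eq_square)
  finally have c: "curvature11 (\<lambda>v. \<i> *s v) A x u u = (- qmetric x u u) *s u" .
  have "qmetric x u u \<noteq> 0" using p by auto
  then show ?thesis
    unfolding hol_sect_curv_def A_def[symmetric] c omega_metric_eq[OF px(2)] qmetric_simps
    by (simp add: power2_eq_square)
qed

end

section \<open>Derivatives along a local lift\<close>

definition vec_holomorphic_on :: "(complex \<Rightarrow> complex^'n) \<Rightarrow> complex set \<Rightarrow> bool" where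
  "vec_holomorphic_on G U \<longleftrightarrow> (\<forall>j. (\<lambda>z. G z $ j) holomorphic_on U)"

definition vderiv :: "(complex \<Rightarrow> complex^'n) \<Rightarrow> complex \<Rightarrow> complex^'n" where
  "vderiv G z = (\<chi> j. deriv (\<lambda>\<zeta>. G \<zeta> $ j) z)"

lemma vec_holomorphic_on_vderiv:
  "vec_holomorphic_on G U \<Longrightarrow> open U \<Longrightarrow> vec_holomorphic_on (vderiv G) U"
  by (simp add: vec_holomorphic_on_def vderiv_def holomorphic_deriv)

lemma vec_eq_sum_axis: "(x :: complex^'n) = (\<Sum>j\<in>UNIV. x $ j *s axis j 1)"
  by (simp add: vec_eq_iff axis_def sum.delta if_distrib cong: if_cong)

lemma has_derivative_vec_holomorphic:
  assumes G: "vec_holomorphic_on G U" and U: "open U" "z \<in> U"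
  shows "(G has_derivative (\<lambda>v. v *s vderiv G z)) (at z)"
proof -
  have "((\<lambda>z. G z $ j) has_field_derivative vderiv G z $ j) (at z)" for j
    using G U by (auto simp: vec_holomorphic_on_def vderiv_def intro: holomorphic_derivI)
  then have "((\<lambda>z. \<Sum>j\<in>UNIV. G z $ j *s axis j 1) has_derivative (\<lambda>v. \<Sum>j\<in>UNIV. (vderiv G z $ j * v) *s axis j 1)) (at z)"
    unfolding has_field_derivative_def
    by (intro has_derivative_sum bounded_linear.has_derivative[OF vsm.bounded_linear_left]) auto
  moreover have "(\<Sum>j\<in>UNIV. (vderiv G z $ j * v) *s axis j 1) = v *s vderiv G z" for v
    using vec_eq_sum_axis[of "v *s vderiv G z"] by (simp add: mult.commute)
  moreover have "(\<lambda>z. \<Sum>j\<in>UNIV. G z $ j *s axis j 1) = G"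
    by (intro ext vec_eq_sum_axis[symmetric])
  ultimately show ?thesis by simp
qed

lemma continuous_on_vec_holomorphic:
  assumes "vec_holomorphic_on G U" "open U"
  shows "continuous_on U G"
  by (meson assms has_derivative_vec_holomorphic has_derivative_continuous continuous_at_imp_continuous_on)

lemma vderiv_unique:
  assumes "(G has_derivative (\<lambda>v. v *s d)) (at z)"
  shows "vderiv G z = d"
proof -
  have "((\<lambda>z. G z $ j) has_derivative (\<lambda>v. (v *s d) $ j)) (at z)" for j
    by (rule bounded_linear.has_derivative[OF bounded_linear_vec_nth assms])
  then have "((\<lambda>z. G z $ j) has_field_derivative d $ j) (at z)" for j
    unfolding has_field_derivative_def by (rule has_derivative_eq_rhs) (simp add: fun_eq_iff mult.commute)
  then show ?thesis by (simp add: vderiv_def vec_eq_iff DERIV_imp_deriv)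
qed

lemma vderiv_smult:
  assumes g: "g holomorphic_on U" and G: "vec_holomorphic_on G U" and U: "open U" "z \<in> U"
    and e: "\<And>\<zeta>. \<zeta> \<in> U \<Longrightarrow> E \<zeta> = g \<zeta> *s G \<zeta>"
  shows "vderiv E z = deriv g z *s G z + g z *s vderiv G z"
proof (rule vderiv_unique)
  have "(g has_derivative (\<lambda>v. deriv g z * v)) (at z)"
    using g U by (auto simp: has_field_derivative_def[symmetric] intro: holomorphic_derivI)
  from vsm.FDERIV[OF this has_derivative_vec_holomorphic[OF G U]]
  have "((\<lambda>z. g z *s G z) has_derivative (\<lambda>v. v *s (deriv g z *s G z + g z *s vderiv G z))) (at z)"
    by (rule has_derivative_eq_rhs) (simp add: fun_eq_iff vec_eq_iff algebra_simps)
  then show "(E has_derivative (\<lambda>v. v *s (deriv g z *s G z + g z *s vderiv G z))) (at z)"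
    by (rule has_derivative_transform_within_open[OF _ U]) (simp add: e)
qed

section \<open>Factoring out zeros of holomorphic vectors\<close>

lemma scalar_factor_zero:
  assumes f: "f holomorphic_on ball z0 r" and r: "r > 0" and nz: "\<not> (\<forall>z\<in>ball z0 r. f z = 0)"
  shows "\<exists>n g. \<exists>\<rho>>0. \<rho> \<le> r \<and> g holomorphic_on ball z0 \<rho> \<and> g z0 \<noteq> 0 \<and> (\<forall>w\<in>ball z0 \<rho>. f w = (w - z0) ^ n * g w)"
proof (cases "f z0 = 0")
  case True
  have "\<not> f constant_on ball z0 r"
  proof
    assume "f constant_on ball z0 r"
    then have "f z = f z0" if "z \<in> ball z0 r" for z
      using that r unfolding constant_on_def by (metis centre_in_ball)
    with True nz show False by simp
  qed
  then obtain g \<rho> n where g: "0 < n" "0 < \<rho>" "ball z0 \<rho> \<subseteq> ball z0 r" "g holomorphic_on ball z0 \<rho>"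
    "\<And>w. w \<in> ball z0 \<rho> \<Longrightarrow> f w = (w - z0) ^ n * g w" "\<And>w. w \<in> ball z0 \<rho> \<Longrightarrow> g w \<noteq> 0"
    using holomorphic_factor_zero_nonconstant[OF f open_ball connected_ball, of z0] r True by (metis centre_in_ball)
  then show ?thesis
    using r by (intro exI[of _ n] exI[of _ g] exI[of _ \<rho>]) (auto simp: ball_subset_ball_iff)
next
  case False
  with f r show ?thesis by (intro exI[of _ 0] exI[of _ f] exI[of _ r]) auto
qed

text \<open>\<open>m\<close> is the least vanishing order among the components that are not
  identically zero; after division by that power the component attaining it is nonzero at
  \<open>z0\<close>. The last clause keeps the quotient inside \<open>chart_fibre i\<close>.\<close>

lemma vector_factor_zero:
  fixes G :: "complex \<Rightarrow> complex^'n"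
  assumes G: "vec_holomorphic_on G (ball z0 r)" and r: "r > 0" and nz: "\<not> (\<forall>z\<in>ball z0 r. G z = 0)"
  shows "\<exists>m s. \<exists>\<rho>>0. \<rho> \<le> r \<and> vec_holomorphic_on s (ball z0 \<rho>) \<and> (\<forall>w\<in>ball z0 \<rho>. s w \<noteq> 0 \<and> G w = (w - z0) ^ m *s s w
     \<and> (\<forall>j. (\<forall>z\<in>ball z0 r. G z $ j = 0) \<longrightarrow> s w $ j = 0))"
proof -
  define I where "I = {j. \<not> (\<forall>z\<in>ball z0 r. G z $ j = 0)}"
  have "\<exists>n g. \<exists>\<rho>>0. \<rho> \<le> r \<and> g holomorphic_on ball z0 \<rho> \<and> g z0 \<noteq> 0 \<and> (\<forall>w\<in>ball z0 \<rho>. G w $ j = (w - z0) ^ n * g w)" if "j \<in> I" for j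
    using scalar_factor_zero[of "\<lambda>z. G z $ j" z0 r] G r that by (auto simp: I_def vec_holomorphic_on_def)
  then obtain n g \<rho> where g: "\<And>j. j \<in> I \<Longrightarrow> \<rho> j > 0" "\<And>j. j \<in> I \<Longrightarrow> \<rho> j \<le> r"
    "\<And>j. j \<in> I \<Longrightarrow> g j holomorphic_on ball z0 (\<rho> j)"
    "\<And>j. j \<in> I \<Longrightarrow> g j z0 \<noteq> 0" "\<And>j w. j \<in> I \<Longrightarrow> w \<in> ball z0 (\<rho> j) \<Longrightarrow> G w $ j = (w - z0) ^ n j * g j w"
    by metis
  have Ine: "I \<noteq> {}" using nz by (auto simp: I_def vec_eq_iff)
  have Ifin: "finite I" by simp
  define m where "m = Min (n ` I)"
  have m_le: "m \<le> n j" if "j \<in> I" for j using that Ifin by (auto simp: m_def)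
  have "m \<in> n ` I" unfolding m_def using Ine Ifin by (intro Min_in) auto
  then obtain j0 where j0: "j0 \<in> I" "n j0 = m" by auto
  define s where "s w = (\<chi> j. if j \<in> I then (w - z0) ^ (n j - m) * g j w else 0)" for w
  define \<rho>1 where "\<rho>1 = Min (\<rho> ` I)"
  have \<rho>1: "\<rho>1 > 0" unfolding \<rho>1_def using Ine Ifin g(1) by simp
  have \<rho>1_le: "\<rho>1 \<le> \<rho> j" if "j \<in> I" for j using that Ifin by (auto simp: \<rho>1_def)
  have "continuous_on (ball z0 \<rho>1) (g j0)"
    by (rule holomorphic_on_imp_continuous_on[OF holomorphic_on_subset[OF g(3)[OF j0(1)] subset_ball[OF \<rho>1_le[OF j0(1)]]]])
  then have "isCont (g j0) z0" using \<rho>1 by (simp add: continuous_on_eq_continuous_at)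
  then obtain d where d: "d > 0" "\<And>w. dist w z0 < d \<Longrightarrow> g j0 w \<noteq> 0"
    using g(4)[OF j0(1)] continuous_at_avoid[of z0 "g j0" 0] by (metis dist_commute)
  define \<rho>2 where "\<rho>2 = min \<rho>1 d"
  have hs: "vec_holomorphic_on s (ball z0 \<rho>2)"
    unfolding vec_holomorphic_on_def s_def
  proof
    fix j
    show "(\<lambda>z. (\<chi> j. if j \<in> I then (z - z0) ^ (n j - m) * g j z else 0) $ j) holomorphic_on ball z0 \<rho>2"
    proof (cases "j \<in> I")
      case True
      have "g j holomorphic_on ball z0 \<rho>2"
        using \<rho>1_le[OF True] by (intro holomorphic_on_subset[OF g(3)[OF True] subset_ball]) (simp add: \<rho>2_def)
      with True show ?thesis by (auto intro!: holomorphic_intros)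
    qed simp
  qed
  have "s w \<noteq> 0 \<and> G w = (w - z0) ^ m *s s w \<and> (\<forall>j. (\<forall>z\<in>ball z0 r. G z $ j = 0) \<longrightarrow> s w $ j = 0)"
    if w: "w \<in> ball z0 \<rho>2" for w
  proof (intro conjI)
    have "s w $ j0 = g j0 w" using j0 by (simp add: s_def)
    moreover have "g j0 w \<noteq> 0" using w d(2)[of w] by (simp add: \<rho>2_def dist_commute)
    ultimately show "s w \<noteq> 0" by auto
    show "G w = (w - z0) ^ m *s s w"
    proof (rule vec_eq_iff[THEN iffD2], rule allI)
      fix j
      show "G w $ j = ((w - z0) ^ m *s s w) $ j"
      proof (cases "j \<in> I")
        case True
        have "w \<in> ball z0 (\<rho> j)" using w \<rho>1_le[OF True] by (simp add: \<rho>2_def)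
        from g(5)[OF True this] show ?thesis
          using True m_le[OF True] by (simp add: s_def mult.assoc[symmetric] power_add[symmetric])
      next
        case False
        have "\<rho>2 \<le> r" using \<rho>1_le[OF j0(1)] g(2)[OF j0(1)] by (simp add: \<rho>2_def)
        then have "w \<in> ball z0 r" using w by simp
        with False show ?thesis by (simp add: s_def I_def)
      qed
    qed
    show "\<forall>j. (\<forall>z\<in>ball z0 r. G z $ j = 0) \<longrightarrow> s w $ j = 0"
      by (auto simp: s_def I_def)
  qed
  moreover have "\<rho>2 > 0" "\<rho>2 \<le> r"
    using \<rho>1 d(1) \<rho>1_le[OF j0(1)] g(2)[OF j0(1)] by (auto simp: \<rho>2_def)
  ultimately show ?thesis using hs by blast
qed

context hermitian begin

lemma continuous_on_qmetric:
  assumes "continuous_on U X" "continuous_on U Y" "continuous_on U V" "\<And>z. z \<in> U \<Longrightarrow> h (X z) (X z) \<noteq> 0"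
  shows "continuous_on U (\<lambda>z. qmetric (X z) (Y z) (V z))"
  unfolding qmetric_def by (intro continuous_intros bb.continuous_on assms) (use assms(4) in auto)

lemma continuous_on_qconn:
  assumes "continuous_on U X" "continuous_on U Y" "continuous_on U V" "\<And>z. z \<in> U \<Longrightarrow> h (X z) (X z) \<noteq> 0"
  shows "continuous_on U (\<lambda>z. qconn (X z) (Y z) (V z))"
  unfolding qconn_def by (intro vsm.continuous_on continuous_intros bb.continuous_on assms) (use assms(4) in auto)

end

text \<open>Below, \<open>W\<close> is the covariant derivative of the velocity \<open>F1\<close>, and \<open>W'\<close> its \<open>\<partial>\<close>-derivative.\<close>

locale local_curve = hermitian h for h :: "complex^'n \<Rightarrow> complex^'n \<Rightarrow> complex" +
  fixes F :: "complex \<Rightarrow> complex^'n" and U :: "complex set"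
  assumes hol: "vec_holomorphic_on F U" and oU: "open U" and nz: "\<And>z. z \<in> U \<Longrightarrow> h (F z) (F z) \<noteq> 0"
begin

definition "F1 = vderiv F"
definition "F2 = vderiv F1"
definition "F3 = vderiv F2"

lemma hol': "vec_holomorphic_on F1 U" "vec_holomorphic_on F2 U" "vec_holomorphic_on F3 U"
  unfolding F1_def F2_def F3_def using vec_holomorphic_on_vderiv hol oU by auto

lemmas cont = continuous_on_vec_holomorphic[OF hol oU] hol'[THEN continuous_on_vec_holomorphic, OF oU]

lemma der: "z \<in> U \<Longrightarrow> (F has_derivative (\<lambda>v. v *s F1 z)) (at z)"
  "z \<in> U \<Longrightarrow> (F1 has_derivative (\<lambda>v. v *s F2 z)) (at z)"
  "z \<in> U \<Longrightarrow> (F2 has_derivative (\<lambda>v. v *s F3 z)) (at z)"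
  unfolding F1_def F2_def F3_def
  using has_derivative_vec_holomorphic[OF _ oU] hol hol'[unfolded F1_def F2_def F3_def] by auto

definition "W z = F2 z + qconn (F z) (F1 z) (F1 z)"
definition "a z = Re (qmetric (F z) (F1 z) (F1 z))"
definition "a_z z = qmetric (F z) (W z) (F1 z)"
text \<open>The connection coefficient along the curve: \<open>qconn (F z) (F1 z) (F1 z)\<close> is
  \<open>- 2 * \<kappa> z\<close> times \<open>F1 z\<close>. The primed function is its
  (1,0)-derivative.\<close>

definition "\<kappa> z = h (F1 z) (F z) / h (F z) (F z)"
definition "\<kappa>' z = h (F2 z) (F z) / h (F z) (F z) - (\<kappa> z)\<^sup>2"
definition "W' z = F3 z - 2 *s (\<kappa> z *s F2 z + \<kappa>' z *s F1 z)"
definition "a_zz z = qmetric (F z) (W' z + qconn (F z) (F1 z) (W z)) (F1 z)"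
definition "a_zzbar z = (a z)\<^sup>2 + Re (qmetric (F z) (W z) (W z))"

lemma a_eq: "of_real (a z) = qmetric (F z) (F1 z) (F1 z)"
  unfolding a_def using qmetric_self by simp

lemma has_derivative_a:
  assumes z: "z \<in> U"
  shows "(a has_derivative (\<lambda>v. 2 * Re (a_z z * v))) (at z)"
proof -
  have "((\<lambda>z. qmetric (F z) (F1 z) (F1 z)) has_derivative
     (\<lambda>v. qmetric (F z) (v *s F2 z + qconn (F z) (v *s F1 z) (F1 z)) (F1 z) + qmetric (F z) (F1 z) (v *s F2 z + qconn (F z) (v *s F1 z) (F1 z)))) (at z)"
    by (rule has_derivative_qmetric[OF der(1)[OF z] der(2)[OF z] der(2)[OF z] nz[OF z]])
  moreover have "v *s F2 z + qconn (F z) (v *s F1 z) (F1 z) = v *s W z" for v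
    by (simp add: W_def qconn_simps vec_eq_iff algebra_simps)
  ultimately have "((\<lambda>z. qmetric (F z) (F1 z) (F1 z)) has_derivative (\<lambda>v. v * a_z z + cnj v * cnj (a_z z))) (at z)"
    by (simp add: qmetric_simps a_z_def qmetric_cnj)
  from has_derivative_Re[OF this] show ?thesis
    unfolding a_def[abs_def] by (rule has_derivative_eq_rhs) (simp add: fun_eq_iff)
qed

text \<open>Curvature enters here: \<open>F1\<close> is holomorphic, so the (0,1)-derivative of its
  covariant derivative is the curvature applied to it. Concretely, the (0,1)-derivative of
  \<open>\<kappa>\<close> is \<open>- a / 2\<close>.\<close>

lemma has_derivative_W:
  assumes z: "z \<in> U"
  shows "(W has_derivative (\<lambda>v. v *s W' z + cnj v *s (of_real (a z) *s F1 z))) (at z)"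
proof -
  have k: "(\<kappa> has_derivative (\<lambda>v. v * \<kappa>' z - cnj v * (of_real (a z) / 2))) (at z)"
    unfolding \<kappa>_def[abs_def]
    by (rule has_derivative_eq_rhs[OF has_derivative_divide[OF bb.FDERIV[OF der(2)[OF z] der(1)[OF z]] bb.FDERIV[OF der(1)[OF z] der(1)[OF z]] nz[OF z]]])
       (use nz[OF z] in \<open>simp add: fun_eq_iff h_simps a_eq qmetric_def \<kappa>'_def \<kappa>_def field_simps power2_eq_square\<close>)
  have "((\<lambda>z. F2 z - 2 *s (\<kappa> z *s F1 z)) has_derivative
     (\<lambda>v. v *s F3 z - 2 *s (\<kappa> z *s (v *s F2 z) + (v * \<kappa>' z - cnj v * (of_real (a z) / 2)) *s F1 z))) (at z)"
    by (intro has_derivative_diff der z bounded_linear.has_derivative[OF vsm.bounded_linear_right] vsm.FDERIV k)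
  moreover have "W = (\<lambda>z. F2 z - 2 *s (\<kappa> z *s F1 z))"
    by (simp add: fun_eq_iff W_def qconn_def \<kappa>_def vec_eq_iff)
  ultimately show ?thesis
    by (simp only:) (erule has_derivative_eq_rhs, simp add: fun_eq_iff W'_def vec_eq_iff algebra_simps)
qed

lemma has_derivative_a_z:
  assumes z: "z \<in> U"
  shows "(a_z has_derivative (\<lambda>v. a_zz z * v + of_real (a_zzbar z) * cnj v)) (at z)"
proof -
  have "((\<lambda>z. qmetric (F z) (W z) (F1 z)) has_derivative
     (\<lambda>v. qmetric (F z) (v *s W' z + cnj v *s (of_real (a z) *s F1 z) + qconn (F z) (v *s F1 z) (W z)) (F1 z) + qmetric (F z) (W z) (v *s F2 z + qconn (F z) (v *s F1 z) (F1 z)))) (at z)"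
    by (rule has_derivative_qmetric[OF der(1)[OF z] has_derivative_W[OF z] der(2)[OF z] nz[OF z]])
  moreover have "v *s F2 z + qconn (F z) (v *s F1 z) (F1 z) = v *s W z" for v
    by (simp add: W_def qconn_simps vec_eq_iff algebra_simps)
  moreover have "of_real (a_zzbar z) = of_real (a z) * qmetric (F z) (F1 z) (F1 z) + qmetric (F z) (W z) (W z)"
    using qmetric_self[of "F z" "W z"] by (simp add: a_zzbar_def a_eq[symmetric] power2_eq_square)
  ultimately show ?thesis
    unfolding a_z_def[abs_def]
    by (simp only:) (erule has_derivative_eq_rhs, simp add: fun_eq_iff a_zz_def qmetric_simps qconn_simps algebra_simps)
qed

lemma continuous_W: "continuous_on U W"
  unfolding W_def[abs_def] by (intro continuous_intros continuous_on_qconn cont nz)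

lemma continuous_a_zz: "continuous_on U a_zz"
  unfolding a_zz_def[abs_def] W'_def \<kappa>'_def \<kappa>_def
  by (intro continuous_intros continuous_on_qmetric continuous_on_qconn continuous_W cont vsm.continuous_on bb.continuous_on nz; simp add: nz)

lemma continuous_a_zzbar: "continuous_on U a_zzbar"
  unfolding a_zzbar_def[abs_def] a_def
  by (intro continuous_intros continuous_on_qmetric continuous_W cont nz)

end

section \<open>Curves with positive tangent lines\<close>

context hermitian begin

text \<open>The squared length of the part of \<open>w\<close> orthogonal to \<open>s\<close>,
  divided by that of \<open>s\<close>. For \<open>w\<close> = \<nabla>s this is
  \<parallel>\<psi>\<parallel>^2.\<close>

definition perp_ratio :: "complex^'n \<Rightarrow> complex^'n \<Rightarrow> complex^'n \<Rightarrow> real" where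
  "perp_ratio X w s = Re (qmetric X w w) / Re (qmetric X s s) - (norm (qmetric X w s))\<^sup>2 / (Re (qmetric X s s))\<^sup>2"

lemma perp_ratio_complex: "of_real (perp_ratio X w s) = qmetric X w w / qmetric X s s - qmetric X w s * qmetric X s w / (qmetric X s s)\<^sup>2"
proof -
  have "of_real ((norm (qmetric X w s))\<^sup>2) = qmetric X w s * qmetric X s w"
    unfolding complex_norm_square qmetric_cnj ..
  then show ?thesis
    unfolding perp_ratio_def of_real_diff of_real_divide of_real_power[of "Re _"] qmetric_self[symmetric] by simp
qed

text \<open>Rescaling a section s to \<phi> s turns \<nabla>s into \<phi>' s + \<phi> \<nabla>s. The
  invariance permits dividing the velocity by a power of z - z0.\<close>

lemma perp_ratio_invariant:
  assumes "\<phi> \<noteq> 0" "qmetric X s s \<noteq> 0"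
  shows "perp_ratio X (c *s s + \<phi> *s w) (\<phi> *s s) = perp_ratio X w s"
proof -
  have "complex_of_real (perp_ratio X (c *s s + \<phi> *s w) (\<phi> *s s)) = of_real (perp_ratio X w s)"
    unfolding perp_ratio_complex qmetric_simps using assms by (simp add: field_simps power2_eq_square)
  then show ?thesis by (rule of_real_eq_iff[THEN iffD1])
qed

lemma pr_perp_qmetric:
  assumes s: "s \<in> chart_fibre i" "qmetric X s s \<noteq> 0" and w: "w \<in> chart_fibre i"
  shows "pr_perp (chart_fibre i) (qmetric X) (vec.span {s}) w = w - (qmetric X w s / qmetric X s s) *s s"
  unfolding pr_perp_def
proof (rule the_equality)
  show "w - (qmetric X w s / qmetric X s s) *s s \<in> chart_fibre i \<and> w - (w - (qmetric X w s / qmetric X s s) *s s) \<in> vec.span {s} \<and>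
      (\<forall>Xa\<in>vec.span {s}. qmetric X (w - (qmetric X w s / qmetric X s s) *s s) Xa = 0)"
    using s w by (auto simp: chart_fibre_def vec.span_singleton qmetric_simps)
  fix y assume y: "y \<in> chart_fibre i \<and> w - y \<in> vec.span {s} \<and> (\<forall>X'\<in>vec.span {s}. qmetric X y X' = 0)"
  then obtain k where k: "w - y = k *s s" by (auto simp: vec.span_singleton)
  then have "y = w - k *s s" by (simp add: algebra_simps)
  moreover have "qmetric X y s = 0" using y by (simp add: vec.span_base)
  ultimately have "qmetric X w s = k * qmetric X s s" by (simp add: qmetric_simps)
  then show "y = w - (qmetric X w s / qmetric X s s) *s s" using s \<open>y = w - k *s s\<close> by simp
qed

text \<open>The velocity of a rescaled lift c x is c' x + c u. This is thus the independence of the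
  pulled-back form from the lift, and in particular from the chart.\<close>

lemma qmetric_scale_base:
  assumes "c \<noteq> 0" "h x x \<noteq> 0"
  shows "qmetric (c *s x) (b *s x + c *s u) (b *s x + c *s u) = qmetric x u u"
  using assms by (simp add: qmetric_def h_simps field_simps power2_eq_square)

end

locale positive_curve = nondegenerate_hermitian h for h :: "complex^'n \<Rightarrow> complex^'n \<Rightarrow> complex" +
  fixes f :: "complex \<Rightarrow> (complex^'n) set"
  assumes hc: "holomorphic_curve f" and fpos: "\<And>z. f z \<in> pos_domain h"
    and nonconst: "\<not> f constant_on UNIV" and lift_pos: "lift_in_positive_lines h f"
begin

definition F :: "'n \<Rightarrow> complex \<Rightarrow> complex^'n" where "F i z = chart i (f z)"

abbreviation U :: "'n \<Rightarrow> complex set" where "U i \<equiv> chart_preimage f i"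

lemma F_props:
  assumes "z \<in> U i"
  shows "F i z \<in> f z" "F i z $ i = 1" "F i z \<noteq> 0" "f z = vec.span {F i z}" "Re (h (F i z) (F i z)) > 0"
    "h (F i z) (F i z) \<noteq> 0"
proof -
  have "f z \<in> chart_dom i" using assms by (simp add: chart_preimage_def)
  note c = chart_props[OF this, folded F_def]
  show "F i z \<in> f z" "F i z $ i = 1" "F i z \<noteq> 0" "f z = vec.span {F i z}" by fact+
  show "Re (h (F i z) (F i z)) > 0" using fpos[of z] c(1,3) by (auto simp: pos_domain_def)
  then show "h (F i z) (F i z) \<noteq> 0" by auto
qed

lemma open_U: "open (U i)" using hc by (simp add: holomorphic_curve_def)

lemma U_cover: "\<exists>i. z \<in> U i"
proof -
  have l: "f z \<in> proj_space" using hc by (simp add: holomorphic_curve_def)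
  have "\<exists>x\<in>f z. x \<noteq> 0"
  proof (rule ccontr)
    assume "\<not> (\<exists>x\<in>f z. x \<noteq> 0)"
    then have "f z \<subseteq> {0}" by auto
    then have "vec.dim (f z) \<le> vec.dim {0 :: complex^'n}" by (rule vec.dim_subset)
    also have "\<dots> = 0" by (simp add: vec.dim_singleton)
    finally have "vec.dim (f z) \<le> 0" .
    moreover have "vec.dim (f z) = 1" using l unfolding proj_space_def by blast
    ultimately show False by linarith
  qed
  then obtain x :: "complex^'n" and i where "x \<in> f z" "x $ i \<noteq> 0" by (auto simp: vec_eq_iff)
  then show ?thesis using l by (auto simp: chart_preimage_def chart_dom_def)
qed

sublocale lc: local_curve h "F i" "U i" for i
proof
  show "vec_holomorphic_on (F i) (U i)"
    using hc by (simp add: vec_holomorphic_on_def F_def holomorphic_curve_def)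
qed (use open_U F_props in auto)

lemma curve_deriv_eq: "curve_deriv f i = lc.F1 i"
  by (simp add: fun_eq_iff curve_deriv_def lc.F1_def vderiv_def F_def)

lemma vderiv_fibre:
  assumes "\<And>z. z \<in> U i \<Longrightarrow> G z $ i = c" "z \<in> U i"
  shows "vderiv G z \<in> chart_fibre i"
proof -
  have "deriv (\<lambda>\<zeta>. G \<zeta> $ i) z = deriv (\<lambda>_. c) z"
    using assms open_U[of i] by (intro deriv_cong_ev eventually_nhds_in_open[THEN eventually_mono]) auto
  then show ?thesis by (simp add: chart_fibre_def vderiv_def)
qed

lemma fibre:
  assumes "z \<in> U i"
  shows "lc.F1 i z \<in> chart_fibre i" "lc.F2 i z \<in> chart_fibre i" "lc.W i z \<in> chart_fibre i"
proof -
  have 1: "lc.F1 i z \<in> chart_fibre i" if "z \<in> U i" for z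
    unfolding lc.F1_def using F_props(2) that by (rule vderiv_fibre)
  have 2: "lc.F2 i z \<in> chart_fibre i"
    unfolding lc.F2_def by (rule vderiv_fibre[OF _ assms, of _ 0]) (use 1 in \<open>simp add: chart_fibre_def\<close>)
  show "lc.F1 i z \<in> chart_fibre i" "lc.F2 i z \<in> chart_fibre i" by (fact 1[OF assms] 2)+
  have "qconn (F i z) (lc.F1 i z) (lc.F1 i z) \<in> chart_fibre i" using 1[OF assms] by (intro qconn_fibre)
  with 2 show "lc.W i z \<in> chart_fibre i" by (simp add: lc.W_def chart_fibre_def)
qed

lemma pullback_metric_eq: "z \<in> U i \<Longrightarrow> pullback_metric h f i z = qmetric (F i z)"
  by (intro ext) (simp add: pullback_metric_def F_def[symmetric] omega_metric_eq F_props(5))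

lemma pullback_chern_form_eq:
  assumes z: "z \<in> U i" and w: "w \<in> chart_fibre i"
  shows "pullback_chern_form h f i z v w = qconn (F i z) (v *s lc.F1 i z) w"
proof -
  have A: "chern_connection (\<lambda>v. \<i> * v) (U i) UNIV (chart_fibre i) (\<lambda>z. omega_metric h (F i z)) (\<lambda>z v w. qconn (F i z) (v *s lc.F1 i z) w)"
  proof (rule chern_connection_pullback)
    fix z v assume z: "z \<in> U i"
    show "Re (h (F i z) (F i z)) > 0" by (rule F_props(5)[OF z])
    have "((\<lambda>t. F i (z + t *\<^sub>R v)) has_vector_derivative v *s lc.F1 i z) (at 0)"
      by (rule has_vector_derivative_line[OF lc.der(1)[OF z]])
    then show "((\<lambda>t. F i (z + t *\<^sub>R v)) has_derivative (\<lambda>t. t *\<^sub>R (v *s lc.F1 i z))) (at 0)"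
      by (simp add: has_vector_derivative_def)
    show "\<forall>\<^sub>F t in nhds (0::real). z + t *\<^sub>R v \<in> U i"
      by (rule eventually_line_in_open[OF open_U z])
    show "v *s lc.F1 i z \<in> chart_fibre i" using fibre(1)[OF z] by (simp add: chart_fibre_def)
  qed (simp_all add: vec_eq_iff algebra_simps)
  have B: "chern_connection (\<lambda>v. \<i> * v) (U i) UNIV (chart_fibre i) (\<lambda>z. omega_metric h (F i z)) (pullback_chern_form h f i)"
    using chern_connection_chern_form[OF A]
    unfolding pullback_chern_form_def pullback_metric_def[abs_def] F_def by simp
  show ?thesis
  proof (rule chern_connection_unique[OF B A z _ _ w])
    show "omega_metric h (F i z) = qmetric (F i z)" using omega_metric_eq[OF F_props(5)[OF z]] by (intro ext)
    show "y = 0" if "y \<in> chart_fibre i" "\<And>w'. w' \<in> chart_fibre i \<Longrightarrow> qmetric (F i z) y w' = 0" for y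
      by (rule qmetric_nondegenerate[OF F_props(2,6)[OF z] that])
  qed auto
qed

section \<open>The tangent line and the zeros of the velocity\<close>

lemma lift_generator_F1:
  assumes z: "z \<in> U i" and n: "lc.F1 i z \<noteq> 0"
  shows "lift_generator f i z (lc.F1 i)"
proof -
  have "open (U i \<inter> lc.F1 i -` (- {0}))"
    by (rule continuous_open_preimage[OF lc.cont(2) open_U]) auto
  then show ?thesis
    unfolding lift_generator_def curve_deriv_eq
    using z n lc.hol'(1)[of i] fibre(1)
    by (intro exI[of _ "U i \<inter> lc.F1 i -` (- {0})"]) (auto simp: vec_holomorphic_on_def intro: holomorphic_on_subset)
qed

lemma lift_line_eq:
  assumes z: "z \<in> U i" and n: "lc.F1 i z \<noteq> 0"
  shows "lift_line f i z = vec.span {lc.F1 i z}"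
proof -
  have "vec.span {s z} = vec.span {lc.F1 i z}" if "lift_generator f i z s" for s
    using that n unfolding lift_generator_def curve_deriv_eq by metis
  with lift_generator_F1[OF z n] show ?thesis unfolding lift_line_def by blast
qed

lemma a_pos:
  assumes z: "z \<in> U i" and n: "lc.F1 i z \<noteq> 0"
  shows "lc.a i z > 0"
proof -
  have "lc.F1 i z \<in> lift_line f i z" unfolding lift_line_eq[OF assms] by (simp add: vec.span_base)
  then have "Re (pullback_metric h f i z (lc.F1 i z) (lc.F1 i z)) > 0"
    using lift_pos z n unfolding lift_in_positive_lines_def by blast
  then show ?thesis by (simp add: lc.a_def pullback_metric_eq[OF z])
qed

lemma a_eq_0_iff: "z \<in> U i \<Longrightarrow> lc.a i z = 0 \<longleftrightarrow> lc.F1 i z = 0"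
  using a_pos[of z i] by (cases "lc.F1 i z = 0") (auto simp: lc.a_def qmetric_simps)

lemma a_nonneg: "z \<in> U i \<Longrightarrow> lc.a i z \<ge> 0"
  using a_pos[of z i] a_eq_0_iff[of z i] by fastforce

lemma a_chart_independent:
  assumes z: "z \<in> U i" "z \<in> U j"
  shows "lc.a i z = lc.a j z"
proof -
  let ?S = "U i \<inter> U j"
  have S: "open ?S" "z \<in> ?S" using open_U z by auto
  have scale: "F j \<zeta> = (F j \<zeta> $ i) *s F i \<zeta>" if \<zeta>: "\<zeta> \<in> ?S" for \<zeta>
  proof -
    have "F j \<zeta> \<in> vec.span {F i \<zeta>}" using F_props(1)[of \<zeta> j] F_props(4)[of \<zeta> i] \<zeta> by auto
    then obtain c where c: "F j \<zeta> = c *s F i \<zeta>" by (auto simp: vec.span_singleton)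
    then have "F j \<zeta> $ i = c" using F_props(2)[of \<zeta> i] \<zeta> by simp
    with c show ?thesis by simp
  qed
  define g where "g \<zeta> = F j \<zeta> $ i" for \<zeta>
  have hg: "g holomorphic_on ?S"
    unfolding g_def using lc.hol[of j] by (auto simp: vec_holomorphic_on_def intro: holomorphic_on_subset)
  have hF: "vec_holomorphic_on (F i) ?S"
    using lc.hol[of i] by (auto simp: vec_holomorphic_on_def intro: holomorphic_on_subset)
  have d: "lc.F1 j z = deriv g z *s F i z + g z *s lc.F1 i z"
    unfolding lc.F1_def by (rule vderiv_smult[OF hg hF S]) (use scale in \<open>simp add: g_def\<close>)
  have e: "F j z = g z *s F i z" using scale[OF S(2)] by (simp add: g_def)
  have "g z \<noteq> 0" using e F_props(3)[OF z(2)] by auto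
  then show ?thesis
    unfolding lc.a_def d e using qmetric_scale_base F_props(6)[OF z(1)] by simp
qed

lemma pullback_omega_eq:
  assumes z: "z \<in> U i"
  shows "pullback_omega h f z = lc.a i z"
  unfolding pullback_omega_def
proof (rule the_equality)
  have *: "Re (pullback_metric h f j z (curve_deriv f j z) (curve_deriv f j z)) = lc.a i z" if "z \<in> U j" for j
    using a_chart_independent[OF z that] by (simp add: pullback_metric_eq[OF that] curve_deriv_eq lc.a_def)
  then show "\<forall>j. z \<in> U j \<longrightarrow> lc.a i z = Re (pullback_metric h f j z (curve_deriv f j z) (curve_deriv f j z))" by simp
  fix q assume "\<forall>j. z \<in> U j \<longrightarrow> q = Re (pullback_metric h f j z (curve_deriv f j z) (curve_deriv f j z))"
  then have "q = Re (pullback_metric h f i z (curve_deriv f i z) (curve_deriv f i z))" using z by blast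
  then show "q = lc.a i z" unfolding *[OF z] .
qed

text \<open>An identity theorem across charts. The interior \<open>A\<close> of the zero set of
  \<open>pullback_omega\<close> is closed: around a limit point the velocity in one chart vanishes
  on an open part of a ball, hence on the ball. If \<open>A\<close> is nonempty it is the whole
  plane, so \<open>f\<close> is locally constant and therefore constant.\<close>

lemma F1_not_locally_zero:
  assumes N: "open N" "z \<in> N" "N \<subseteq> U i"
  shows "\<exists>w\<in>N. lc.F1 i w \<noteq> 0"
proof (rule ccontr)
  assume none: "\<not> (\<exists>w\<in>N. lc.F1 i w \<noteq> 0)"
  define A where "A = interior {w. pullback_omega h f w = 0}"
  have "N \<subseteq> {w. pullback_omega h f w = 0}"
    using none N pullback_omega_eq a_eq_0_iff by (metis (mono_tags, lifting) mem_Collect_eq subset_eq)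
  then have zA: "z \<in> A" unfolding A_def using N by (meson interior_maximal subsetD)
  have "closed A"
    unfolding closed_limpt
  proof (intro allI impI)
    fix x assume x: "x islimpt A"
    obtain j where j: "x \<in> U j" using U_cover by blast
    then obtain r where r: "r > 0" "ball x r \<subseteq> U j" using open_U open_contains_ball by blast
    then obtain y where y: "y \<in> A" "y \<in> ball x r"
      using x unfolding islimpt_def by (metis centre_in_ball open_ball)
    define B where "B = A \<inter> ball x r"
    have B: "open B" "B \<noteq> {}" "B \<subseteq> ball x r" using y by (auto simp: B_def A_def)
    have 0: "lc.F1 j w = 0" if "w \<in> B" for w
    proof -
      have "pullback_omega h f w = 0" using that interior_subset by (auto simp: B_def A_def)
      moreover have "w \<in> U j" using that r by (auto simp: B_def)
      ultimately show ?thesis using pullback_omega_eq a_eq_0_iff by metis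
    qed
    have "lc.F1 j w $ k = 0" if "w \<in> ball x r" for w k
      by (rule analytic_continuation_open[OF B(1) open_ball B(2) connected_ball B(3), of "\<lambda>w. lc.F1 j w $ k" "\<lambda>_. 0"])
        (use lc.hol'(1)[of j] r 0 that in \<open>auto simp: vec_holomorphic_on_def intro: holomorphic_on_subset\<close>)
    then have "pullback_omega h f w = 0" if "w \<in> ball x r" for w
      using that r pullback_omega_eq[of w j] a_eq_0_iff[of w j] by (auto simp: vec_eq_iff)
    then have "ball x r \<subseteq> {w. pullback_omega h f w = 0}" by auto
    then show "x \<in> A" unfolding A_def using r by (meson interior_maximal open_ball centre_in_ball subsetD)
  qed
  moreover have "open A" by (simp add: A_def)
  ultimately have "A = UNIV" using zA clopen by blast
  then have all0: "pullback_omega h f w = 0" for w using interior_subset unfolding A_def by blast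
  have "\<forall>\<^sub>F b in at a. f a = f b" for a
  proof -
    obtain j where j: "a \<in> U j" using U_cover by blast
    then obtain r where r: "r > 0" "ball a r \<subseteq> U j" using open_U open_contains_ball by blast
    have der0: "(F j has_derivative (\<lambda>v. 0)) (at w within ball a r)" if "w \<in> ball a r" for w
    proof -
      have w: "w \<in> U j" using that r by auto
      then have "lc.F1 j w = 0" using all0 pullback_omega_eq a_eq_0_iff by metis
      then show ?thesis using lc.der(1)[OF w] by (simp add: has_derivative_at_withinI)
    qed
    have const: "f b = f a" if b: "b \<in> ball a r" for b
    proof -
      obtain c where c: "\<And>w. w \<in> ball a r \<Longrightarrow> F j w = c"
        using has_derivative_zero_constant[OF convex_ball der0] by metis
      then have "F j b = F j a" using b r by simp
      then show ?thesis using F_props(4)[of a j] F_props(4)[of b j] b r j by auto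
    qed
    have "\<forall>b\<in>UNIV. b \<noteq> a \<and> dist b a < r \<longrightarrow> f a = f b"
      using const by (metis dist_commute mem_ball)
    then show ?thesis unfolding eventually_at using r(1) by blast
  qed
  then have "f a = f b" for a b
    by (intro connected_local_const[of UNIV]) auto
  then have "f constant_on UNIV" unfolding constant_on_def by metis
  with nonconst show False by simp
qed

text \<open>Dividing out the zero of the velocity at \<open>z0\<close> extends the tangent direction
  through it, which makes the positivity hypothesis available at \<open>z0\<close> as well.\<close>

lemma local_generator:
  assumes z0: "z0 \<in> U i"
  obtains s m W where "open W" "z0 \<in> W" "W \<subseteq> U i" "vec_holomorphic_on s W"
    "\<And>w. w \<in> W \<Longrightarrow> s w \<noteq> 0" "\<And>w. w \<in> W \<Longrightarrow> lc.F1 i w = (w - z0) ^ m *s s w"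
    "\<And>w. w \<in> W \<Longrightarrow> s w \<in> chart_fibre i" "lift_generator f i z0 s"
proof -
  obtain r where r: "r > 0" "ball z0 r \<subseteq> U i" using z0 open_U open_contains_ball by blast
  have h1: "vec_holomorphic_on (lc.F1 i) (ball z0 r)"
    using lc.hol'(1)[of i] r by (auto simp: vec_holomorphic_on_def intro: holomorphic_on_subset)
  have nz: "\<not> (\<forall>z\<in>ball z0 r. lc.F1 i z = 0)"
    using F1_not_locally_zero[of "ball z0 r" z0 i] r by auto
  obtain m s \<rho> where s: "\<rho> > 0" "\<rho> \<le> r" "vec_holomorphic_on s (ball z0 \<rho>)" and
    s': "\<And>w. w \<in> ball z0 \<rho> \<Longrightarrow> s w \<noteq> 0" "\<And>w. w \<in> ball z0 \<rho> \<Longrightarrow> lc.F1 i w = (w - z0) ^ m *s s w"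
      "\<And>w j. w \<in> ball z0 \<rho> \<Longrightarrow> (\<forall>z\<in>ball z0 r. lc.F1 i z $ j = 0) \<Longrightarrow> s w $ j = 0"
    using vector_factor_zero[OF h1 r(1) nz] by blast
  have sub: "ball z0 \<rho> \<subseteq> U i" using s(2) r(2) by (meson subset_ball subset_trans)
  have fib: "s w \<in> chart_fibre i" if "w \<in> ball z0 \<rho>" for w
    using s'(3)[OF that, of i] fibre(1)[of _ i] r(2) by (auto simp: chart_fibre_def)
  have gen: "lift_generator f i z0 s"
    unfolding lift_generator_def curve_deriv_eq
  proof (intro exI[of _ "ball z0 \<rho>"] conjI ballI impI)
    fix w assume w: "w \<in> ball z0 \<rho>" and n: "lc.F1 i w \<noteq> 0"
    then have "(w - z0) ^ m \<noteq> 0" using s'(2)[OF w] by auto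
    then show "vec.span {s w} = vec.span {lc.F1 i w}"
      unfolding s'(2)[OF w] by (simp add: vec.span_image_scale[of "{s w}" "\<lambda>_. (w - z0) ^ m", simplified])
  qed (use s s' sub fib in \<open>auto simp: vec_holomorphic_on_def\<close>)
  show ?thesis by (rule that[OF open_ball _ sub s(3) s'(1,2) fib gen]) (use s in auto)
qed

text \<open>Holds at zeros of the velocity too, where the line is larger than the span of the
  velocity. \<open>second_fund\<close> requires sections to lie in the line on all of
  \<open>U i\<close>.\<close>

lemma F1_in_lift_line:
  assumes z: "z \<in> U i"
  shows "c *s lc.F1 i z \<in> lift_line f i z"
proof -
  obtain s m W where s: "z \<in> W" "\<And>w. w \<in> W \<Longrightarrow> lc.F1 i w = (w - z) ^ m *s s w" "lift_generator f i z s"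
    using local_generator[OF z] by metis
  have "c *s lc.F1 i z \<in> vec.span {s z}"
    unfolding s(2)[OF s(1)] by (intro vec.span_scale vec.span_base) simp
  with s(3) show ?thesis unfolding lift_line_def by blast
qed

section \<open>The second fundamental form\<close>

text \<open>Near \<open>z\<close> the section is \<phi> times the velocity, with \<phi> read off
  from a coordinate in which the velocity is nonzero. By Leibniz only the multiple \<open>b\<close>
  of the velocity depends on the section, and \<open>pr_perp\<close> removes it; so the description
  in \<open>second_fund\<close> determines a value.\<close>

lemma nabla_section:
  assumes z: "z \<in> U i" and n: "lc.F1 i z \<noteq> 0"
    and s: "\<And>\<zeta>. \<zeta> \<in> U i \<Longrightarrow> s \<zeta> \<in> lift_line f i \<zeta>" "s differentiable (at z)" "s z = c *s lc.F1 i z"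
  shows "\<exists>b. nabla (pullback_chern_form h f i) s z 1 = b *s lc.F1 i z + c *s lc.W i z"
proof -
  obtain j where j: "lc.F1 i z $ j \<noteq> 0" using n by (auto simp: vec_eq_iff)
  obtain s' where s': "(s has_derivative s') (at z)" using s(2) unfolding differentiable_def by blast
  define \<phi> where "\<phi> \<zeta> = s \<zeta> $ j / lc.F1 i \<zeta> $ j" for \<zeta>
  have dj: "((\<lambda>\<zeta>. lc.F1 i \<zeta> $ j) has_derivative (\<lambda>v. (v *s lc.F2 i z) $ j)) (at z)"
    by (rule bounded_linear.has_derivative[OF bounded_linear_vec_nth lc.der(2)[OF z]])
  obtain \<phi>' where \<phi>': "(\<phi> has_derivative \<phi>') (at z)"
    unfolding \<phi>_def[abs_def]
    using has_derivative_divide[OF bounded_linear.has_derivative[OF bounded_linear_vec_nth s'] dj j] by blast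
  have "open (U i \<inter> (\<lambda>\<zeta>. lc.F1 i \<zeta> $ j) -` (- {0}))"
    by (rule continuous_open_preimage[OF _ open_U]) (auto intro!: continuous_intros lc.cont)
  moreover have "z \<in> U i \<inter> (\<lambda>\<zeta>. lc.F1 i \<zeta> $ j) -` (- {0})" using z j by simp
  moreover have "\<phi> \<zeta> *s lc.F1 i \<zeta> = s \<zeta>" if "\<zeta> \<in> U i \<inter> (\<lambda>\<zeta>. lc.F1 i \<zeta> $ j) -` (- {0})" for \<zeta>
  proof -
    have \<zeta>: "\<zeta> \<in> U i" "lc.F1 i \<zeta> $ j \<noteq> 0" using that by auto
    then have "lc.F1 i \<zeta> \<noteq> 0" by auto
    then obtain k where "s \<zeta> = k *s lc.F1 i \<zeta>"
      using s(1)[OF \<zeta>(1)] lift_line_eq[OF \<zeta>(1)] by (auto simp: vec.span_singleton)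
    with \<zeta> show ?thesis by (simp add: \<phi>_def)
  qed
  ultimately have "(s has_derivative (\<lambda>v. \<phi> z *s (v *s lc.F2 i z) + \<phi>' v *s lc.F1 i z)) (at z)"
    by (rule has_derivative_transform_within_open[OF vsm.FDERIV[OF \<phi>' lc.der(2)[OF z]]])
  then have "dird s z 1 = \<phi> z *s lc.F2 i z + \<phi>' 1 *s lc.F1 i z"
    by (simp add: dird_has_derivative)
  moreover have "\<phi> z = c" using j by (simp add: \<phi>_def s(3))
  moreover have "c *s lc.F1 i z \<in> chart_fibre i" using fibre(1)[OF z] by (simp add: chart_fibre_def)
  ultimately have "nabla (pullback_chern_form h f i) s z 1 = \<phi>' 1 *s lc.F1 i z + c *s lc.W i z"
    unfolding nabla_def s(3) using pullback_chern_form_eq[OF z, of "c *s lc.F1 i z" 1]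
    by (simp add: qconn_simps lc.W_def vec_eq_iff algebra_simps)
  then show ?thesis by blast
qed

lemma psi_eq:
  assumes z: "z \<in> U i" and n: "lc.F1 i z \<noteq> 0"
  shows "psi h f i z (c *s lc.F1 i z) =
    c *s (lc.W i z - (qmetric (F i z) (lc.W i z) (lc.F1 i z) / qmetric (F i z) (lc.F1 i z) (lc.F1 i z)) *s lc.F1 i z)"
    (is "_ = ?Y")
proof -
  have a: "qmetric (F i z) (lc.F1 i z) (lc.F1 i z) \<noteq> 0"
    using a_pos[OF z n] lc.a_eq[of i z] by auto
  have pr: "pr_perp (chart_fibre i) (pullback_metric h f i z) (lift_line f i z) (b *s lc.F1 i z + c *s lc.W i z) = ?Y" for b
  proof -
    have "b *s lc.F1 i z + c *s lc.W i z \<in> chart_fibre i" using fibre[OF z] by (simp add: chart_fibre_def)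
    from pr_perp_qmetric[OF fibre(1)[OF z] a this] show ?thesis
      unfolding pullback_metric_eq[OF z] lift_line_eq[OF z n]
      using a by (simp add: qmetric_simps vec_eq_iff add_divide_distrib algebra_simps)
  qed
  show ?thesis
    unfolding psi_def second_fund_def
  proof (rule the_equality)
    let ?s = "\<lambda>\<zeta>. c *s lc.F1 i \<zeta>"
    have s: "\<forall>\<zeta>\<in>U i. ?s \<zeta> \<in> lift_line f i \<zeta>" using F1_in_lift_line by blast
    have d: "?s differentiable at z"
      using bounded_linear.has_derivative[OF vsm.bounded_linear_right lc.der(2)[OF z]] unfolding differentiable_def by blast
    obtain b where "nabla (pullback_chern_form h f i) ?s z 1 = b *s lc.F1 i z + c *s lc.W i z"
      using nabla_section[OF z n _ d refl] s by blast
    then show "\<exists>s. (\<forall>\<zeta>\<in>U i. s \<zeta> \<in> lift_line f i \<zeta>) \<and> s differentiable at z \<and> s z = c *s lc.F1 i z \<and>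
        ?Y = pr_perp (chart_fibre i) (pullback_metric h f i z) (lift_line f i z) (nabla (pullback_chern_form h f i) s z 1)"
      using s d pr by (intro exI[of _ ?s]) simp
  next
    fix Y
    assume "\<exists>s. (\<forall>\<zeta>\<in>U i. s \<zeta> \<in> lift_line f i \<zeta>) \<and> s differentiable at z \<and> s z = c *s lc.F1 i z \<and>
        Y = pr_perp (chart_fibre i) (pullback_metric h f i z) (lift_line f i z) (nabla (pullback_chern_form h f i) s z 1)"
    then obtain s where s: "\<forall>\<zeta>\<in>U i. s \<zeta> \<in> lift_line f i \<zeta>" "s differentiable at z" "s z = c *s lc.F1 i z"
      and Y: "Y = pr_perp (chart_fibre i) (pullback_metric h f i z) (lift_line f i z) (nabla (pullback_chern_form h f i) s z 1)"
      by blast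
    obtain b where "nabla (pullback_chern_form h f i) s z 1 = b *s lc.F1 i z + c *s lc.W i z"
      using nabla_section[OF z n _ s(2,3)] s(1) by blast
    then show "Y = ?Y" unfolding Y by (simp only: pr)
  qed
qed

lemma psi_quotient:
  assumes z: "z \<in> U i" and n: "lc.F1 i z \<noteq> 0" and X: "X \<in> lift_line f i z" "X \<noteq> 0"
  shows "Re (pullback_metric h f i z (psi h f i z X) (psi h f i z X)) / Re (pullback_metric h f i z X X)
    = perp_ratio (F i z) (lc.W i z) (lc.F1 i z)"
proof -
  define x u w where "x = F i z" and "u = lc.F1 i z" and "w = lc.W i z"
  obtain c where c: "X = c *s u" using X lift_line_eq[OF z n] by (auto simp: vec.span_singleton u_def)
  have c0: "c \<noteq> 0" using c X by auto
  have a: "qmetric x u u \<noteq> 0"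
    using a_pos[OF z n] lc.a_eq[of i z] by (auto simp: x_def u_def)
  define Y where "Y = c *s (w - (qmetric x w u / qmetric x u u) *s u)"
  have Y: "psi h f i z X = Y" unfolding c Y_def x_def u_def w_def by (rule psi_eq[OF z n])
  have "complex_of_real (Re (qmetric x Y Y) / Re (qmetric x X X)) = qmetric x Y Y / qmetric x X X"
    unfolding of_real_divide qmetric_self[symmetric] ..
  also have "\<dots> = of_real (perp_ratio x w u)"
    unfolding perp_ratio_complex Y_def c qmetric_simps using a c0 qmetric_cnj[of x u u]
    by (simp add: qmetric_cnj field_simps power2_eq_square)
  finally have "Re (qmetric x Y Y) / Re (qmetric x X X) = perp_ratio x w u" by (rule of_real_eq_iff[THEN iffD1])
  then show ?thesis unfolding Y pullback_metric_eq[OF z] by (simp add: x_def u_def w_def)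
qed

section \<open>Global derivatives and the norm of \<psi>\<close>

definition "some_chart z = (SOME i. z \<in> U i)"

lemma some_chart: "z \<in> U (some_chart z)"
  unfolding some_chart_def using U_cover by (rule someI_ex)

definition "omega_z z = lc.a_z (some_chart z) z"
definition "omega_zz z = lc.a_zz (some_chart z) z"
definition "omega_zzbar z = lc.a_zzbar (some_chart z) z"

lemma has_derivative_omega_chart:
  assumes z: "z \<in> U i"
  shows "(pullback_omega h f has_derivative (\<lambda>v. 2 * Re (lc.a_z i z * v))) (at z)"
  by (rule has_derivative_transform_within_open[OF lc.has_derivative_a[OF z] open_U z])
    (simp add: pullback_omega_eq)

text \<open>Independence of the chart comes from uniqueness of the derivative of the global function
  \<open>pullback_omega\<close>, instead of a transition formula. The directions 1 and i isolate
  real and imaginary part. Second derivatives are treated in the same way below.\<close>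

lemma omega_z_eq:
  assumes z: "z \<in> U i"
  shows "omega_z z = lc.a_z i z"
proof -
  have "(\<lambda>v. 2 * Re (omega_z z * v)) = (\<lambda>v. 2 * Re (lc.a_z i z * v))"
    unfolding omega_z_def by (rule has_derivative_unique[OF has_derivative_omega_chart[OF some_chart] has_derivative_omega_chart[OF z]])
  from fun_cong[OF this, of 1] fun_cong[OF this, of \<i>] show ?thesis by (simp add: complex_eq_iff)
qed

lemma has_derivative_omega_z_chart:
  assumes z: "z \<in> U i"
  shows "(omega_z has_derivative (\<lambda>v. lc.a_zz i z * v + of_real (lc.a_zzbar i z) * cnj v)) (at z)"
  by (rule has_derivative_transform_within_open[OF lc.has_derivative_a_z[OF z] open_U z])
    (simp add: omega_z_eq)

lemma omega_zz_eq:
  assumes z: "z \<in> U i"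
  shows "omega_zz z = lc.a_zz i z" "omega_zzbar z = lc.a_zzbar i z"
proof -
  have "(\<lambda>v. omega_zz z * v + of_real (omega_zzbar z) * cnj v) = (\<lambda>v. lc.a_zz i z * v + of_real (lc.a_zzbar i z) * cnj v)"
    unfolding omega_zz_def omega_zzbar_def by (rule has_derivative_unique[OF has_derivative_omega_z_chart[OF some_chart] has_derivative_omega_z_chart[OF z]])
  from fun_cong[OF this, of 1] fun_cong[OF this, of \<i>]
  show "omega_zz z = lc.a_zz i z" "omega_zzbar z = lc.a_zzbar i z" by (auto simp add: complex_eq_iff)
qed

lemma continuous_omega_zz: "continuous_on UNIV omega_zz" "continuous_on UNIV omega_zzbar"
proof -
  have "isCont omega_zz z \<and> isCont omega_zzbar z" for z
  proof -
    have "continuous_on (U (some_chart z)) omega_zz"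
      by (rule continuous_on_eq[OF lc.continuous_a_zz]) (simp add: omega_zz_eq(1))
    moreover have "continuous_on (U (some_chart z)) omega_zzbar"
      by (rule continuous_on_eq[OF lc.continuous_a_zzbar]) (simp add: omega_zz_eq(2))
    ultimately show ?thesis
      unfolding continuous_on_eq_continuous_at[OF open_U] using some_chart[of z] by blast
  qed
  then show "continuous_on UNIV omega_zz" "continuous_on UNIV omega_zzbar"
    by (simp_all add: continuous_on_eq_continuous_at)
qed

lemma omega_nonneg: "pullback_omega h f z \<ge> 0"
  using a_nonneg[OF some_chart] pullback_omega_eq[OF some_chart] by simp

text \<open>Divide \<open>a_zzbar\<close> = a^2 + g(W,W) by a; the right-hand side is
  \<partial>\<partial>bar log a - a.\<close>

lemma perp_ratio_eq:
  assumes z: "z \<in> U i" and n: "pullback_omega h f z \<noteq> 0"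
  shows "perp_ratio (F i z) (lc.W i z) (lc.F1 i z) =
    omega_zzbar z / pullback_omega h f z - (norm (omega_z z))\<^sup>2 / (pullback_omega h f z)\<^sup>2 - pullback_omega h f z"
  using n unfolding omega_z_eq[OF z] omega_zz_eq[OF z] pullback_omega_eq[OF z]
  by (simp add: perp_ratio_def lc.a_def[symmetric] lc.a_z_def lc.a_zzbar_def add_divide_distrib power2_eq_square)

lemma psi_norm2_eq:
  assumes n: "pullback_omega h f z \<noteq> 0"
  shows "psi_norm2 h f z = omega_zzbar z / pullback_omega h f z - (norm (omega_z z))\<^sup>2 / (pullback_omega h f z)\<^sup>2 - pullback_omega h f z"
    (is "_ = ?q")
  unfolding psi_norm2_def
proof (rule the_equality)
  have n': "lc.F1 i z \<noteq> 0" if "z \<in> U i" for i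
    using n that pullback_omega_eq a_eq_0_iff by metis
  have *: "?q = Re (pullback_metric h f i z (psi h f i z X) (psi h f i z X)) / Re (pullback_metric h f i z X X)"
    if "z \<in> U i" "X \<in> lift_line f i z" "X \<noteq> 0" for i X
    using psi_quotient[OF that(1) n'[OF that(1)] that(2,3)] perp_ratio_eq[OF that(1) n] by simp
  then show "\<forall>i. z \<in> U i \<longrightarrow> (\<forall>X\<in>lift_line f i z. X \<noteq> 0 \<longrightarrow>
      ?q = Re (pullback_metric h f i z (psi h f i z X) (psi h f i z X)) / Re (pullback_metric h f i z X X))"
    by blast
  fix q assume q: "\<forall>i. z \<in> U i \<longrightarrow> (\<forall>X\<in>lift_line f i z. X \<noteq> 0 \<longrightarrow>
      q = Re (pullback_metric h f i z (psi h f i z X) (psi h f i z X)) / Re (pullback_metric h f i z X X))"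
  have "lc.F1 (some_chart z) z \<in> lift_line f (some_chart z) z" using F1_in_lift_line[OF some_chart, of 1 z] by simp
  with q * n'[OF some_chart] some_chart show "q = ?q" by metis
qed

section \<open>Control near the zeros\<close>

text \<open>Let F1 = \<phi> s with s nonvanishing and \<phi> a power of \<zeta> - z0, and let
  \<open>w\<close> = \<nabla>s. Off the zeros the norm of \<psi> is the \<open>perp_ratio\<close> of
  \<open>w\<close> and \<open>s\<close>. This is continuous at z0, since the line spanned by
  \<open>s z0\<close> is positive, and the same factorisation shows that z0 is the only zero
  nearby.\<close>

lemma local_zero_and_bound:
  "\<exists>N B. open N \<and> z0 \<in> N \<and> (\<forall>\<zeta>\<in>N. pullback_omega h f \<zeta> = 0 \<longrightarrow> \<zeta> = z0) \<and>
     (\<forall>\<zeta>\<in>N. pullback_omega h f \<zeta> \<noteq> 0 \<longrightarrow> \<bar>psi_norm2 h f \<zeta>\<bar> \<le> B)"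
proof -
  obtain i where z0: "z0 \<in> U i" using U_cover by blast
  obtain s m V where V: "open V" "z0 \<in> V" "V \<subseteq> U i" and s: "vec_holomorphic_on s V"
    "\<And>w. w \<in> V \<Longrightarrow> s w \<noteq> 0" "\<And>w. w \<in> V \<Longrightarrow> lc.F1 i w = (w - z0) ^ m *s s w"
    "\<And>w. w \<in> V \<Longrightarrow> s w \<in> chart_fibre i" "lift_generator f i z0 s"
    using local_generator[OF z0] by metis
  have cs: "continuous_on V s" "continuous_on V (vderiv s)"
    using s(1) V(1) vec_holomorphic_on_vderiv continuous_on_vec_holomorphic by blast+
  have cF: "continuous_on V (F i)" "continuous_on V (lc.F1 i)"
    using lc.cont(1,2)[of i] V(3) continuous_on_subset by blast+
  have nzV: "h (F i \<zeta>) (F i \<zeta>) \<noteq> 0" if "\<zeta> \<in> V" for \<zeta> using F_props(6) V(3) that by blast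
  define w where "w \<zeta> = vderiv s \<zeta> + qconn (F i \<zeta>) (lc.F1 i \<zeta>) (s \<zeta>)" for \<zeta>
  have cw: "continuous_on V w"
    unfolding w_def by (intro continuous_intros continuous_on_qconn cs cF nzV)
  define S where "S \<zeta> = Re (qmetric (F i \<zeta>) (s \<zeta>) (s \<zeta>))" for \<zeta>
  have cS: "continuous_on V S" unfolding S_def by (intro continuous_intros continuous_on_qmetric cs cF nzV)
  define T where "T = V \<inter> S -` {0<..}"
  have T: "open T" unfolding T_def by (rule continuous_open_preimage[OF cS V(1)]) auto
  have "s z0 \<in> lift_line f i z0"
    using s(5) unfolding lift_line_def by (auto intro: vec.span_base)
  then have "S z0 > 0"
    using lift_pos z0 s(2)[OF V(2)] unfolding lift_in_positive_lines_def S_def pullback_metric_eq[OF z0, symmetric] by blast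
  then have z0T: "z0 \<in> T" using V(2) by (simp add: T_def)
  have TV: "T \<subseteq> V" by (auto simp: T_def)
  define q where "q \<zeta> = perp_ratio (F i \<zeta>) (w \<zeta>) (s \<zeta>)" for \<zeta>
  have "continuous_on T q"
    unfolding q_def perp_ratio_def
    by (intro continuous_intros continuous_on_qmetric continuous_on_subset[OF cF(1) TV] continuous_on_subset[OF cs(1) TV] continuous_on_subset[OF cw TV])
      (use nzV in \<open>auto simp: T_def S_def\<close>)
  then have "isCont q z0" using T z0T continuous_on_eq_continuous_at by blast
  then obtain d where d: "d > 0" "\<And>\<zeta>. dist \<zeta> z0 < d \<Longrightarrow> \<bar>q \<zeta> - q z0\<bar> < 1"
    unfolding continuous_at_eps_delta dist_real_def by (metis zero_less_one)
  have qeq: "psi_norm2 h f \<zeta> = q \<zeta>" if \<zeta>: "\<zeta> \<in> T" and n: "pullback_omega h f \<zeta> \<noteq> 0" for \<zeta>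
  proof -
    have \<zeta>V: "\<zeta> \<in> V" and \<zeta>U: "\<zeta> \<in> U i" using \<zeta> TV V(3) by auto
    define \<phi> where "\<phi> = (\<lambda>\<zeta>. (\<zeta> - z0) ^ m)"
    have e: "lc.F1 i \<zeta> = \<phi> \<zeta> *s s \<zeta>" using s(3)[OF \<zeta>V] by (simp add: \<phi>_def)
    have "lc.F1 i \<zeta> \<noteq> 0" using n pullback_omega_eq[OF \<zeta>U] a_eq_0_iff[OF \<zeta>U] by simp
    then have p0: "\<phi> \<zeta> \<noteq> 0" using e by auto
    have "\<phi> holomorphic_on V" unfolding \<phi>_def by (intro holomorphic_intros)
    then have "lc.F2 i \<zeta> = deriv \<phi> \<zeta> *s s \<zeta> + \<phi> \<zeta> *s vderiv s \<zeta>"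
      unfolding lc.F2_def by (rule vderiv_smult[OF _ s(1) V(1) \<zeta>V]) (use s(3) in \<open>simp add: \<phi>_def\<close>)
    then have W: "lc.W i \<zeta> = deriv \<phi> \<zeta> *s s \<zeta> + \<phi> \<zeta> *s w \<zeta>"
      unfolding lc.W_def w_def by (subst (2) e) (simp add: qconn_simps vec_eq_iff algebra_simps)
    have g: "qmetric (F i \<zeta>) (s \<zeta>) (s \<zeta>) \<noteq> 0" using \<zeta> by (auto simp: T_def S_def)
    have "psi_norm2 h f \<zeta> = perp_ratio (F i \<zeta>) (lc.W i \<zeta>) (lc.F1 i \<zeta>)"
      using psi_norm2_eq[OF n] perp_ratio_eq[OF \<zeta>U n] by simp
    also have "\<dots> = q \<zeta>" unfolding W e q_def by (rule perp_ratio_invariant[OF p0 g])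
    finally show ?thesis .
  qed
  show ?thesis
  proof (intro exI[of _ "T \<inter> ball z0 d"] exI[of _ "\<bar>q z0\<bar> + 1"] conjI ballI impI)
    show "z0 \<in> T \<inter> ball z0 d" using z0T d by simp
    fix \<zeta> assume \<zeta>: "\<zeta> \<in> T \<inter> ball z0 d"
    show "\<zeta> = z0" if "pullback_omega h f \<zeta> = 0"
    proof -
      have \<zeta>V: "\<zeta> \<in> V" and \<zeta>U: "\<zeta> \<in> U i" using \<zeta> TV V(3) by auto
      have "lc.F1 i \<zeta> = 0" using that pullback_omega_eq[OF \<zeta>U] a_eq_0_iff[OF \<zeta>U] by simp
      then show ?thesis using s(2,3)[OF \<zeta>V] by auto
    qed
    show "\<bar>psi_norm2 h f \<zeta>\<bar> \<le> \<bar>q z0\<bar> + 1" if "pullback_omega h f \<zeta> \<noteq> 0"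
      using qeq[of \<zeta>] d(2)[of \<zeta>] \<zeta> that by (auto simp: dist_commute)
  qed (use T in auto)
qed

text \<open>Each neighbourhood contains at most its own centre as a zero, so the centres of a
  countable subcover contain all zeros.\<close>

lemma countable_zeros: "countable {z. pullback_omega h f z = 0}"
proof -
  obtain N where N: "\<And>z. open (N z)" "\<And>z. z \<in> N z" "\<And>z \<zeta>. \<zeta> \<in> N z \<Longrightarrow> pullback_omega h f \<zeta> = 0 \<Longrightarrow> \<zeta> = z"
    using local_zero_and_bound by metis
  obtain \<F> where \<F>: "\<F> \<subseteq> range N" "countable \<F>" "\<Union>\<F> = \<Union>(range N)"
    using Lindelof[of "range N"] N(1) by (metis imageE)
  obtain C where C: "countable C" "\<F> = N ` C"
    using \<F>(1,2) by (metis countable_subset_image subset_UNIV)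
  have "{z. pullback_omega h f z = 0} \<subseteq> C"
  proof
    fix \<zeta> assume "\<zeta> \<in> {z. pullback_omega h f z = 0}"
    moreover obtain z where "z \<in> C" "\<zeta> \<in> N z" using \<F>(3) C N(2) by blast
    ultimately show "\<zeta> \<in> C" using N(3) by blast
  qed
  then show ?thesis using C countable_subset by blast
qed

lemma psi_norm2_locally_bounded:
  "\<exists>B. \<forall>z. norm z \<le> R \<longrightarrow> pullback_omega h f z \<noteq> 0 \<longrightarrow> \<bar>psi_norm2 h f z\<bar> \<le> B"
proof -
  obtain N B where N: "\<And>z. open (N z)" "\<And>z. z \<in> N z"
    "\<And>z \<zeta>. \<zeta> \<in> N z \<Longrightarrow> pullback_omega h f \<zeta> \<noteq> 0 \<Longrightarrow> \<bar>psi_norm2 h f \<zeta>\<bar> \<le> B z"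
    using local_zero_and_bound by metis
  have "cball 0 R \<subseteq> (\<Union>z\<in>UNIV. N z)" using N(2) by auto
  then obtain C where "C \<subseteq> UNIV" and C: "finite C" "cball 0 R \<subseteq> (\<Union>z\<in>C. N z)"
    by (rule compactE_image[OF compact_cball N(1)])
  show ?thesis
  proof (intro exI[of _ "\<Sum>z\<in>C. \<bar>B z\<bar>"] allI impI)
    fix \<zeta> :: complex assume "norm \<zeta> \<le> R" and n: "pullback_omega h f \<zeta> \<noteq> 0"
    then have "\<zeta> \<in> cball 0 R" by simp
    then obtain z where z: "z \<in> C" "\<zeta> \<in> N z" using C(2) by blast
    then have "\<bar>psi_norm2 h f \<zeta>\<bar> \<le> \<bar>B z\<bar>" using N(3)[OF z(2) n] by simp
    also have "\<dots> \<le> (\<Sum>z\<in>C. \<bar>B z\<bar>)" using C z by (intro member_le_sum) auto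
    finally show "\<bar>psi_norm2 h f \<zeta>\<bar> \<le> (\<Sum>z\<in>C. \<bar>B z\<bar>)" .
  qed
qed

text \<open>A nonzero velocity of \<open>f\<close> supplies a positive vector at which the assumed
  constant can be compared with the computed curvature.\<close>

lemma gamma_eq_1:
  assumes "hol_sect_curv_pos_eq h (- \<gamma>)"
  shows "\<gamma> = 1"
proof -
  obtain i where "0 \<in> U i" using U_cover by blast
  then obtain z where z: "z \<in> U i" "lc.F1 i z \<noteq> 0"
    using F1_not_locally_zero[OF open_U _ subset_refl] by blast
  have x: "F i z \<in> pos_region h i" using F_props[OF z(1)] by (simp add: pos_region_eq)
  have p: "Re (qmetric (F i z) (lc.F1 i z) (lc.F1 i z)) > 0" using a_pos[OF z] by (simp add: lc.a_def)
  have "hol_sect_curv h i (F i z) (lc.F1 i z) = of_real (- \<gamma>)"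
    using assms x fibre(1)[OF z(1)] p omega_metric_eq[OF F_props(5)[OF z(1)]]
    unfolding hol_sect_curv_pos_eq_def by simp
  then have "complex_of_real (- \<gamma>) = complex_of_real (- 1)"
    using hol_sect_curv_eq[OF x fibre(1)[OF z(1)] p] by simp
  then show ?thesis unfolding of_real_eq_iff by simp
qed

end

theorem theorem6p15:
  fixes h :: "complex^'n \<Rightarrow> complex^'n \<Rightarrow> complex"
    and p :: nat
    and f :: "complex \<Rightarrow> (complex^'n) set"
    and \<gamma> :: real
  assumes "CARD('n) = 3 + p"
    and "hermitian_form h" and "has_signature h 3 p"
    and "holomorphic_curve f" and "\<And>z. f z \<in> pos_domain h" and "\<not> f constant_on UNIV"
    and "lift_in_positive_lines h f"
    and "\<gamma> > 0" and "hol_sect_curv_pos_eq h (- \<gamma>)"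
  shows "\<exists>C>0. \<exists>E. E \<subseteq> {1..} \<and> E \<in> lmeasurable \<and>
           (\<forall>r. r \<ge> 1 \<and> r \<notin> E \<longrightarrow>
              \<gamma> * characteristic (pullback_omega h f) r + characteristic (psi_norm2 h f) r
                \<le> C * (ln r + ln (characteristic (pullback_omega h f) r)))"
proof -
  \<comment> \<open>The signature supplies the nondegeneracy of \<open>h\<close>, on which
    uniqueness of the Chern connection rests.\<close>
  interpret positive_curve h f
    using assms has_signature_nondegenerate by unfold_locales blast+
  have "\<gamma> = 1" using assms(9) by (rule gamma_eq_1)
  then show ?thesis
    using characteristic_bound_outside_exceptional_set[OF omega_nonneg
        has_derivative_omega_chart[OF some_chart, folded omega_z_def] has_derivative_omega_z_chart[OF some_chart, folded omega_zz_def omega_zzbar_def]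
        continuous_omega_zz countable_zeros psi_norm2_eq psi_norm2_locally_bounded]
    by simp
qed

end
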